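(* Let $\alpha,\beta>-1$, let $m\ge 0$ and $\mu\ge 0$ be integers, let $g\in C^\infty[-1,1]$, and let $\mathcal P_N^f$ denote the Jacobi orthogonal projection of $f$ with parameters $(\alpha,\beta)$. Then, as $N\to\infty$, the following hold. (i) If $f(x)=(1-x)^{\gamma}\ln^{\mu}(1-x)\,g(x)$ with $\gamma\in\mathbb R$ and $\min\{\alpha+\gamma,\alpha+2\gamma\}>m-1$, then $$\|f-\mathcal P_N^f\|_{H^{m,\alpha,\beta}(\Omega)}=O\big(N^{m-\alpha-2\gamma-1}\ln^{\mu}(N)\big).$$ (ii) If $f(x)=|x-z_0|^{s}\ln^{\mu}|x-z_0|\,g(x)$ with $z_0\in(-1,1)$, $s>m-\frac12$ and $\min\{\alpha,\beta\}\ge-\frac12$, then $$\|f-\mathcal P_N^f\|_{H^{m,\alpha,\beta}(\Omega)}=O\big(N^{m-s-1/2}\ln^{\mu}(N)\big).$$ (iii) If $f(x)=(1+x)^{\delta}\ln^{\mu}(1+x)\,g(x)$ with $\delta\in\mathbb R$ and $\min\{\beta+\delta,\beta+2\delta\}>m-1$, then $$\|f-\mathcal P_N^f\|_{H^{m,\alpha,\beta}(\Omega)}=O\big(N^{m-\beta-2\delta-1}\ln^{\mu}(N)\big).$$ Furthermore, if $\mu$ is a positive integer and $\gamma$ (respectively $\delta$) is an integer, then in case (i) (respectively case (iii)) the factor $\ln^{\mu}(N)$ may be replaced by $\ln^{\mu-1}(N)$.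
   Context: $\Omega=(-1,1)$. For $\alpha,\beta>-1$, $P_n^{(\alpha,\beta)}$ is the Jacobi polynomial of degree $n$ (standard normalization), $\sigma_n^{\alpha,\beta}=\int_{-1}^1(1-x)^\alpha(1+x)^\beta [P_n^{(\alpha,\beta)}(x)]^2\,dx$, and the Jacobi coefficients of $f$ are $$a_n(\alpha,\beta)=\frac{1}{\sigma_n^{\alpha,\beta}}\int_{-1}^{1}(1-x)^{\alpha}(1+x)^{\beta}f(x)P_n^{(\alpha,\beta)}(x)\,dx.$$ The Jacobi orthogonal projection is $\mathcal P_N^f(x)=\sum_{n=0}^N a_n(\alpha,\beta)P_n^{(\alpha,\beta)}(x)$. The non-uniformly Jacobi-weighted Sobolev norm is $$\|u\|_{H^{m,\alpha,\beta}(\Omega)}=\Big\{\sum_{j=0}^m\int_{-1}^1(1-x)^{\alpha+j}(1+x)^{\beta+j}[u^{(j)}(x)]^2\,dx\Big\}^{1/2}.$$ The constants in the $O$-terms may depend on everything except $N$.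
   Formalization: In the final "Furthermore", "γ (respectively δ) is an integer" is restricted to nonnegative integers; for negative integers the claim fails, e.g. m=0, α=2, β=0, γ=-1, μ=1, g=1, where the error is of exact order N^{-1} ln N. *)

theory Defs
  imports "HOL-Analysis.Analysis" "HOL-Library.Landau_Symbols"
begin

text \<open>
  Jacobi polynomials with the standard normalization
  \<open>P\<^sub>n(1) = (n + \<alpha>) gchoose n\<close>, in the explicit form obtained by applying the
  Leibniz rule to Rodrigues' formula
  \<open>(1-x)\<^sup>\<alpha> (1+x)\<^sup>\<beta> P\<^sub>n(x) = (-1)\<^sup>n / (2\<^sup>n n!) (d/dx)\<^sup>n ((1-x)\<^sup>\<alpha>\<^sup>+\<^sup>n (1+x)\<^sup>\<beta>\<^sup>+\<^sup>n)\<close>.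
  Unlike the Gamma-function forms, it has no exceptional parameter values.
\<close>

definition jacobi_P :: "real \<Rightarrow> real \<Rightarrow> nat \<Rightarrow> real \<Rightarrow> real" where
  "jacobi_P \<alpha> \<beta> n x =
     (\<Sum>k\<le>n. ((real n + \<alpha>) gchoose (n - k)) * ((real n + \<beta>) gchoose k)
            * ((x - 1) / 2) ^ k * ((x + 1) / 2) ^ (n - k))"

lemma jacobi_P_at_1: "jacobi_P \<alpha> \<beta> n 1 = (real n + \<alpha>) gchoose n"
proof -
  have "jacobi_P \<alpha> \<beta> n 1 = (\<Sum>k\<le>n. if k = 0 then (real n + \<alpha>) gchoose n else 0)"
    unfolding jacobi_P_def by (rule sum.cong) auto
  then show ?thesis by simp
qed

definition jacobi_weight :: "real \<Rightarrow> real \<Rightarrow> real \<Rightarrow> real" where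
  "jacobi_weight \<alpha> \<beta> x = (1 - x) powr \<alpha> * (1 + x) powr \<beta>"

definition jacobi_sigma :: "real \<Rightarrow> real \<Rightarrow> nat \<Rightarrow> real" where
  "jacobi_sigma \<alpha> \<beta> n =
     (LINT x:{-1<..<1}|lborel. jacobi_weight \<alpha> \<beta> x * (jacobi_P \<alpha> \<beta> n x)\<^sup>2)"

definition jacobi_coeff :: "real \<Rightarrow> real \<Rightarrow> (real \<Rightarrow> real) \<Rightarrow> nat \<Rightarrow> real" where
  "jacobi_coeff \<alpha> \<beta> f n =
     (1 / jacobi_sigma \<alpha> \<beta> n) *
     (LINT x:{-1<..<1}|lborel. jacobi_weight \<alpha> \<beta> x * f x * jacobi_P \<alpha> \<beta> n x)"

definition jacobi_proj :: "real \<Rightarrow> real \<Rightarrow> (real \<Rightarrow> real) \<Rightarrow> nat \<Rightarrow> real \<Rightarrow> real" where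
  "jacobi_proj \<alpha> \<beta> f N x = (\<Sum>n\<le>N. jacobi_coeff \<alpha> \<beta> f n * jacobi_P \<alpha> \<beta> n x)"

text \<open>
  \<open>C\<^sup>\<infinity>\<close> on a set, used for a compact interval: derivatives of all orders exist on the set,
  and are one-sided at the end points.
\<close>

definition smooth_on :: "real set \<Rightarrow> (real \<Rightarrow> real) \<Rightarrow> bool" where
  "smooth_on S g \<longleftrightarrow>
     (\<exists>D :: nat \<Rightarrow> real \<Rightarrow> real. (\<forall>x\<in>S. D 0 x = g x) \<and>
        (\<forall>k. \<forall>x\<in>S. (D k has_real_derivative D (Suc k) x) (at x within S)))"

definition jacobi_sobolev_norm ::
    "nat \<Rightarrow> real \<Rightarrow> real \<Rightarrow> (real \<Rightarrow> real) \<Rightarrow> real" where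
  "jacobi_sobolev_norm m \<alpha> \<beta> u =
     sqrt (\<Sum>j\<le>m. (LINT x:{-1<..<1}|lborel.
        jacobi_weight (\<alpha> + real j) (\<beta> + real j) x * ((deriv ^^ j) u x)\<^sup>2))"

text \<open>
  The functions on \<open>(-1, 1)\<close> for which the above norm is meaningful and finite.  The weak
  derivatives are described in the usual one-dimensional way: for \<open>j < m\<close>, the function
  \<open>(deriv ^^ j) u\<close> is a locally absolutely continuous function, namely a primitive of its almost
  everywhere derivative \<open>(deriv ^^ Suc j) u\<close>.  In particular \<open>(deriv ^^ m) u\<close> may be undefined
  (hence an arbitrary value) on a null set only, and none of the integrals in
  \<open>jacobi_sobolev_norm\<close> is zero by virtue of being divergent.
\<close>

definition jacobi_sobolev :: "nat \<Rightarrow> real \<Rightarrow> real \<Rightarrow> (real \<Rightarrow> real) set" where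
  "jacobi_sobolev m \<alpha> \<beta> = {u.
     (\<forall>j\<le>m. set_borel_measurable lborel {-1<..<1} ((deriv ^^ j) u) \<and>
        set_integrable lborel {-1<..<1}
          (\<lambda>x. jacobi_weight (\<alpha> + real j) (\<beta> + real j) x * ((deriv ^^ j) u x)\<^sup>2)) \<and>
     (\<forall>j<m. \<forall>a b. -1 < a \<and> a \<le> b \<and> b < 1 \<longrightarrow>
        set_integrable lborel {a..b} ((deriv ^^ Suc j) u) \<and>
        (LINT x:{a..b}|lborel. (deriv ^^ Suc j) u x) = (deriv ^^ j) u b - (deriv ^^ j) u a)}"

end

theory Submission
  imports Defs "HOL-Computational_Algebra.Polynomial"
begin

text \<open>
  All three cases are instances of \<open>f x = \<bar>x - z\<bar>\<^sup>\<gamma> ln\<^sup>\<mu> \<bar>x - z\<bar> g x\<close> with \<open>z \<in> [-1, 1]\<close>, and the proof is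
  a K-functional argument which needs no asymptotics of Jacobi polynomials. With the length scale
  \<open>h = N\<^sup>-\<^sup>2\<close> (\<open>z = \<plusminus>1\<close>) or \<open>h = N\<^sup>-\<^sup>1\<close> (\<open>z\<close> interior), write
  \<open>ln \<bar>x - z\<bar> = ln (\<bar>x - z\<bar> / h) + ln h\<close> and expand \<open>f\<close> into terms
  \<open>(ln h)\<^sup>\<mu>\<^sup>-\<^sup>i F\<^sub>i\<close> with the scale-invariant functions \<open>F\<^sub>i x = \<bar>x - z\<bar>\<^sup>\<gamma> ln\<^sup>i (\<bar>x - z\<bar> / h) g x\<close>. A cutoff at
  distance \<open>h\<close> splits each \<open>F\<^sub>i\<close> into a near part, which is small in the weighted norms and whose
  projection is controlled by the inverse inequality, and a smooth far part. For the latter,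
  derivatives of Jacobi polynomials are Jacobi polynomials with shifted parameters, so differentiation
  commutes with the projection, and iterating the Poincare inequality on the orthogonal complement of
  the polynomials of degree \<open>\<le> N\<close> gains a factor \<open>1 / N\<close> per derivative. If \<open>z = \<plusminus>1\<close> and \<open>\<gamma>\<close> is a
  natural number, then \<open>F\<^sub>0\<close> is smooth and the term with \<open>(ln h)\<^sup>\<mu>\<close> is negligible.
\<close>

subsection \<open>Jacobi polynomials\<close>

text \<open>The powers of N balance as follows. The j-th derivative is measured with both weight
  parameters raised by j. In these squared norms a derivative of a polynomial of degree N costs a
  factor of order N^2, not N^4, and each derivative of a smooth function gains N^-2, uniformly up to
  the end points. Differentiating at distance r from z costs r^(\<kappa> - 2), which is N^2 at r =
  N^-\<rho> because \<open>\<rho> * (2 - \<kappa>) = 2\<close>. Hence the near part, its projection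
  and the error of the far part all have the same order. Powers of ln (r / h) are bounded by small
  powers of r / h or h / r. These change constants but not the exponent of h, since the near
  integrals converge at z, and the far ones at infinity, with some room; so logarithms of N enter
  through ln h alone. The Poincare inequality is proved for functions that are C^1 up to the end
  points, so the singularity is cut out even if z is an end point. The iterated \<open>deriv\<close>
  is uncontrolled at z; hence every function carries an explicit sequence of derivatives.\<close>

lemma gbinomial_Suc_mult:
  fixes a :: real
  shows "real (Suc k) * (a gchoose Suc k) = (a - real k) * (a gchoose k)"
  using gbinomial_mult_1[of a k] by (simp add: algebra_simps)

definition jacobi_cf :: "real \<Rightarrow> real \<Rightarrow> nat \<Rightarrow> nat \<Rightarrow> real" where
  "jacobi_cf a b n k = ((real n + a) gchoose (n - k)) * ((real n + b) gchoose k)"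

lemma jacobi_P_alt:
  "jacobi_P a b n x = (\<Sum>k\<le>n. jacobi_cf a b n k * (((x - 1) / 2) ^ k * ((x + 1) / 2) ^ (n - k)))"
  by (simp add: jacobi_P_def jacobi_cf_def mult_ac)

text \<open>In the derivative of P_{n+1} the product with exponents k and n - k arises from two
  neighbouring terms. This identity and the next one express both contributions through one
  coefficient of the polynomial with shifted parameters; the factors k + a + 1 and n - k + b + 1 add
  up to a number free of k.\<close>

lemma jacobi_cf_left:
  assumes "k \<le> n"
  shows "real (Suc n - k) * jacobi_cf a b (Suc n) k = (real k + a + 1) * jacobi_cf (a + 1) (b + 1) n k"
proof -
  have *: "Suc n - k = Suc (n - k)" using assms by simp
  have "real (Suc (n - k)) * ((real (Suc n) + a) gchoose Suc (n - k))
      = (real (Suc n) + a - real (n - k)) * ((real (Suc n) + a) gchoose (n - k))"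
    by (rule gbinomial_Suc_mult)
  moreover have "real (Suc n) + a - real (n - k) = real k + a + 1"
    using assms by (simp add: of_nat_diff)
  moreover have e: "real (Suc n) + a = real n + (a + 1)" "real (Suc n) + b = real n + (b + 1)" by auto
  ultimately show ?thesis unfolding jacobi_cf_def * e by (metis mult.assoc)
qed

lemma jacobi_cf_right:
  assumes "k \<le> n"
  shows "real (Suc k) * jacobi_cf a b (Suc n) (Suc k)
    = (real (n - k) + b + 1) * jacobi_cf (a + 1) (b + 1) n k"
proof -
  have "real (Suc k) * ((real (Suc n) + b) gchoose Suc k)
      = (real (Suc n) + b - real k) * ((real (Suc n) + b) gchoose k)"
    by (rule gbinomial_Suc_mult)
  moreover have "real (Suc n) + b - real k = real (n - k) + b + 1"
    using assms by (simp add: of_nat_diff)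
  moreover have e: "real (Suc n) + a = real n + (a + 1)" "real (Suc n) + b = real n + (b + 1)" by auto
  moreover have "Suc n - Suc k = n - k" by simp
  ultimately show ?thesis unfolding jacobi_cf_def e by (metis mult.assoc mult.commute)
qed

lemma jacobi_P_deriv:
  "(jacobi_P a b (Suc n) has_real_derivative
     (real n + a + b + 2) / 2 * jacobi_P (a + 1) (b + 1) n x) (at x within S)"
proof -
  define X Y where "X = (x - 1) / 2" and "Y = (x + 1) / 2"
  let ?c = "jacobi_cf a b (Suc n)" and ?d = "jacobi_cf (a + 1) (b + 1) n"
  have d: "((\<lambda>x. ((x - 1) / 2) ^ k * ((x + 1) / 2) ^ (Suc n - k)) has_real_derivative
     (real k * X ^ (k - 1) * Y ^ (Suc n - k) + real (Suc n - k) * X ^ k * Y ^ (n - k)) / 2)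
       (at x within S)" if "k \<le> Suc n" for k
    unfolding X_def Y_def
    by ((rule derivative_eq_intros refl | simp)+)?
  have "((\<lambda>x. \<Sum>k\<le>Suc n. ?c k * (((x - 1) / 2) ^ k * ((x + 1) / 2) ^ (Suc n - k)))
      has_real_derivative (\<Sum>k\<le>Suc n. ?c k * ((real k * X ^ (k - 1) * Y ^ (Suc n - k)
        + real (Suc n - k) * X ^ k * Y ^ (n - k)) / 2))) (at x within S)"
    by (intro DERIV_sum DERIV_cmult d) auto
  also have "(\<Sum>k\<le>Suc n. ?c k * ((real k * X ^ (k - 1) * Y ^ (Suc n - k)
        + real (Suc n - k) * X ^ k * Y ^ (n - k)) / 2))
      = (\<Sum>k\<le>Suc n. real k * ?c k * X ^ (k - 1) * Y ^ (Suc n - k)) / 2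
        + (\<Sum>k\<le>Suc n. real (Suc n - k) * ?c k * X ^ k * Y ^ (n - k)) / 2"
    unfolding sum_divide_distrib sum.distrib[symmetric]
    by (intro sum.cong refl) (simp add: field_simps)
  also have "(\<Sum>k\<le>Suc n. real k * ?c k * X ^ (k - 1) * Y ^ (Suc n - k))
     = (\<Sum>k\<le>n. (real (n - k) + b + 1) * ?d k * X ^ k * Y ^ (n - k))"
    by (subst sum.atMost_Suc_shift)
       (auto simp del: of_nat_Suc of_nat_diff intro!: sum.cong simp: jacobi_cf_right[symmetric])
  also have "(\<Sum>k\<le>Suc n. real (Suc n - k) * ?c k * X ^ k * Y ^ (n - k))
     = (\<Sum>k\<le>n. (real k + a + 1) * ?d k * X ^ k * Y ^ (n - k))"
    by (subst sum.atMost_Suc) (auto intro!: sum.cong simp: jacobi_cf_left[symmetric])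
  also have "(\<Sum>k\<le>n. (real (n - k) + b + 1) * ?d k * X ^ k * Y ^ (n - k)) / 2
      + (\<Sum>k\<le>n. (real k + a + 1) * ?d k * X ^ k * Y ^ (n - k)) / 2
      = (\<Sum>k\<le>n. (real n + a + b + 2) / 2 * (?d k * (X ^ k * Y ^ (n - k))))"
    unfolding sum_divide_distrib sum.distrib[symmetric]
    by (intro sum.cong refl) (simp add: field_simps of_nat_diff)
  also have "\<dots> = (real n + a + b + 2) / 2 * jacobi_P (a + 1) (b + 1) n x"
    by (simp add: jacobi_P_alt X_def Y_def sum_distrib_left)
  finally show ?thesis
    by (simp add: jacobi_P_alt[abs_def])
qed

lemma jacobi_P_0 [simp]: "jacobi_P a b 0 x = 1"
  by (simp add: jacobi_P_def)

lemma continuous_on_jacobi_P [continuous_intros]: "continuous_on S (jacobi_P a b n)"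
  unfolding jacobi_P_alt[abs_def] by (auto intro!: continuous_intros)

lemma jacobi_P_measurable [measurable]: "jacobi_P a b n \<in> borel_measurable borel"
  by (intro borel_measurable_continuous_onI continuous_on_jacobi_P)

lemma jacobi_weight_measurable [measurable]: "jacobi_weight a b \<in> borel_measurable borel"
  unfolding jacobi_weight_def[abs_def] by measurable

lemma jacobi_weight_nonneg [simp]: "jacobi_weight a b x \<ge> 0"
  by (simp add: jacobi_weight_def)

lemma jacobi_weight_pos: "x \<in> {-1<..<1} \<Longrightarrow> jacobi_weight a b x > 0"
  by (simp add: jacobi_weight_def)

lemma jacobi_weight_add:
  "x \<in> {-1<..<1} \<Longrightarrow> jacobi_weight (a + 1) (b + 1) x = jacobi_weight a b x * ((1 - x) * (1 + x))"
  by (simp add: jacobi_weight_def powr_add)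

text \<open>One step of Rodrigues' formula.\<close>

lemma jacobi_weight_P_deriv:
  assumes x: "x \<in> {-1<..<1}"
  shows "((\<lambda>x. jacobi_weight (a + 1) (b + 1) x * jacobi_P (a + 1) (b + 1) n x) has_real_derivative
     - 2 * real (Suc n) * jacobi_weight a b x * jacobi_P a b (Suc n) x) (at x within S)"
proof -
  define X Y where "X = (x - 1) / 2" and "Y = (x + 1) / 2"
  let ?c = "jacobi_cf a b (Suc n)" and ?d = "jacobi_cf (a + 1) (b + 1) n" and ?w = "jacobi_weight a b"
  have w: "((\<lambda>x. jacobi_weight (a + 1) (b + 1) x) has_real_derivative
      ?w x * ((b + 1) * (1 - x) - (a + 1) * (1 + x))) (at x within S)"
  proof -
    have "((\<lambda>y. y powr (a + 1)) has_real_derivative (a + 1) * (1 - x) powr a) (at (1 - x))"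
      using has_real_derivative_powr[of "1 - x" "a + 1"] x by simp
    from this have 1:
      "((\<lambda>x. (1 - x) powr (a + 1)) has_real_derivative (a + 1) * (1 - x) powr a * (-1)) (at x within S)"
      by (rule DERIV_chain2[where f="\<lambda>y. y powr (a + 1)" and g="\<lambda>x. 1 - x" and x=x and s=S and Db="-1"]) (auto intro!: derivative_eq_intros)
    have "((\<lambda>y. y powr (b + 1)) has_real_derivative (b + 1) * (1 + x) powr b) (at (1 + x))"
      using has_real_derivative_powr[of "1 + x" "b + 1"] x by simp
    from this have 2:
      "((\<lambda>x. (1 + x) powr (b + 1)) has_real_derivative (b + 1) * (1 + x) powr b * 1) (at x within S)"
      by (rule DERIV_chain2[where f="\<lambda>y. y powr (b + 1)" and g="\<lambda>x. 1 + x" and x=x and s=S and Db=1]) (auto intro!: derivative_eq_intros)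
    show ?thesis unfolding jacobi_weight_def
      by (rule DERIV_cong[OF DERIV_mult[OF 1 2]]) (use x in \<open>simp add: powr_add algebra_simps power2_eq_square\<close>)
  qed
  have p: "((\<lambda>x. ((x - 1) / 2) ^ k * ((x + 1) / 2) ^ (n - k)) has_real_derivative
     (real k * X ^ (k - 1) * Y ^ (n - k) + real (n - k) * X ^ k * Y ^ (n - k - 1)) / 2)
       (at x within S)" for k
    unfolding X_def Y_def
    by ((rule derivative_eq_intros refl | simp)+)?
  have d: "((\<lambda>x. jacobi_weight (a + 1) (b + 1) x * (((x - 1) / 2) ^ k * ((x + 1) / 2) ^ (n - k)))
      has_real_derivative
     - 2 * ?w x * ((real k + a + 1) * X ^ k * Y ^ (Suc n - k)
           + (real (n - k) + b + 1) * X ^ Suc k * Y ^ (n - k))) (at x within S)"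
    if k: "k \<le> n" for k
  proof -
    \<comment> \<open>After multiplication by the missing factor the truncated exponents are
      harmless: where truncation occurs, the coefficient is 0.\<close>
    have e1: "X * (real k * X ^ (k - 1)) = real k * X ^ k" by (cases k) auto
    have e2: "Y * (real (n - k) * Y ^ (n - k - 1)) = real (n - k) * Y ^ (n - k)"
      by (cases "n - k") auto
    have e3: "jacobi_weight (a + 1) (b + 1) x = ?w x * (- 4 * X * Y)"
      unfolding jacobi_weight_add[OF x] by (simp add: X_def Y_def field_simps)
    have e4: "(b + 1) * (1 - x) - (a + 1) * (1 + x) = - 2 * (b + 1) * X - 2 * (a + 1) * Y"
      by (simp add: X_def Y_def field_simps)
    have e5: "Y ^ (Suc n - k) = Y * Y ^ (n - k)" using k by (simp add: Suc_diff_le)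
    have "?w x * ((b + 1) * (1 - x) - (a + 1) * (1 + x)) * (X ^ k * Y ^ (n - k)) +
        (real k * X ^ (k - 1) * Y ^ (n - k) + real (n - k) * X ^ k * Y ^ (n - k - 1)) / 2
          * jacobi_weight (a + 1) (b + 1) x
      = ?w x * (- 2 * (b + 1) * X - 2 * (a + 1) * Y) * (X ^ k * Y ^ (n - k)) +
        ?w x * (- 2) * (Y * (X * (real k * X ^ (k - 1))) * Y ^ (n - k)
           + X * X ^ k * (Y * (real (n - k) * Y ^ (n - k - 1))))"
      unfolding e3 e4 by (simp add: field_simps)
    also have "\<dots> = - 2 * ?w x * ((real k + a + 1) * X ^ k * Y ^ (Suc n - k)
           + (real (n - k) + b + 1) * X ^ Suc k * Y ^ (n - k))"
      unfolding e1 e2 e5 by (simp add: algebra_simps)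
    finally show ?thesis
      using DERIV_mult[OF w p[of k]] by (simp add: X_def Y_def)
  qed
  have "((\<lambda>x. \<Sum>k\<le>n. ?d k * (jacobi_weight (a + 1) (b + 1) x
           * (((x - 1) / 2) ^ k * ((x + 1) / 2) ^ (n - k))))
      has_real_derivative (\<Sum>k\<le>n. ?d k * (- 2 * ?w x * ((real k + a + 1) * X ^ k * Y ^ (Suc n - k)
           + (real (n - k) + b + 1) * X ^ Suc k * Y ^ (n - k))))) (at x within S)"
    by (intro DERIV_sum DERIV_cmult d) auto
  also have "(\<Sum>k\<le>n. ?d k * (- 2 * ?w x * ((real k + a + 1) * X ^ k * Y ^ (Suc n - k)
           + (real (n - k) + b + 1) * X ^ Suc k * Y ^ (n - k))))
     = - 2 * ?w x * ((\<Sum>k\<le>n. (real k + a + 1) * ?d k * (X ^ k * Y ^ (Suc n - k)))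
        + (\<Sum>k\<le>n. (real (n - k) + b + 1) * ?d k * (X ^ Suc k * Y ^ (n - k))))"
    unfolding sum_distrib_left sum.distrib[symmetric]
    by (intro sum.cong) (auto simp: algebra_simps)
  \<comment> \<open>The coefficient identities are now read backwards; the factors
    \<open>Suc n - k\<close> and \<open>k\<close> produced in this way add up to
    \<open>Suc n\<close>.\<close>
  also have "(\<Sum>k\<le>n. (real k + a + 1) * ?d k * (X ^ k * Y ^ (Suc n - k)))
     = (\<Sum>k\<le>Suc n. real (Suc n - k) * ?c k * (X ^ k * Y ^ (Suc n - k)))"
    by (subst sum.atMost_Suc) (auto intro!: sum.cong simp: jacobi_cf_left[symmetric])
  also have "(\<Sum>k\<le>n. (real (n - k) + b + 1) * ?d k * (X ^ Suc k * Y ^ (n - k)))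
     = (\<Sum>k\<le>Suc n. real k * ?c k * (X ^ k * Y ^ (Suc n - k)))"
    by (subst sum.atMost_Suc_shift)
       (auto simp del: of_nat_Suc of_nat_diff power_Suc intro!: sum.cong simp: jacobi_cf_right[symmetric])
  also have "(\<Sum>k\<le>Suc n. real (Suc n - k) * ?c k * (X ^ k * Y ^ (Suc n - k)))
      + (\<Sum>k\<le>Suc n. real k * ?c k * (X ^ k * Y ^ (Suc n - k)))
     = (\<Sum>k\<le>Suc n. real (Suc n) * (?c k * (X ^ k * Y ^ (Suc n - k))))"
    unfolding sum.distrib[symmetric]
    by (intro sum.cong) (auto simp: algebra_simps of_nat_diff simp del: power_Suc)
  also have "\<dots> = real (Suc n) * jacobi_P a b (Suc n) x"
    by (simp only: jacobi_P_alt X_def Y_def sum_distrib_left)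
  finally have D: "((\<lambda>x. \<Sum>k\<le>n. ?d k * (jacobi_weight (a + 1) (b + 1) x
      * (((x - 1) / 2) ^ k * ((x + 1) / 2) ^ (n - k)))) has_real_derivative
     - 2 * ?w x * (real (Suc n) * jacobi_P a b (Suc n) x)) (at x within S)" .
  have "(\<lambda>x. jacobi_weight (a + 1) (b + 1) x * jacobi_P (a + 1) (b + 1) n x)
      = (\<lambda>x. \<Sum>k\<le>n. ?d k * (jacobi_weight (a + 1) (b + 1) x
           * (((x - 1) / 2) ^ k * ((x + 1) / 2) ^ (n - k))))"
    by (simp add: jacobi_P_alt sum_distrib_left mult_ac fun_eq_iff)
  with D show ?thesis by (simp only: mult_ac)
qed

section \<open>Power integrals and the weighted measure\<close>

lemma nn_integral_radial_le:
  fixes F :: "real \<Rightarrow> ennreal"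
  assumes [measurable]: "F \<in> borel_measurable borel"
  shows "(\<integral>\<^sup>+x. F \<bar>x - z\<bar> \<partial>lborel) \<le> 2 * (\<integral>\<^sup>+t. indicator {0..} t * F t \<partial>lborel)"
proof -
  let ?G = "\<lambda>t. indicator {0..} t * F t"
  \<comment> \<open>The line is folded at \<open>z\<close>. The point \<open>z\<close> itself is
    counted twice, which the inequality tolerates.\<close>
  have "(\<integral>\<^sup>+x. F \<bar>x - z\<bar> \<partial>lborel) \<le> (\<integral>\<^sup>+x. ?G (- z + 1 * x) + ?G (z + (-1) * x) \<partial>lborel)"
    by (intro nn_integral_mono) (auto simp: abs_if indicator_def)
  also have "\<dots> = (\<integral>\<^sup>+x. ?G (- z + 1 * x) \<partial>lborel) + (\<integral>\<^sup>+x. ?G (z + (-1) * x) \<partial>lborel)"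
    by (intro nn_integral_add) measurable
  also have "(\<integral>\<^sup>+x. ?G (- z + 1 * x) \<partial>lborel) = integral\<^sup>N lborel ?G"
    by (subst nn_integral_real_affine[of ?G 1 "- z"]) auto
  also have "(\<integral>\<^sup>+x. ?G (z + (-1) * x) \<partial>lborel) = integral\<^sup>N lborel ?G"
    by (subst nn_integral_real_affine[of ?G "-1" z]) auto
  finally show ?thesis by (simp add: mult_2)
qed

lemma nn_integral_powr_near:
  fixes p h z :: real
  assumes "p > -1" "h \<ge> 0"
  shows "(\<integral>\<^sup>+x. ennreal (indicator {..h} \<bar>x - z\<bar> * \<bar>x - z\<bar> powr p) \<partial>lborel)
    \<le> ennreal (2 * (h powr (p + 1) / (p + 1)))"
proof -
  have "(\<integral>\<^sup>+t. indicator {0..} t * ennreal (indicator {..h} t * t powr p) \<partial>lborel)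
      = (\<integral>\<^sup>+t. ennreal (indicator {0..h} t * t powr p) \<partial>lborel)"
    by (intro nn_integral_cong) (auto simp: indicator_def)
  also have "\<dots> = ennreal (h powr (p + 1) / (p + 1))"
    using assms by (intro nn_integral_has_integral_lebesgue has_integral_powr_from_0) auto
  finally have "(\<integral>\<^sup>+x. ennreal (indicator {..h} \<bar>x - z\<bar> * \<bar>x - z\<bar> powr p) \<partial>lborel)
    \<le> 2 * ennreal (h powr (p + 1) / (p + 1))"
    using nn_integral_radial_le[of "\<lambda>t. ennreal (indicator {..h} t * t powr p)" z] by simp
  also have "\<dots> = ennreal (2 * (h powr (p + 1) / (p + 1)))"
    using assms by (subst ennreal_mult') auto
  finally show ?thesis .
qed

lemma nn_integral_powr_far:
  fixes p h z :: real
  assumes "p < -1" "h > 0"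
  shows "(\<integral>\<^sup>+x. ennreal (indicator {h..} \<bar>x - z\<bar> * \<bar>x - z\<bar> powr p) \<partial>lborel)
    \<le> ennreal (2 * (h powr (p + 1) / - (p + 1)))"
proof -
  have "(\<integral>\<^sup>+t. indicator {0..} t * ennreal (indicator {h..} t * t powr p) \<partial>lborel)
      = (\<integral>\<^sup>+t. ennreal (indicator {h..} t * t powr p) \<partial>lborel)"
    using assms by (intro nn_integral_cong) (auto simp: indicator_def)
  also have "\<dots> = ennreal (h powr (p + 1) / - (p + 1))"
    using assms has_integral_powr_to_inf[of p h]
    by (intro nn_integral_has_integral_lebesgue) (auto simp only: minus_divide_right divide_minus_left powr_ge_zero)
  finally have "(\<integral>\<^sup>+x. ennreal (indicator {h..} \<bar>x - z\<bar> * \<bar>x - z\<bar> powr p) \<partial>lborel)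
    \<le> 2 * ennreal (h powr (p + 1) / - (p + 1))"
    using nn_integral_radial_le[of "\<lambda>t. ennreal (indicator {h..} t * t powr p)" z] by simp
  also have "\<dots> = ennreal (2 * (h powr (p + 1) / - (p + 1)))"
    using assms by (subst ennreal_mult') (auto simp: field_simps)
  finally show ?thesis .
qed

text \<open>With the weight absorbed into a measure, general facts about integrals and finite
  measures apply directly.\<close>

definition jacobi_measure :: "real \<Rightarrow> real \<Rightarrow> real measure" where
  "jacobi_measure a b =
     density lborel (\<lambda>x. ennreal (indicator {-1<..<1} x * jacobi_weight a b x))"

lemma sets_jacobi_measure [simp, measurable_cong]: "sets (jacobi_measure a b) = sets borel"
  by (simp add: jacobi_measure_def)

lemma space_jacobi_measure [simp]: "space (jacobi_measure a b) = UNIV"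
  by (simp add: jacobi_measure_def)

lemma integrable_jacobi_measure:
  fixes u :: "real \<Rightarrow> real"
  assumes [measurable]: "u \<in> borel_measurable borel"
  shows "integrable (jacobi_measure a b) u
    \<longleftrightarrow> set_integrable lborel {-1<..<1} (\<lambda>x. jacobi_weight a b x * u x)"
  unfolding jacobi_measure_def set_integrable_def
  by (subst integrable_density) (auto simp: mult.assoc)

lemma integral_jacobi_measure:
  fixes u :: "real \<Rightarrow> real"
  assumes [measurable]: "u \<in> borel_measurable borel"
  shows "integral\<^sup>L (jacobi_measure a b) u
    = (LINT x:{-1<..<1}|lborel. jacobi_weight a b x * u x)"
  unfolding jacobi_measure_def set_lebesgue_integral_def
  by (subst integral_density) (auto simp: mult.assoc)

lemma AE_jacobi_measure: "AE x in jacobi_measure a b. x \<in> {-1<..<1} \<and> x \<noteq> z"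
proof -
  have "AE x in lborel. x \<noteq> z"
    by (rule AE_lborel_singleton)
  then show ?thesis unfolding jacobi_measure_def
    by (subst AE_density) (auto simp: indicator_def)
qed

lemma powr_le_2_powr_abs:
  assumes "1 \<le> t" "t \<le> (2::real)"
  shows "t powr p \<le> 2 powr \<bar>p\<bar>"
proof -
  have "t powr p \<le> t powr \<bar>p\<bar>" using assms by (intro powr_mono) auto
  also have "\<dots> \<le> 2 powr \<bar>p\<bar>" using assms by (intro powr_mono2) auto
  finally show ?thesis .
qed

text \<open>At every point one of the two factors has its base in [1, 2] and is bounded by a
  constant; the sum avoids deciding which one.\<close>

lemma jacobi_weight_le:
  assumes "x \<in> {-1<..<1}"
  shows "jacobi_weight a b x \<le> 2 powr \<bar>b\<bar> * (1 - x) powr a + 2 powr \<bar>a\<bar> * (1 + x) powr b"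
proof (cases "x \<ge> 0")
  case True
  have "(1 + x) powr b \<le> 2 powr \<bar>b\<bar>" using True assms by (intro powr_le_2_powr_abs) auto
  then have "(1 - x) powr a * (1 + x) powr b \<le> (1 - x) powr a * 2 powr \<bar>b\<bar>"
    by (intro mult_left_mono) auto
  then show ?thesis by (simp add: jacobi_weight_def mult.commute add_increasing2)
next
  case False
  have "(1 - x) powr a \<le> 2 powr \<bar>a\<bar>" using False assms by (intro powr_le_2_powr_abs) auto
  then have "(1 - x) powr a * (1 + x) powr b \<le> 2 powr \<bar>a\<bar> * (1 + x) powr b"
    by (intro mult_right_mono) auto
  then show ?thesis by (simp add: jacobi_weight_def add_increasing)
qed

lemma finite_measure_jacobi_measure:
  assumes "a > -1" "b > -1"
  shows "finite_measure (jacobi_measure a b)"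
proof
  have "emeasure (jacobi_measure a b) (space (jacobi_measure a b))
      = (\<integral>\<^sup>+x. ennreal (indicator {-1<..<1} x * jacobi_weight a b x) \<partial>lborel)"
    by (simp add: jacobi_measure_def emeasure_density)
  also have "\<dots> \<le> (\<integral>\<^sup>+x. ennreal (2 powr \<bar>b\<bar>) * ennreal (indicator {..2} \<bar>x - 1\<bar> * \<bar>x - 1\<bar> powr a)
       + ennreal (2 powr \<bar>a\<bar>) * ennreal (indicator {..2} \<bar>x - (-1)\<bar> * \<bar>x - (-1)\<bar> powr b) \<partial>lborel)"
  proof (intro nn_integral_mono)
    fix x :: real
    show "ennreal (indicator {-1<..<1} x * jacobi_weight a b x) \<le>
      ennreal (2 powr \<bar>b\<bar>) * ennreal (indicator {..2} \<bar>x - 1\<bar> * \<bar>x - 1\<bar> powr a)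
       + ennreal (2 powr \<bar>a\<bar>) * ennreal (indicator {..2} \<bar>x - (-1)\<bar> * \<bar>x - (-1)\<bar> powr b)"
    proof (cases "x \<in> {-1<..<1}")
      case True
      then have "ennreal (2 powr \<bar>b\<bar>) * ennreal (indicator {..2} \<bar>x - 1\<bar> * \<bar>x - 1\<bar> powr a)
       + ennreal (2 powr \<bar>a\<bar>) * ennreal (indicator {..2} \<bar>x - (-1)\<bar> * \<bar>x - (-1)\<bar> powr b)
       = ennreal (2 powr \<bar>b\<bar> * (1 - x) powr a + 2 powr \<bar>a\<bar> * (1 + x) powr b)"
        by (simp add: indicator_def ennreal_mult' ennreal_plus abs_if add.commute)
      moreover have "ennreal (indicator {-1<..<1} x * jacobi_weight a b x) = ennreal (jacobi_weight a b x)"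
        using True by simp
      ultimately show ?thesis using jacobi_weight_le[OF True, of a b] ennreal_leI by metis
    qed auto
  qed
  also have "\<dots> = ennreal (2 powr \<bar>b\<bar>) * (\<integral>\<^sup>+x. ennreal (indicator {..2} \<bar>x - 1\<bar> * \<bar>x - 1\<bar> powr a) \<partial>lborel)
       + ennreal (2 powr \<bar>a\<bar>) * (\<integral>\<^sup>+x. ennreal (indicator {..2} \<bar>x - (-1)\<bar> * \<bar>x - (-1)\<bar> powr b) \<partial>lborel)"
    by (simp add: nn_integral_add nn_integral_cmult)
  also have "\<dots> \<le> ennreal (2 powr \<bar>b\<bar>) * ennreal (2 * (2 powr (a + 1) / (a + 1)))
       + ennreal (2 powr \<bar>a\<bar>) * ennreal (2 * (2 powr (b + 1) / (b + 1)))"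
    using assms by (intro add_mono mult_left_mono nn_integral_powr_near) auto
  also have "\<dots> < \<infinity>" by (simp add: ennreal_mult_less_top)
  finally show "emeasure (jacobi_measure a b) (space (jacobi_measure a b)) \<noteq> \<infinity>" by simp
qed

lemma integrable_jacobi_bounded:
  fixes u :: "real \<Rightarrow> real"
  assumes ab: "a > -1" "b > -1" and [measurable]: "u \<in> borel_measurable borel"
    and "\<And>x. x \<in> {-1<..<1} \<Longrightarrow> \<bar>u x\<bar> \<le> B"
  shows "integrable (jacobi_measure a b) u"
proof -
  interpret finite_measure "jacobi_measure a b" by (rule finite_measure_jacobi_measure[OF ab])
  have "AE x in jacobi_measure a b. norm (u x) \<le> B"
    by (rule eventually_mono[OF AE_jacobi_measure[where z=0]]) (use assms in auto)
  then show ?thesis by (intro integrable_const_bound[where B=B]) auto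
qed

lemma integrable_jacobi_continuous:
  fixes u :: "real \<Rightarrow> real"
  assumes "a > -1" "b > -1" "u \<in> borel_measurable borel" "continuous_on {-1..1} u"
  shows "integrable (jacobi_measure a b) u"
proof -
  have "bounded (u ` {-1..1})"
    using assms by (intro compact_imp_bounded compact_continuous_image) auto
  then obtain B where B: "\<forall>x\<in>{-1..1}. \<bar>u x\<bar> \<le> B"
    unfolding bounded_iff by auto
  show ?thesis by (rule integrable_jacobi_bounded[OF assms(1-3), of B]) (use B in auto)
qed

subsection \<open>Orthogonality and truncated Jacobi expansions\<close>

abbreviation jint :: "real \<Rightarrow> real \<Rightarrow> (real \<Rightarrow> real) \<Rightarrow> real" where
  "jint a b u \<equiv> integral\<^sup>L (jacobi_measure a b) u"

text \<open>Since \<open>jint\<close> returns 0 on non-integrable functions, a bound on a squared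
  norm has content only together with this predicate.\<close>

definition jacobi_L2 :: "real \<Rightarrow> real \<Rightarrow> (real \<Rightarrow> real) \<Rightarrow> bool" where
  "jacobi_L2 a b u \<longleftrightarrow> u \<in> borel_measurable borel \<and> integrable (jacobi_measure a b) (\<lambda>x. (u x)\<^sup>2)"

lemma jacobi_L2_measurable: "jacobi_L2 a b u \<Longrightarrow> u \<in> borel_measurable borel"
  by (simp add: jacobi_L2_def)

lemma jacobi_L2_square: "jacobi_L2 a b u \<Longrightarrow> integrable (jacobi_measure a b) (\<lambda>x. (u x)\<^sup>2)"
  by (simp add: jacobi_L2_def)

lemma jacobi_L2_mult:
  assumes "jacobi_L2 a b u" "jacobi_L2 a b v"
  shows "integrable (jacobi_measure a b) (\<lambda>x. u x * v x)"
proof (rule Bochner_Integration.integrable_bound)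
  have [measurable]: "u \<in> borel_measurable borel" "v \<in> borel_measurable borel"
    using assms by (auto simp: jacobi_L2_def)
  show "integrable (jacobi_measure a b) (\<lambda>x. (u x)\<^sup>2 + (v x)\<^sup>2)"
    using assms by (auto simp: jacobi_L2_def)
  show "(\<lambda>x. u x * v x) \<in> borel_measurable (jacobi_measure a b)" by measurable
  show "AE x in jacobi_measure a b. norm (u x * v x) \<le> norm ((u x)\<^sup>2 + (v x)\<^sup>2)"
  proof (rule AE_I2)
    fix x
    have "2 * (\<bar>u x\<bar> * \<bar>v x\<bar>) \<le> (u x)\<^sup>2 + (v x)\<^sup>2"
      using sum_squares_bound[of "\<bar>u x\<bar>" "\<bar>v x\<bar>"] by simp
    moreover have "\<bar>u x\<bar> * \<bar>v x\<bar> \<le> 2 * (\<bar>u x\<bar> * \<bar>v x\<bar>)" by simp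
    ultimately have "\<bar>u x\<bar> * \<bar>v x\<bar> \<le> (u x)\<^sup>2 + (v x)\<^sup>2" by linarith
    then show "norm (u x * v x) \<le> norm ((u x)\<^sup>2 + (v x)\<^sup>2)" by (simp add: abs_mult)
  qed
qed

lemma jacobi_L2_cmult: "jacobi_L2 a b u \<Longrightarrow> jacobi_L2 a b (\<lambda>x. c * u x)"
  by (auto simp: jacobi_L2_def power_mult_distrib)

lemma jacobi_L2_add:
  assumes "jacobi_L2 a b u" "jacobi_L2 a b v"
  shows "jacobi_L2 a b (\<lambda>x. u x + v x)"
  using assms jacobi_L2_mult[OF assms] by (auto simp: jacobi_L2_def power2_sum mult.assoc)

lemma jacobi_L2_diff:
  assumes "jacobi_L2 a b u" "jacobi_L2 a b v"
  shows "jacobi_L2 a b (\<lambda>x. u x - v x)"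
  using jacobi_L2_add[OF assms(1) jacobi_L2_cmult[OF assms(2), of "-1"]] by simp

lemma jacobi_L2_sum:
  "(\<And>i. i \<in> I \<Longrightarrow> jacobi_L2 a b (u i)) \<Longrightarrow> jacobi_L2 a b (\<lambda>x. \<Sum>i\<in>I. u i x)"
  by (induction I rule: infinite_finite_induct) (auto intro: jacobi_L2_add simp: jacobi_L2_def[of _ _ "\<lambda>x. 0"])

lemma jacobi_L2_continuous:
  assumes "a > -1" "b > -1" "u \<in> borel_measurable borel" "continuous_on {-1..1} u"
  shows "jacobi_L2 a b u"
  using assms by (auto simp: jacobi_L2_def intro!: integrable_jacobi_continuous continuous_intros)

lemma jacobi_L2_P: "a > -1 \<Longrightarrow> b > -1 \<Longrightarrow> jacobi_L2 a b (jacobi_P a' b' n)"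
  by (intro jacobi_L2_continuous) (auto intro: continuous_intros)

lemma jacobi_sigma_eq: "jacobi_sigma a b n = jint a b (\<lambda>x. jacobi_P a b n x * jacobi_P a b n x)"
  by (subst integral_jacobi_measure) (auto simp: jacobi_sigma_def power2_eq_square)

lemma jacobi_coeff_eq:
  assumes "u \<in> borel_measurable borel"
  shows "jacobi_coeff a b u n = jint a b (\<lambda>x. u x * jacobi_P a b n x) / jacobi_sigma a b n"
  using assms by (subst integral_jacobi_measure) (auto simp: jacobi_coeff_def mult.assoc)

text \<open>Integration by parts with one step of Rodrigues' formula. There is no boundary term: the
  raised exponents a + 1 and b + 1 are positive, so the weight is continuous on the closed interval
  and vanishes at its ends.\<close>

lemma jint_weight_P_deriv:
  assumes ab: "a > -1" "b > -1"
    and [measurable]: "u \<in> borel_measurable borel" "u' \<in> borel_measurable borel"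
    and du: "\<And>x. x \<in> {-1..1} \<Longrightarrow> (u has_real_derivative u' x) (at x within {-1..1})"
    and cu': "continuous_on {-1..1} u'"
  shows "jint (a + 1) (b + 1) (\<lambda>x. u' x * jacobi_P (a + 1) (b + 1) n x)
    = 2 * real (Suc n) * jint a b (\<lambda>x. u x * jacobi_P a b (Suc n) x)"
proof -
  let ?P = "jacobi_P (a + 1) (b + 1) n" and ?Q = "jacobi_P a b (Suc n)"
    and ?v = "jacobi_weight (a + 1) (b + 1)" and ?w = "jacobi_weight a b"
  define F' where "F' = (\<lambda>x. ?v x * (u' x * ?P x) + (- 2 * real (Suc n)) * (?w x * (u x * ?Q x)))"
  have cu: "continuous_on {-1..1} u" using du by (rule DERIV_continuous_on)
  have "continuous_on {-1..1} (\<lambda>x. ?v x * ?P x * u x)"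
    unfolding jacobi_weight_def using ab by (intro continuous_intros continuous_on_powr' cu) auto
  moreover have "((\<lambda>x. ?v x * ?P x * u x) has_vector_derivative F' x) (at x)" if "x \<in> {-1<..<1}" for x
  proof -
    have "at x within {-1..1} = at x" using that by (simp add: at_within_Icc_at)
    with du[of x] that have "(u has_real_derivative u' x) (at x)" by auto
    from DERIV_mult[OF jacobi_weight_P_deriv[OF that, of a b n UNIV] this]
    show ?thesis unfolding F'_def has_real_derivative_iff_has_vector_derivative[symmetric]
      by (rule DERIV_cong) (simp add: algebra_simps)
  qed
  ultimately have "(F' has_integral 0) {-1..1}"
    using fundamental_theorem_of_calculus_interior[of "-1" 1 "\<lambda>x. ?v x * ?P x * u x" F']
    by (simp add: jacobi_weight_def)
  then have 0: "integral {-1<..<1} F' = 0"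
    using integral_open_interval_real[of "-1" 1 F'] by (simp add: integral_unique)
  have 1: "set_integrable lborel {-1<..<1} (\<lambda>x. ?v x * (u' x * ?P x))"
    using ab cu' by (subst integrable_jacobi_measure[symmetric])
      (auto intro!: integrable_jacobi_continuous continuous_intros)
  have 2: "set_integrable lborel {-1<..<1} (\<lambda>x. ?w x * (u x * ?Q x))"
    using ab cu by (subst integrable_jacobi_measure[symmetric])
      (auto intro!: integrable_jacobi_continuous continuous_intros)
  have 3: "set_integrable lborel {-1<..<1} (\<lambda>x. (- 2 * real (Suc n)) * (?w x * (u x * ?Q x)))"
    using 2 by (rule set_integrable_mult_right)
  have "(LINT x:{-1<..<1}|lborel. F' x) = 0"
    using 0 set_borel_integral_eq_integral(2)[of "{-1<..<1}" F'] set_integral_add(1)[OF 1 3]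
    by (simp add: F'_def)
  then show ?thesis
    unfolding F'_def set_integral_add(2)[OF 1 3] set_integral_mult_right
    by (simp add: integral_jacobi_measure left_diff_distrib distrib_right)
qed

text \<open>Each integration by parts lowers both degrees and raises both parameters by one, until
  the polynomial of smaller degree is constant and its derivative vanishes.\<close>

lemma jacobi_P_orthogonal_less:
  "a > -1 \<Longrightarrow> b > -1 \<Longrightarrow> m < n \<Longrightarrow> jint a b (\<lambda>x. jacobi_P a b m x * jacobi_P a b n x) = 0"
proof (induction n arbitrary: a b m)
  case (Suc n)
  have "jint (a + 1) (b + 1) (\<lambda>x. u' x * jacobi_P (a + 1) (b + 1) n x) = 0 \<Longrightarrow>
     (\<And>x. (jacobi_P a b m has_real_derivative u' x) (at x within {-1..1})) \<Longrightarrow>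
     continuous_on {-1..1} u' \<Longrightarrow> u' \<in> borel_measurable borel \<Longrightarrow> ?case" for u'
    using jint_weight_P_deriv[OF Suc.prems(1,2), of "jacobi_P a b m" u' n] by simp
  note * = this
  show ?case
  proof (cases m)
    case 0
    show ?thesis by (rule *[of "\<lambda>_. 0"]) (auto simp: 0 jacobi_P_0[abs_def])
  next
    case (Suc m')
    show ?thesis
    proof (rule *[of "\<lambda>x. (real m' + a + b + 2) / 2 * jacobi_P (a + 1) (b + 1) m' x"])
      show "jint (a + 1) (b + 1) (\<lambda>x. (real m' + a + b + 2) / 2 * jacobi_P (a + 1) (b + 1) m' x
         * jacobi_P (a + 1) (b + 1) n x) = 0"
        using Suc.IH[of "a + 1" "b + 1" m'] Suc.prems Suc by (simp add: mult.assoc)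
      show "(jacobi_P a b m has_real_derivative
          (real m' + a + b + 2) / 2 * jacobi_P (a + 1) (b + 1) m' x) (at x within {-1..1})" for x
        unfolding Suc by (rule jacobi_P_deriv)
    qed (auto intro!: continuous_intros)
  qed
qed simp

lemma jacobi_P_orthogonal:
  assumes "a > -1" "b > -1" "m \<noteq> n"
  shows "jint a b (\<lambda>x. jacobi_P a b m x * jacobi_P a b n x) = 0"
  using assms jacobi_P_orthogonal_less[of a b m n] jacobi_P_orthogonal_less[of a b n m]
  by (cases "m < n") (auto simp: mult.commute)

text \<open>Integration by parts with \<open>u\<close> the polynomial of degree n + 1 itself. This
  recursion takes the place of the closed form by Gamma functions.\<close>

lemma jacobi_sigma_Suc:
  assumes "a > -1" "b > -1"
  shows "jacobi_sigma a b (Suc n)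
    = (real n + a + b + 2) / (4 * real (Suc n)) * jacobi_sigma (a + 1) (b + 1) n"
proof -
  define d where "d = (real n + a + b + 2) / 2"
  have "jint (a + 1) (b + 1) (\<lambda>x. (d * jacobi_P (a + 1) (b + 1) n x) * jacobi_P (a + 1) (b + 1) n x)
    = 2 * real (Suc n) * jint a b (\<lambda>x. jacobi_P a b (Suc n) x * jacobi_P a b (Suc n) x)"
    unfolding d_def
    using assms by (intro jint_weight_P_deriv jacobi_P_deriv) (auto intro!: continuous_intros)
  then have "d * jacobi_sigma (a + 1) (b + 1) n = 2 * real (Suc n) * jacobi_sigma a b (Suc n)"
    unfolding jacobi_sigma_eq mult.assoc integral_mult_right_zero .
  then show ?thesis unfolding d_def by (simp add: field_simps)
qed

text \<open>The recursion leads down to degree 0, where the value is the total mass of a positive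
  weight.\<close>

lemma jacobi_sigma_pos: "a > -1 \<Longrightarrow> b > -1 \<Longrightarrow> jacobi_sigma a b n > 0"
proof (induction n arbitrary: a b)
  case 0
  interpret finite_measure "jacobi_measure a b" by (rule finite_measure_jacobi_measure[OF 0])
  have "measure (jacobi_measure a b) UNIV \<noteq> 0"
  proof
    assume "measure (jacobi_measure a b) UNIV = 0"
    then have "emeasure (jacobi_measure a b) UNIV = 0" by (simp add: emeasure_eq_measure)
    then have "UNIV \<in> null_sets (jacobi_measure a b)" by (simp add: null_sets_def)
    then have "AE x in lborel. ennreal (indicator {-1<..<1} x * jacobi_weight a b x) = 0"
      unfolding jacobi_measure_def by (subst (asm) null_sets_density_iff) auto
    then have "AE x in lborel. x \<notin> {-1<..<1::real}"
    proof eventually_elim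
      case (elim x)
      then show ?case using jacobi_weight_pos[of x a b] by (auto simp: indicator_def ennreal_eq_0_iff)
    qed
    then have "emeasure lborel {-1<..<1::real} = 0"
      by (subst (asm) AE_iff_measurable[of "{-1<..<1::real}"]) auto
    then show False by simp
  qed
  then show ?case using measure_nonneg[of "jacobi_measure a b" UNIV]
    by (simp add: jacobi_sigma_eq less_le del: measure_nonneg)
next
  case (Suc n)
  then show ?case
    unfolding jacobi_sigma_Suc[OF Suc.prems] by (intro mult_pos_pos divide_pos_pos) auto
qed

text \<open>The factor is the one that appears when P_{n+1} is differentiated. So the derivative of
  the truncated expansion of \<open>u\<close> is the truncated expansion of \<open>u'\<close> for
  the shifted parameters.\<close>

lemma jacobi_coeff_deriv:
  assumes ab: "a > -1" "b > -1"
    and "u \<in> borel_measurable borel" "u' \<in> borel_measurable borel"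
    and "\<And>x. x \<in> {-1..1} \<Longrightarrow> (u has_real_derivative u' x) (at x within {-1..1})"
    and "continuous_on {-1..1} u'"
  shows "jacobi_coeff (a + 1) (b + 1) u' n = (real n + a + b + 2) / 2 * jacobi_coeff a b u (Suc n)"
proof -
  have "real n + a + b + 2 > 0" using ab by simp
  moreover have "jacobi_sigma (a + 1) (b + 1) n > 0" using ab by (intro jacobi_sigma_pos) auto
  moreover have alg: "2 * m * J / s = d / 2 * (J / (d / (4 * m) * s))" if "d > 0" "s > 0" "m > 0"
    for d s m J :: real using that by (simp add: field_simps)
  ultimately have "2 * real (Suc n) * J / jacobi_sigma (a + 1) (b + 1) n
      = (real n + a + b + 2) / 2 * (J / jacobi_sigma a b (Suc n))" for J
    unfolding jacobi_sigma_Suc[OF ab] by (intro alg) auto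
  then show ?thesis
    using jacobi_coeff_eq[OF assms(3), of a b "Suc n"] jacobi_coeff_eq[OF assms(4), of "a + 1" "b + 1" n]
      jint_weight_P_deriv[OF assms, of n] by metis
qed

text \<open>The \<open>j\<close>-th derivative of \<open>\<Sum>n<N. c n * P\<^sub>n\<close>.\<close>

primrec jacobi_sum :: "nat \<Rightarrow> real \<Rightarrow> real \<Rightarrow> nat \<Rightarrow> (nat \<Rightarrow> real) \<Rightarrow> real \<Rightarrow> real" where
  "jacobi_sum 0 a b N c = (\<lambda>x. \<Sum>n<N. c n * jacobi_P a b n x)"
| "jacobi_sum (Suc j) a b N c
     = jacobi_sum j (a + 1) (b + 1) (N - 1) (\<lambda>n. (real n + a + b + 2) / 2 * c (Suc n))"

lemma jacobi_sum_deriv: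
  "(jacobi_sum j a b N c has_real_derivative jacobi_sum (Suc j) a b N c x) (at x within S)"
proof (induction j arbitrary: a b N c)
  case 0
  show ?case
  proof (cases N)
    case (Suc M)
    have "((\<lambda>x. c 0 * jacobi_P a b 0 x + (\<Sum>n<M. c (Suc n) * jacobi_P a b (Suc n) x))
      has_real_derivative (0 + (\<Sum>n<M. c (Suc n) *
         ((real n + a + b + 2) / 2 * jacobi_P (a + 1) (b + 1) n x)))) (at x within S)"
      by (intro DERIV_add DERIV_sum DERIV_cmult jacobi_P_deriv) (auto simp: jacobi_P_0[abs_def])
    then show ?thesis
      by (simp add: Suc sum.lessThan_Suc_shift mult_ac del: sum.lessThan_Suc)
  qed simp
next
  case (Suc j)
  show ?case unfolding jacobi_sum.simps(2)[of j a b N c] jacobi_sum.simps(2)[of "Suc j" a b N c]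
    by (rule Suc.IH)
qed

lemma continuous_on_jacobi_sum [continuous_intros]: "continuous_on S (jacobi_sum j a b N c)"
  using jacobi_sum_deriv by (rule DERIV_continuous_on)

lemma jacobi_sum_measurable [measurable]: "jacobi_sum j a b N c \<in> borel_measurable borel"
  by (intro borel_measurable_continuous_onI continuous_on_jacobi_sum)

lemma jacobi_L2_jacobi_sum: "a > -1 \<Longrightarrow> b > -1 \<Longrightarrow> jacobi_L2 a b (jacobi_sum j a' b' N c)"
  by (intro jacobi_L2_continuous) (auto intro: continuous_intros)

lemma jacobi_sum_linear:
  "jacobi_sum j a b N (\<lambda>n. \<Sum>i\<in>I. k i * c i n) x = (\<Sum>i\<in>I. k i * jacobi_sum j a b N (c i) x)"
proof (induction j arbitrary: a b N c)
  case 0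
  have "(\<Sum>n<N. (\<Sum>i\<in>I. k i * c i n) * jacobi_P a b n x)
      = (\<Sum>n<N. \<Sum>i\<in>I. k i * (c i n * jacobi_P a b n x))"
    by (simp add: sum_distrib_right mult.assoc)
  also have "\<dots> = (\<Sum>i\<in>I. \<Sum>n<N. k i * (c i n * jacobi_P a b n x))"
    by (rule sum.swap)
  finally show ?case by (simp add: sum_distrib_left)
next
  case (Suc j)
  have "(real n + a + b + 2) / 2 * (\<Sum>i\<in>I. k i * c i (Suc n))
      = (\<Sum>i\<in>I. k i * ((real n + a + b + 2) / 2 * c i (Suc n)))" for n
    unfolding sum_distrib_left by (rule sum.cong) (simp_all add: mult_ac)
  then show ?case unfolding jacobi_sum.simps(2) by (simp only: Suc.IH)
qed

lemma jacobi_sum_add: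
  "jacobi_sum j a b N (\<lambda>n. c n + d n) x = jacobi_sum j a b N c x + jacobi_sum j a b N d x"
  using jacobi_sum_linear[of j a b N "\<lambda>_. 1" "\<lambda>i. if i = (0::nat) then c else d" "{0,1}" x] by simp

lemma jacobi_coeff_linear:
  assumes ab: "a > -1" "b > -1" and L: "\<And>i. i \<in> I \<Longrightarrow> jacobi_L2 a b (u i)"
  shows "jacobi_coeff a b (\<lambda>x. \<Sum>i\<in>I. k i * u i x) n = (\<Sum>i\<in>I. k i * jacobi_coeff a b (u i) n)"
proof -
  have "(\<lambda>x. \<Sum>i\<in>I. k i * u i x) \<in> borel_measurable borel"
    using jacobi_L2_measurable[OF L] by measurable
  then have "jacobi_coeff a b (\<lambda>x. \<Sum>i\<in>I. k i * u i x) n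
      = jint a b (\<lambda>x. (\<Sum>i\<in>I. k i * u i x) * jacobi_P a b n x) / jacobi_sigma a b n"
    by (rule jacobi_coeff_eq)
  also have "jint a b (\<lambda>x. (\<Sum>i\<in>I. k i * u i x) * jacobi_P a b n x)
      = jint a b (\<lambda>x. \<Sum>i\<in>I. k i * (u i x * jacobi_P a b n x))"
    by (simp add: sum_distrib_right mult.assoc)
  also have "\<dots> = (\<Sum>i\<in>I. k i * jint a b (\<lambda>x. u i x * jacobi_P a b n x))"
    using jacobi_L2_mult[OF L jacobi_L2_P[OF ab]] by (subst Bochner_Integration.integral_sum) auto
  also have "\<dots> / jacobi_sigma a b n = (\<Sum>i\<in>I. k i * jacobi_coeff a b (u i) n)"
    using jacobi_coeff_eq[OF jacobi_L2_measurable[OF L]] by (simp add: sum_divide_distrib)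
  finally show ?thesis .
qed

lemma jacobi_coeff_diff:
  assumes ab: "a > -1" "b > -1" and L: "jacobi_L2 a b u" "jacobi_L2 a b v"
  shows "jacobi_coeff a b (\<lambda>x. u x - v x) n = jacobi_coeff a b u n - jacobi_coeff a b v n"
  using jacobi_coeff_linear[OF ab, of "{0,1}" "\<lambda>i. if i = (0::nat) then u else v"
      "\<lambda>i. if i = 0 then 1 else -1" n] L by simp

lemma jint_jacobi_sum:
  assumes ab: "a > -1" "b > -1" and u: "jacobi_L2 a b u"
  shows "jint a b (\<lambda>x. u x * jacobi_sum 0 a b N c x)
    = (\<Sum>n<N. c n * jacobi_coeff a b u n * jacobi_sigma a b n)"
proof -
  have "jint a b (\<lambda>x. u x * jacobi_sum 0 a b N c x)
      = jint a b (\<lambda>x. \<Sum>n<N. c n * (u x * jacobi_P a b n x))"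
    by (simp add: sum_distrib_left mult_ac)
  also have "\<dots> = (\<Sum>n<N. c n * jint a b (\<lambda>x. u x * jacobi_P a b n x))"
    using jacobi_L2_mult[OF u jacobi_L2_P[OF ab]] by (subst Bochner_Integration.integral_sum) auto
  also have "\<dots> = (\<Sum>n<N. c n * jacobi_coeff a b u n * jacobi_sigma a b n)"
    unfolding jacobi_coeff_eq[OF jacobi_L2_measurable[OF u]]
    using jacobi_sigma_pos[OF ab] by (intro sum.cong) (simp_all add: less_imp_neq[THEN not_sym])
  finally show ?thesis .
qed

lemma jacobi_coeff_jacobi_sum:
  assumes ab: "a > -1" "b > -1"
  shows "jacobi_coeff a b (jacobi_sum 0 a b N c) n = (if n < N then c n else 0)"
proof -
  have "jacobi_coeff a b (\<lambda>x. \<Sum>i<N. c i * jacobi_P a b i x) n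
      = (\<Sum>i<N. c i * jacobi_coeff a b (jacobi_P a b i) n)"
    by (intro jacobi_coeff_linear jacobi_L2_P ab)
  also have "\<dots> = (\<Sum>i<N. if i = n then c n else 0)"
    using jacobi_sigma_pos[OF ab, of n] jacobi_P_orthogonal[OF ab, of _ n]
    by (intro sum.cong) (auto simp: jacobi_coeff_eq jacobi_sigma_eq)
  finally show ?thesis by simp
qed

lemma jint_jacobi_sum_square:
  assumes ab: "a > -1" "b > -1"
  shows "jint a b (\<lambda>x. (jacobi_sum 0 a b N c x)\<^sup>2) = (\<Sum>n<N. (c n)\<^sup>2 * jacobi_sigma a b n)"
proof -
  have "jint a b (\<lambda>x. (jacobi_sum 0 a b N c x)\<^sup>2)
      = (\<Sum>n<N. c n * jacobi_coeff a b (jacobi_sum 0 a b N c) n * jacobi_sigma a b n)"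
    using jint_jacobi_sum[OF ab jacobi_L2_jacobi_sum[OF ab, of 0 a b N c], of N c]
    unfolding power2_eq_square .
  also have "\<dots> = (\<Sum>n<N. (c n)\<^sup>2 * jacobi_sigma a b n)"
    by (intro sum.cong) (simp_all only: jacobi_coeff_jacobi_sum[OF ab], simp_all add: power2_eq_square)
  finally show ?thesis .
qed

text \<open>Truncation to the first \<open>N\<close> Jacobi modes; \<open>jacobi_trunc 0 a b (Suc N)\<close> is the projection
  onto degree \<open>\<le> N\<close>, and the first argument counts derivatives.\<close>

abbreviation jacobi_trunc :: "nat \<Rightarrow> real \<Rightarrow> real \<Rightarrow> nat \<Rightarrow> (real \<Rightarrow> real) \<Rightarrow> real \<Rightarrow> real" where
  "jacobi_trunc j a b N u \<equiv> jacobi_sum j a b N (jacobi_coeff a b u)"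

lemma jacobi_pythagoras:
  assumes ab: "a > -1" "b > -1" and u: "jacobi_L2 a b u"
  shows "jint a b (\<lambda>x. (u x - jacobi_trunc 0 a b N u x)\<^sup>2)
    = jint a b (\<lambda>x. (u x)\<^sup>2) - (\<Sum>n<N. (jacobi_coeff a b u n)\<^sup>2 * jacobi_sigma a b n)"
proof -
  let ?T = "jacobi_trunc 0 a b N u"
  note T = jacobi_L2_jacobi_sum[OF ab, of 0 a b N "jacobi_coeff a b u"]
  have "jint a b (\<lambda>x. (u x - ?T x)\<^sup>2)
      = jint a b (\<lambda>x. ((u x)\<^sup>2 - 2 * (u x * ?T x)) + (?T x)\<^sup>2)"
    by (simp only: power2_diff diff_add_eq mult.assoc)
  also have "\<dots> = jint a b (\<lambda>x. (u x)\<^sup>2) - 2 * jint a b (\<lambda>x. u x * ?T x) + jint a b (\<lambda>x. (?T x)\<^sup>2)"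
    using jacobi_L2_square[OF u] jacobi_L2_square[OF T] jacobi_L2_mult[OF u T]
    by (simp del: jacobi_sum.simps)
  also have "\<dots> = jint a b (\<lambda>x. (u x)\<^sup>2) - (\<Sum>n<N. (jacobi_coeff a b u n)\<^sup>2 * jacobi_sigma a b n)"
    unfolding jint_jacobi_sum[OF ab u] jint_jacobi_sum_square[OF ab] by (simp add: power2_eq_square)
  finally show ?thesis .
qed

section \<open>Bessel, inverse and Poincare inequalities\<close>

lemma jint_square_nonneg: "jint a b (\<lambda>x. (u x)\<^sup>2) \<ge> 0"
  by simp

lemma jacobi_bessel:
  assumes ab: "a > -1" "b > -1" and u: "jacobi_L2 a b u"
  shows "(\<Sum>n<N. (jacobi_coeff a b u n)\<^sup>2 * jacobi_sigma a b n) \<le> jint a b (\<lambda>x. (u x)\<^sup>2)"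
  using jacobi_pythagoras[OF assms, of N] jint_square_nonneg[of a b "\<lambda>x. u x - jacobi_trunc 0 a b N u x"]
  by (simp del: jacobi_sum.simps)

lemma jacobi_error_le:
  assumes ab: "a > -1" "b > -1" and u: "jacobi_L2 a b u"
  shows "jint a b (\<lambda>x. (u x - jacobi_trunc 0 a b N u x)\<^sup>2) \<le> jint a b (\<lambda>x. (u x)\<^sup>2)"
proof -
  have "(\<Sum>n<N. (jacobi_coeff a b u n)\<^sup>2 * jacobi_sigma a b n) \<ge> 0"
    using jacobi_sigma_pos[OF ab] by (intro sum_nonneg) (simp add: less_imp_le)
  then show ?thesis unfolding jacobi_pythagoras[OF assms] by simp
qed

text \<open>The numbers n (n + a + b + 1) are the eigenvalues of the Jacobi differential operator.
  Passing to the derivative multiplies the energy of each mode by its eigenvalue.\<close>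

lemma jacobi_sigma_shift:
  assumes ab: "a > -1" "b > -1"
  shows "((real n + a + b + 2) / 2 * c)\<^sup>2 * jacobi_sigma (a + 1) (b + 1) n
    = real (Suc n) * (real (Suc n) + a + b + 1) * (c\<^sup>2 * jacobi_sigma a b (Suc n))"
proof -
  have "real n + a + b + 2 > 0" using ab by simp
  moreover have alg: "(d / 2 * c)\<^sup>2 * s = m * d * (c\<^sup>2 * (d / (4 * m) * s))" if "m > 0" "d > 0" for d m s :: real
    using that by (simp add: field_simps power2_eq_square)
  ultimately have "((real n + a + b + 2) / 2 * c)\<^sup>2 * jacobi_sigma (a + 1) (b + 1) n
    = real (Suc n) * (real n + a + b + 2) * (c\<^sup>2 * jacobi_sigma a b (Suc n))"
    unfolding jacobi_sigma_Suc[OF ab] by (intro alg) auto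
  then show ?thesis by (simp add: add_ac)
qed

text \<open>Each derivative costs an eigenvalue, and on the modes below N these are at most B. The
  summand 2 j in the hypothesis is the reserve for the parameter shifts: every derivative raises a +
  b by 2 and lowers the remaining order j by 1.\<close>

lemma jacobi_inverse_inequality:
  assumes "a > -1" "b > -1" "real N * (real N + \<bar>a + b\<bar> + 2 * real j + 1) \<le> B"
  shows "jint (a + real j) (b + real j) (\<lambda>x. (jacobi_sum j a b N c x)\<^sup>2)
    \<le> B ^ j * (\<Sum>n<N. (c n)\<^sup>2 * jacobi_sigma a b n)"
  using assms
proof (induction j arbitrary: a b N c)
  case 0
  then show ?case using jint_jacobi_sum_square[of a b N c] by (simp del: jacobi_sum.simps)
next
  case (Suc j)
  note ab = Suc.prems(1,2)
  let ?c = "\<lambda>n. (real n + a + b + 2) / 2 * c (Suc n)"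
  have B0: "B \<ge> 0"
  proof -
    have "real N * (real N + \<bar>a + b\<bar> + 2 * real (Suc j) + 1) \<ge> 0" by (intro mult_nonneg_nonneg) auto
    then show ?thesis using Suc.prems(3) by linarith
  qed
  have s: "jacobi_sigma a b n \<ge> 0" for n using jacobi_sigma_pos[OF ab, of n] by simp
  have "real (N - 1) * (real (N - 1) + \<bar>a + 1 + (b + 1)\<bar> + 2 * real j + 1)
      \<le> real N * (real N + \<bar>a + b\<bar> + 2 * real (Suc j) + 1)"
    by (intro mult_mono) auto
  then have "real (N - 1) * (real (N - 1) + \<bar>a + 1 + (b + 1)\<bar> + 2 * real j + 1) \<le> B"
    using Suc.prems(3) by linarith
  then have "jint (a + 1 + real j) (b + 1 + real j) (\<lambda>x. (jacobi_sum j (a + 1) (b + 1) (N - 1) ?c x)\<^sup>2)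
    \<le> B ^ j * (\<Sum>n<N - 1. (?c n)\<^sup>2 * jacobi_sigma (a + 1) (b + 1) n)"
    using ab by (intro Suc.IH) auto
  moreover have "(\<Sum>n<N - 1. (?c n)\<^sup>2 * jacobi_sigma (a + 1) (b + 1) n)
      = (\<Sum>n<N - 1. real (Suc n) * (real (Suc n) + a + b + 1) * ((c (Suc n))\<^sup>2 * jacobi_sigma a b (Suc n)))"
    by (intro sum.cong refl jacobi_sigma_shift ab)
  also have "\<dots> \<le> (\<Sum>n<N - 1. B * ((c (Suc n))\<^sup>2 * jacobi_sigma a b (Suc n)))"
  proof (intro sum_mono mult_right_mono)
    fix n assume "n \<in> {..<N - 1}"
    then have n: "real (Suc n) \<le> real N" by auto
    have "real (Suc n) * (real (Suc n) + a + b + 1)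
        \<le> real N * (real N + \<bar>a + b\<bar> + 2 * real (Suc j) + 1)"
      using n by (intro mult_mono) (use ab in auto)
    then show "real (Suc n) * (real (Suc n) + a + b + 1) \<le> B" using Suc.prems(3) by linarith
  qed (use s in auto)
  also have "\<dots> = B * (\<Sum>n<N - 1. (c (Suc n))\<^sup>2 * jacobi_sigma a b (Suc n))"
    by (simp add: sum_distrib_left)
  also have "\<dots> \<le> B * (\<Sum>n<N. (c n)\<^sup>2 * jacobi_sigma a b n)"
    using s B0 by (cases N) (auto simp: sum.lessThan_Suc_shift intro!: mult_left_mono simp del: sum.lessThan_Suc)
  ultimately have "jint (a + 1 + real j) (b + 1 + real j) (\<lambda>x. (jacobi_sum j (a + 1) (b + 1) (N - 1) ?c x)\<^sup>2)
    \<le> B ^ j * (B * (\<Sum>n<N. (c n)\<^sup>2 * jacobi_sigma a b n))"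
    using B0 by (meson order_trans mult_left_mono zero_le_power)
  then show ?case unfolding jacobi_sum.simps(2) by (simp only: of_nat_Suc power_Suc add_ac mult_ac)
qed

text \<open>Induction on the degree in place of a dimension count: truncation commutes with
  differentiation, so by the induction hypothesis the error is a constant, and this constant is 0
  because its coefficient of order 0 vanishes.\<close>

lemma jacobi_trunc_poly:
  assumes "a > -1" "b > -1" "degree q < N"
  shows "jacobi_trunc 0 a b N (poly q) x = poly q x"
proof -
  have "jacobi_trunc 0 a b (Suc M) (poly q) x = poly q x"
    if "a > -1" "b > -1" "degree q \<le> M" for a b M q x
    using that
  proof (induction M arbitrary: a b q x)
    case 0
    then obtain c where q: "q = [:c:]" by (metis degree_eq_zeroE le_zero_eq)
    have "jacobi_sigma a b 0 > 0" using 0 by (intro jacobi_sigma_pos) auto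
    moreover have "jint a b (\<lambda>x. poly q x * jacobi_P a b 0 x) = c * jacobi_sigma a b 0"
      by (simp add: q jacobi_sigma_eq)
    moreover have "poly q \<in> borel_measurable borel"
      by (intro borel_measurable_continuous_onI) (auto intro: continuous_intros)
    ultimately have "jacobi_coeff a b (poly q) 0 = c" by (simp add: jacobi_coeff_eq)
    moreover have "poly q x = c" by (simp add: q)
    ultimately show ?case by simp
  next
    case (Suc M)
    note ab = Suc.prems(1,2)
    let ?T = "jacobi_trunc 0 a b (Suc (Suc M)) (poly q)"
    have m: "poly p \<in> borel_measurable borel" for p :: "real poly"
      by (intro borel_measurable_continuous_onI) (auto intro: continuous_intros)
    have c: "jacobi_coeff (a + 1) (b + 1) (poly (pderiv q)) n
        = (real n + a + b + 2) / 2 * jacobi_coeff a b (poly q) (Suc n)" for n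
      by (intro jacobi_coeff_deriv ab m DERIV_subset[OF poly_DERIV]) (auto intro: continuous_intros)
    have "jacobi_trunc 0 (a + 1) (b + 1) (Suc M) (poly (pderiv q)) x = poly (pderiv q) x" for x
      using Suc.prems by (intro Suc.IH) (auto simp: degree_pderiv)
    then have s: "jacobi_sum (Suc 0) a b (Suc (Suc M)) (jacobi_coeff a b (poly q)) x = poly (pderiv q) x" for x
      unfolding jacobi_sum.simps(2) c[symmetric] diff_Suc_1 .
    have "((\<lambda>x. poly q x - ?T x) has_real_derivative 0) (at x)" for x
      by (rule DERIV_cong[OF DERIV_diff[OF poly_DERIV jacobi_sum_deriv]])
         (simp add: s del: jacobi_sum.simps)
    from DERIV_isconst_all[OF allI, OF this]
    have "poly q x - ?T x = poly q 0 - ?T 0" for x .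
    then obtain k where k: "\<And>x. poly q x - ?T x = k" by blast
    have L: "jacobi_L2 a b (poly q)" by (intro jacobi_L2_continuous ab m) (auto intro: continuous_intros)
    have "jacobi_coeff a b (\<lambda>x. poly q x - ?T x) 0 = 0"
      unfolding jacobi_coeff_diff[OF ab L jacobi_L2_jacobi_sum[OF ab]] jacobi_coeff_jacobi_sum[OF ab]
      by simp
    then have "jint a b (\<lambda>x. k) = 0"
      using jacobi_sigma_pos[OF ab, of 0] unfolding k by (simp add: jacobi_coeff_eq)
    then have "k = 0" using jacobi_sigma_pos[OF ab, of 0] by (simp add: jacobi_sigma_eq)
    then show ?case using k[of x] by linarith
  qed
  from this[of a b q "N - 1" x] show ?thesis using assms by (cases N) auto
qed

lemma jacobi_trunc_diff:
  assumes "a > -1" "b > -1" "jacobi_L2 a b u" "jacobi_L2 a b v"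
  shows "jacobi_trunc j a b N (\<lambda>x. u x - v x) x = jacobi_trunc j a b N u x - jacobi_trunc j a b N v x"
proof -
  have "jacobi_coeff a b u = (\<lambda>n. jacobi_coeff a b (\<lambda>x. u x - v x) n + jacobi_coeff a b v n)"
    using jacobi_coeff_diff[OF assms] by auto
  then have "jacobi_trunc j a b N u x
      = jacobi_sum j a b N (\<lambda>n. jacobi_coeff a b (\<lambda>x. u x - v x) n + jacobi_coeff a b v n) x"
    by simp
  then show ?thesis unfolding jacobi_sum_add by simp
qed

lemma real_polynomial_function_poly:
  assumes "real_polynomial_function p"
  obtains q :: "real poly" where "\<And>x. p x = poly q x"
proof -
  from assms obtain a n where "p = (\<lambda>x. \<Sum>i\<le>n. a i * x ^ i)"
    unfolding real_polynomial_function_iff_sum by blast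
  then have "p x = poly (\<Sum>i\<le>n. monom (a i) i) x" for x
    by (simp add: poly_sum poly_monom)
  then show ?thesis using that by blast
qed

text \<open>Truncation reproduces a Weierstrass polynomial, and the truncation error of the
  remainder is at most the norm of the remainder. A single large \<open>M\<close> is all that the
  later tail argument asks for.\<close>

lemma jacobi_completeness:
  assumes ab: "a > -1" "b > -1" and m: "u \<in> borel_measurable borel" and c: "continuous_on {-1..1} u"
    and e: "e > 0"
  shows "\<exists>M\<ge>N. jint a b (\<lambda>x. (u x - jacobi_trunc 0 a b M u x)\<^sup>2) \<le> e"
proof -
  interpret finite_measure "jacobi_measure a b" by (rule finite_measure_jacobi_measure[OF ab])
  define W where "W = measure (jacobi_measure a b) UNIV"
  have W: "W \<ge> 0" by (simp add: W_def)
  \<comment> \<open>\<open>W\<close> is the total mass, so a uniform error \<open>\<delta>\<close>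
    contributes at most \<open>e\<close> to the squared norm; the \<open>+ 1\<close> keeps the
    denominator positive.\<close>
  define \<delta> where "\<delta> = sqrt (e / (W + 1))"
  have \<delta>: "\<delta> > 0" "\<delta>\<^sup>2 * W \<le> e" using e W by (auto simp: \<delta>_def field_simps)
  obtain p where p: "real_polynomial_function p" "\<And>x. x \<in> {-1..1} \<Longrightarrow> \<bar>u x - p x\<bar> < \<delta>"
    using Stone_Weierstrass_real_polynomial_function[OF _ c \<delta>(1)] by auto
  obtain q where q: "\<And>x. p x = poly q x" using real_polynomial_function_poly[OF p(1)] by blast
  define M where "M = max N (Suc (degree q))"
  have L: "jacobi_L2 a b u" by (intro jacobi_L2_continuous ab m c)
  have mq: "poly q \<in> borel_measurable borel"
    by (intro borel_measurable_continuous_onI) (auto intro: continuous_intros)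
  have Lq: "jacobi_L2 a b (poly q)"
    by (intro jacobi_L2_continuous ab mq) (auto intro: continuous_intros)
  have "jint a b (\<lambda>x. (u x - jacobi_trunc 0 a b M u x)\<^sup>2)
     = jint a b (\<lambda>x. ((u x - poly q x) - jacobi_trunc 0 a b M (\<lambda>x. u x - poly q x) x)\<^sup>2)"
    unfolding jacobi_trunc_diff[OF ab L Lq] using jacobi_trunc_poly[OF ab, of q M]
    by (simp add: M_def del: jacobi_sum.simps)
  also have "\<dots> \<le> jint a b (\<lambda>x. (u x - poly q x)\<^sup>2)"
    by (intro jacobi_error_le ab jacobi_L2_diff L Lq)
  also have "\<dots> \<le> jint a b (\<lambda>x. \<delta>\<^sup>2)"
  proof (intro integral_mono_AE)
    show "integrable (jacobi_measure a b) (\<lambda>x. (u x - poly q x)\<^sup>2)"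
      using jacobi_L2_square[OF jacobi_L2_diff[OF L Lq]] .
    show "AE x in jacobi_measure a b. (u x - poly q x)\<^sup>2 \<le> \<delta>\<^sup>2"
      using AE_jacobi_measure[where a=a and b=b and z=0]
    proof eventually_elim
      case (elim x)
      then have "\<bar>u x - poly q x\<bar> < \<delta>" using p(2)[of x] q by auto
      then show ?case using abs_le_square_iff[of "u x - poly q x" \<delta>] \<delta> by simp
    qed
  qed simp
  also have "\<dots> \<le> e" using \<delta> by (simp add: W_def mult.commute)
  finally show ?thesis by (intro exI[of _ M]) (auto simp: M_def)
qed

text \<open>From the N-th mode on the eigenvalues are at least N (N + a + b + 1), and the derivative
  multiplies energies by eigenvalues. Differentiation removes one mode, hence \<open>N - 1\<close>
  on the right.\<close>

lemma jacobi_poincare: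
  assumes ab: "a > -1" "b > -1"
    and m: "u \<in> borel_measurable borel" "u' \<in> borel_measurable borel"
    and du: "\<And>x. x \<in> {-1..1} \<Longrightarrow> (u has_real_derivative u' x) (at x within {-1..1})"
    and cu': "continuous_on {-1..1} u'"
    and N: "N > 0" and L: "L \<ge> 0" "L \<le> real N * (real N + a + b + 1)"
  shows "L * jint a b (\<lambda>x. (u x - jacobi_trunc 0 a b N u x)\<^sup>2)
    \<le> jint (a + 1) (b + 1) (\<lambda>x. (u' x - jacobi_trunc 0 (a + 1) (b + 1) (N - 1) u' x)\<^sup>2)"
    (is "L * ?E N \<le> ?R")
proof (cases "L = 0")
  case True
  then show ?thesis using jint_square_nonneg by simp
next
  case False
  with L have "L > 0" by simp
  have ab1: "a + 1 > -1" "b + 1 > -1" using ab by auto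
  have cu: "continuous_on {-1..1} u" using du by (rule DERIV_continuous_on)
  have Lu: "jacobi_L2 a b u" by (intro jacobi_L2_continuous ab m cu)
  have Lu': "jacobi_L2 (a + 1) (b + 1) u'" by (intro jacobi_L2_continuous ab1 m cu')
  define S where "S = (\<lambda>n. (jacobi_coeff a b u n)\<^sup>2 * jacobi_sigma a b n)"
  define S' where "S' = (\<lambda>n. (jacobi_coeff (a + 1) (b + 1) u' n)\<^sup>2 * jacobi_sigma (a + 1) (b + 1) n)"
  have S0: "S n \<ge> 0" for n using jacobi_sigma_pos[OF ab, of n] by (simp add: S_def)
  have S': "S' n = real (Suc n) * (real (Suc n) + a + b + 1) * S (Suc n)" for n
  proof -
    have "jacobi_coeff (a + 1) (b + 1) u' n = (real n + a + b + 2) / 2 * jacobi_coeff a b u (Suc n)"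
      by (intro jacobi_coeff_deriv ab m du cu')
    then show ?thesis unfolding S'_def S_def by (simp only: jacobi_sigma_shift[OF ab])
  qed
  obtain N' where N': "N = Suc N'" using N by (cases N) auto
  \<comment> \<open>Finite pieces of the tail are compared mode by mode. For \<open>u'\<close>
    Bessel's inequality suffices: what remains of its norm after the first N - 1 modes is its
    truncation error.\<close>
  have tail: "L * (\<Sum>n\<in>{N..<M}. S n) \<le> ?R" if "M \<ge> N" for M
  proof -
    obtain M' where M': "M = Suc M'" "M' \<ge> N'" using \<open>M \<ge> N\<close> N' by (cases M) auto
    have "L * (\<Sum>n\<in>{N..<M}. S n) = (\<Sum>n\<in>{N'..<M'}. L * S (Suc n))"
      unfolding N' M' sum.shift_bounds_Suc_ivl by (simp add: sum_distrib_left)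
    also have "\<dots> \<le> (\<Sum>n\<in>{N'..<M'}. S' n)"
    proof (rule sum_mono)
      fix n assume "n \<in> {N'..<M'}"
      then have n: "real N \<le> real (Suc n)" using N' by auto
      then have "real N * (real N + a + b + 1) \<le> real (Suc n) * (real (Suc n) + a + b + 1)"
        using ab N' by (intro mult_mono) auto
      then show "L * S (Suc n) \<le> S' n" unfolding S'
        using L S0 by (intro mult_right_mono) auto
    qed
    also have "\<dots> = (\<Sum>n<M'. S' n) - (\<Sum>n<N'. S' n)"
      using sum.atLeastLessThan_concat[of 0 N' M' S'] M' by (simp add: lessThan_atLeast0)
    also have "\<dots> \<le> jint (a + 1) (b + 1) (\<lambda>x. (u' x)\<^sup>2) - (\<Sum>n<N'. S' n)"
      using jacobi_bessel[OF ab1 Lu', of M'] by (simp add: S'_def)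
    also have "\<dots> = ?R"
      using jacobi_pythagoras[OF ab1 Lu', of N'] by (simp add: S'_def N' del: jacobi_sum.simps)
    finally show ?thesis .
  qed
  show ?thesis
  \<comment> \<open>Completeness exhausts the tail of \<open>u\<close> by finite pieces up to an
    arbitrary error.\<close>
  proof (rule field_le_epsilon)
    fix e :: real assume "e > 0"
    then have "e / L > 0" using \<open>L > 0\<close> by simp
    then obtain M where M: "M \<ge> N" "?E M \<le> e / L"
      using jacobi_completeness[OF ab m(1) cu] by blast
    have "?E N = ?E M + (\<Sum>n\<in>{N..<M}. S n)"
      unfolding jacobi_pythagoras[OF ab Lu]
      using sum.atLeastLessThan_concat[of 0 N M S] M(1) by (simp add: lessThan_atLeast0 S_def)
    then have "L * ?E N = L * ?E M + L * (\<Sum>n\<in>{N..<M}. S n)"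
      by (simp only: distrib_left)
    moreover have "L * ?E M \<le> e" using M(2) \<open>L > 0\<close> by (simp add: field_simps del: jacobi_sum.simps)
    ultimately show "L * ?E N \<le> ?R + e" using tail[OF M(1)] by linarith
  qed
qed

text \<open>The first j derivatives commute with the truncation and gain nothing; each of the
  remaining K - j is a Poincare step. After i derivatives there are N - i modes with parameters a +
  i and b + i, whence the condition on \<open>L\<close>.\<close>

lemma jacobi_spectral:
  assumes "a > -1" "b > -1"
    and "\<And>k. k \<le> K \<Longrightarrow> U k \<in> borel_measurable borel"
    and "\<And>k x. k < K \<Longrightarrow> x \<in> {-1..1} \<Longrightarrow> (U k has_real_derivative U (Suc k) x) (at x within {-1..1})"
    and "\<And>k. k \<le> K \<Longrightarrow> continuous_on {-1..1} (U k)"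
    and "K \<le> N" "j \<le> K" "L \<ge> 0"
    and "\<And>i. i < K \<Longrightarrow> L \<le> (real N - real i) * (real N + real i + a + b + 1)"
  shows "L ^ (K - j) * jint (a + real j) (b + real j) (\<lambda>x. (U j x - jacobi_trunc j a b N (U 0) x)\<^sup>2)
    \<le> jint (a + real K) (b + real K) (\<lambda>x. (U K x)\<^sup>2)"
  using assms
proof (induction K arbitrary: a b N U j)
  case 0
  then show ?case using jacobi_error_le[of a b "U 0" N]
    by (simp add: jacobi_L2_continuous del: jacobi_sum.simps)
next
  case (Suc K)
  note ab = Suc.prems(1,2)
  have L: "L \<le> (real (N - 1) - real i) * (real (N - 1) + real i + (a + 1) + (b + 1) + 1)" if "i < K" for i
    using Suc.prems(9)[of "Suc i"] Suc.prems(6) that by (simp add: of_nat_diff algebra_simps)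
  have IH: "L ^ (K - j) * jint (a + 1 + real j) (b + 1 + real j)
       (\<lambda>x. (U (Suc j) x - jacobi_trunc j (a + 1) (b + 1) (N - 1) (U (Suc 0)) x)\<^sup>2)
    \<le> jint (a + 1 + real K) (b + 1 + real K) (\<lambda>x. (U (Suc K) x)\<^sup>2)" if "j \<le> K" for j
    using Suc.prems that L by (intro Suc.IH[of "a + 1" "b + 1" "\<lambda>k. U (Suc k)" "N - 1" j]) auto
  have d: "\<And>x. x \<in> {-1..1} \<Longrightarrow> (U 0 has_real_derivative U (Suc 0) x) (at x within {-1..1})"
    by (intro Suc.prems(4)) auto
  show ?case
  proof (cases j)
    case 0
    have "L * jint a b (\<lambda>x. (U 0 x - jacobi_trunc 0 a b N (U 0) x)\<^sup>2)
      \<le> jint (a + 1) (b + 1) (\<lambda>x. (U (Suc 0) x - jacobi_trunc 0 (a + 1) (b + 1) (N - 1) (U (Suc 0)) x)\<^sup>2)"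
      using Suc.prems(6) Suc.prems(9)[of 0] by (intro jacobi_poincare ab d Suc.prems) auto
    from mult_left_mono[OF this, of "L ^ K"] IH[of 0] Suc.prems(8) show ?thesis
      by (simp add: 0 mult_ac add_ac del: jacobi_sum.simps)
  next
    case (Suc j')
    have "jacobi_coeff (a + 1) (b + 1) (U (Suc 0)) n
        = (real n + a + b + 2) / 2 * jacobi_coeff a b (U 0) (Suc n)" for n
      by (intro jacobi_coeff_deriv ab d Suc.prems) auto
    then have "jacobi_trunc j a b N (U 0) = jacobi_trunc j' (a + 1) (b + 1) (N - 1) (U (Suc 0))"
      unfolding Suc jacobi_sum.simps(2) by presburger
    then show ?thesis using IH[of j'] Suc Suc.prems(7)
      by (simp add: add_ac del: jacobi_sum.simps)
  qed
qed

lemma jacobi_spectral_rate: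
  assumes ab: "a > -1" "b > -1"
    and "\<And>k. k \<le> K \<Longrightarrow> U k \<in> borel_measurable borel"
    and "\<And>k x. k < K \<Longrightarrow> x \<in> {-1..1} \<Longrightarrow> (U k has_real_derivative U (Suc k) x) (at x within {-1..1})"
    and "\<And>k. k \<le> K \<Longrightarrow> continuous_on {-1..1} (U k)"
    and N: "2 * K < N" and j: "j \<le> K"
  shows "jint (a + real j) (b + real j) (\<lambda>x. (U j x - jacobi_trunc j a b (Suc N) (U 0) x)\<^sup>2)
    \<le> (4 / (real N)\<^sup>2) ^ (K - j) * jint (a + real K) (b + real K) (\<lambda>x. (U K x)\<^sup>2)"
proof -
  \<comment> \<open>Since i < K and 2 K < N, both factors of each eigenvalue bound are at least N /
    2.\<close>
  define L where "L = (real N)\<^sup>2 / 4"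
  have L: "L > 0" using N by (simp add: L_def)
  have "L \<le> (real (Suc N) - real i) * (real (Suc N) + real i + a + b + 1)" if "i < K" for i
  proof -
    have "(real N / 2) * (real N / 2) \<le> (real (Suc N) - real i) * (real (Suc N) + real i + a + b + 1)"
      using N that ab by (intro mult_mono) auto
    then show ?thesis by (simp add: L_def power2_eq_square)
  qed
  then have "L ^ (K - j) * jint (a + real j) (b + real j)
      (\<lambda>x. (U j x - jacobi_trunc j a b (Suc N) (U 0) x)\<^sup>2)
    \<le> jint (a + real K) (b + real K) (\<lambda>x. (U K x)\<^sup>2)" (is "_ * ?A \<le> ?B")
    using N L by (intro jacobi_spectral assms) auto
  then have "?A \<le> ?B / L ^ (K - j)" using L by (simp add: field_simps del: jacobi_sum.simps)
  also have "\<dots> = (1 / L) ^ (K - j) * ?B" by (simp add: power_divide)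
  also have "1 / L = 4 / (real N)\<^sup>2" by (simp add: L_def)
  finally show ?thesis .
qed

text \<open>For functions without usable derivatives: Bessel's inequality bounds the projection by
  the plain norm of the function, and each derivative of the projection costs a constant times N^2
  in the squared norm.\<close>

lemma jacobi_trunc_stable:
  assumes ab: "a > -1" "b > -1" and u: "jacobi_L2 a b u" and N: "N > 0"
  shows "jint (a + real j) (b + real j) (\<lambda>x. (jacobi_trunc j a b (Suc N) u x)\<^sup>2)
    \<le> (2 * (\<bar>a + b\<bar> + 2 * real j + 3) * (real N)\<^sup>2) ^ j * jint a b (\<lambda>x. (u x)\<^sup>2)"
proof -
  have N1: "real N \<ge> 1" using N by simp
  have "\<bar>a + b\<bar> * 1 \<le> \<bar>a + b\<bar> * real N" "real j * 1 \<le> real j * real N"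
    using N1 by (intro mult_left_mono; simp)+
  then have 1: "real (Suc N) + \<bar>a + b\<bar> + 2 * real j + 1 \<le> (\<bar>a + b\<bar> + 2 * real j + 3) * real N"
    using N1 unfolding distrib_right by simp
  have "real (Suc N) * (real (Suc N) + \<bar>a + b\<bar> + 2 * real j + 1)
      \<le> (2 * real N) * ((\<bar>a + b\<bar> + 2 * real j + 3) * real N)"
    using 1 N1 by (intro mult_mono) auto
  also have "\<dots> = 2 * (\<bar>a + b\<bar> + 2 * real j + 3) * (real N)\<^sup>2" by (simp add: power2_eq_square)
  finally have "jint (a + real j) (b + real j) (\<lambda>x. (jacobi_trunc j a b (Suc N) u x)\<^sup>2)
    \<le> (2 * (\<bar>a + b\<bar> + 2 * real j + 3) * (real N)\<^sup>2) ^ j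
       * (\<Sum>n<Suc N. (jacobi_coeff a b u n)\<^sup>2 * jacobi_sigma a b n)"
    by (intro jacobi_inverse_inequality ab)
  also have "\<dots> \<le> (2 * (\<bar>a + b\<bar> + 2 * real j + 3) * (real N)\<^sup>2) ^ j * jint a b (\<lambda>x. (u x)\<^sup>2)"
    by (intro mult_left_mono jacobi_bessel ab u) simp
  finally show ?thesis .
qed

subsection \<open>Singular functions and cutoffs\<close>

text \<open>\<open>leib k A B\<close> is the \<open>k\<close>-th derivative of a product, given the derivatives \<open>A i\<close> and \<open>B i\<close>
  of the factors.\<close>

primrec leib :: "nat \<Rightarrow> (nat \<Rightarrow> real \<Rightarrow> real) \<Rightarrow> (nat \<Rightarrow> real \<Rightarrow> real) \<Rightarrow> real \<Rightarrow> real" where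
  "leib 0 A B = (\<lambda>x. A 0 x * B 0 x)"
| "leib (Suc k) A B = (\<lambda>x. leib k (\<lambda>i. A (Suc i)) B x + leib k A (\<lambda>i. B (Suc i)) x)"

lemma leib_deriv:
  assumes "\<And>i. i \<le> k \<Longrightarrow> (A i has_real_derivative A (Suc i) x) (at x within S)"
    and "\<And>i. i \<le> k \<Longrightarrow> (B i has_real_derivative B (Suc i) x) (at x within S)"
  shows "(leib k A B has_real_derivative leib (Suc k) A B x) (at x within S)"
  using assms
proof (induction k arbitrary: A B)
  case 0
  then show ?case using DERIV_mult[of "A 0" "A 1 x" x S "B 0" "B 1 x"]
    by (simp add: mult.commute add.commute)
next
  case (Suc k)
  have "(leib k (\<lambda>i. A (Suc i)) B has_real_derivative leib (Suc k) (\<lambda>i. A (Suc i)) B x) (at x within S)"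
    using Suc.prems by (intro Suc.IH) auto
  moreover have "(leib k A (\<lambda>i. B (Suc i)) has_real_derivative leib (Suc k) A (\<lambda>i. B (Suc i)) x) (at x within S)"
    using Suc.prems by (intro Suc.IH) auto
  ultimately have "((\<lambda>x. leib k (\<lambda>i. A (Suc i)) B x + leib k A (\<lambda>i. B (Suc i)) x) has_real_derivative
      leib (Suc k) (\<lambda>i. A (Suc i)) B x + leib (Suc k) A (\<lambda>i. B (Suc i)) x) (at x within S)"
    by (rule DERIV_add)
  then show ?case unfolding leib.simps(2)[of k A B] leib.simps(2)[of "Suc k" A B] .
qed

lemma leib_measurable:
  "(\<And>i. A i \<in> borel_measurable borel) \<Longrightarrow> (\<And>i. B i \<in> borel_measurable borel) \<Longrightarrow>
    leib k A B \<in> borel_measurable borel"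
  by (induction k arbitrary: A B) auto

text \<open>All 2^k terms of the unfolded Leibniz rule have the same homogeneity p + q - k,
  whichever factor is differentiated.\<close>

lemma leib_bound:
  fixes r :: real
  assumes "r > 0" "CA \<ge> 0" "CB \<ge> 0"
    and "\<And>i. i \<le> k \<Longrightarrow> \<bar>A i x\<bar> \<le> CA * r powr (p - real i)"
    and "\<And>i. i \<le> k \<Longrightarrow> \<bar>B i x\<bar> \<le> CB * r powr (q - real i)"
  shows "\<bar>leib k A B x\<bar> \<le> 2 ^ k * CA * CB * r powr (p + q - real k)"
  using assms(4,5)
proof (induction k arbitrary: A B p q)
  case 0
  have "\<bar>A 0 x\<bar> * \<bar>B 0 x\<bar> \<le> (CA * r powr p) * (CB * r powr q)"
    using 0[of 0] assms by (intro mult_mono) auto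
  then show ?case by (simp add: abs_mult powr_add mult_ac)
next
  case (Suc k)
  have "\<bar>leib k (\<lambda>i. A (Suc i)) B x\<bar> \<le> 2 ^ k * CA * CB * r powr ((p - 1) + q - real k)"
    using Suc.prems by (intro Suc.IH) (force simp: algebra_simps)+
  moreover have "\<bar>leib k A (\<lambda>i. B (Suc i)) x\<bar> \<le> 2 ^ k * CA * CB * r powr (p + (q - 1) - real k)"
    using Suc.prems by (intro Suc.IH) (force simp: algebra_simps)+
  moreover have "(p - 1) + q - real k = p + q - real (Suc k)" "p + (q - 1) - real k = p + q - real (Suc k)"
    by auto
  ultimately have "\<bar>leib (Suc k) A B x\<bar> \<le> 2 * (2 ^ k * CA * CB * r powr (p + q - real (Suc k)))"
    by (simp only: leib.simps)
  then show ?case by (simp add: mult_ac)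
qed

lemma leib_zero_left: "(\<And>i. i \<le> k \<Longrightarrow> A i x = 0) \<Longrightarrow> leib k A B x = 0"
  by (induction k arbitrary: A B) auto

lemma leib_zero_right: "(\<And>i. i \<le> k \<Longrightarrow> B i x = 0) \<Longrightarrow> leib k A B x = 0"
  by (induction k arbitrary: A B) auto

lemma leib_one_right:
  "B 0 x = 1 \<Longrightarrow> (\<And>i. 0 < i \<Longrightarrow> i \<le> k \<Longrightarrow> B i x = 0) \<Longrightarrow> leib k A B x = A k x"
  by (induction k arbitrary: A) (auto intro!: leib_zero_right)

text \<open>Differentiating r^(\<gamma> - k) q(ln (r / h)) in r gives r^(\<gamma> - k - 1) times
  (\<gamma> - k) q + q' at the same logarithm. The polynomials do not involve h, which is the source
  of all bounds uniform in the scale.\<close>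

primrec sing_poly :: "real \<Rightarrow> nat \<Rightarrow> real poly \<Rightarrow> real poly" where
  "sing_poly \<gamma> 0 p = p"
| "sing_poly \<gamma> (Suc k) p = smult (\<gamma> - real k) (sing_poly \<gamma> k p) + pderiv (sing_poly \<gamma> k p)"

text \<open>The \<open>k\<close>-th derivative of \<open>\<bar>x - z\<bar>\<^sup>\<gamma> p(ln (\<bar>x - z\<bar> / h))\<close>, with junk value \<open>0\<close> at \<open>x = z\<close>.\<close>

definition sing :: "real \<Rightarrow> real \<Rightarrow> real \<Rightarrow> real poly \<Rightarrow> nat \<Rightarrow> real \<Rightarrow> real" where
  "sing z \<gamma> h p k x = sgn (x - z) ^ k * \<bar>x - z\<bar> powr (\<gamma> - real k)
     * poly (sing_poly \<gamma> k p) (ln (\<bar>x - z\<bar> / h))"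

lemma sing_measurable [measurable]: "sing z \<gamma> h p k \<in> borel_measurable borel"
proof -
  have [measurable]: "poly q \<in> borel_measurable borel" for q :: "real poly"
    by (intro borel_measurable_continuous_onI) (auto intro: continuous_intros)
  have [measurable]: "(sgn :: real \<Rightarrow> real) \<in> borel_measurable borel"
    unfolding sgn_real_def[abs_def] by measurable
  show ?thesis unfolding sing_def[abs_def] by measurable
qed

lemma sing_at [simp]: "sing z \<gamma> h p k z = 0"
  by (simp add: sing_def)

lemma sing_deriv:
  assumes x: "x \<noteq> z" and h: "h > 0"
  shows "(sing z \<gamma> h p k has_real_derivative sing z \<gamma> h p (Suc k) x) (at x within S)"
proof -
  \<comment> \<open>On the side of \<open>z\<close> that contains \<open>x\<close> the sign is
    constant, so the distance is the affine function \<open>s * (y - z)\<close> there.\<close>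
  define s where "s = sgn (x - z)"
  define q where "q = sing_poly \<gamma> k p"
  define r where "r = s * (x - z)"
  have s: "s * s = 1" "s \<noteq> 0" using x by (auto simp: s_def sgn_real_def)
  have r: "r > 0" "\<bar>x - z\<bar> = r" using x by (auto simp: r_def s_def sgn_real_def)
  have "((\<lambda>y. s ^ k * (s * (y - z)) powr (\<gamma> - real k) * poly q (ln (s * (y - z) / h)))
      has_real_derivative s ^ k * ((\<gamma> - real k) * r powr (\<gamma> - real k - 1) * s) * poly q (ln (r / h))
        + s ^ k * r powr (\<gamma> - real k) * (poly (pderiv q) (ln (r / h)) * (s / r))) (at x)"
    using r h unfolding r_def
    by (auto intro!: derivative_eq_intros poly_DERIV[THEN DERIV_chain2]
        has_real_derivative_powr[THEN DERIV_chain2] simp: field_simps)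
  also have "s ^ k * ((\<gamma> - real k) * r powr (\<gamma> - real k - 1) * s) * poly q (ln (r / h))
        + s ^ k * r powr (\<gamma> - real k) * (poly (pderiv q) (ln (r / h)) * (s / r))
      = s ^ Suc k * r powr (\<gamma> - real (Suc k)) * poly (sing_poly \<gamma> (Suc k) p) (ln (r / h))"
  proof -
    define R where "R = r powr (\<gamma> - real (Suc k))"
    have "r powr (\<gamma> - real k) = r * R"
      using r by (simp add: R_def powr_mult_base)
    moreover have "r powr (\<gamma> - real k - 1) = R" unfolding R_def by (simp add: diff_diff_eq add.commute)
    ultimately show ?thesis unfolding R_def[symmetric] using r by (simp add: q_def field_simps)
  qed
  also have "\<dots> = sing z \<gamma> h p (Suc k) x"
    using r by (simp add: sing_def s_def)
  finally have "(sing z \<gamma> h p k has_real_derivative sing z \<gamma> h p (Suc k) x) (at x)"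
  proof (rule has_field_derivative_transform_within_open)
    show "open {y. s * (y - z) > 0}" by (intro open_Collect_less continuous_intros)
    show "x \<in> {y. s * (y - z) > 0}" using r by (simp add: r_def)
    show "s ^ k * (s * (y - z)) powr (\<gamma> - real k) * poly q (ln (s * (y - z) / h)) = sing z \<gamma> h p k y"
      if "y \<in> {y. s * (y - z) > 0}" for y
    proof -
      have "\<bar>y - z\<bar> = s * (y - z)" "sgn (y - z) = s"
        using that x by (auto simp: s_def sgn_real_def split: if_splits)
      then show ?thesis by (simp add: sing_def q_def)
    qed
  qed
  then show ?thesis by (rule has_field_derivative_at_within)
qed

text \<open>With y = ln (r / h) this dominates a polynomial in the logarithm by arbitrarily small
  powers of r / h and h / r. In the induction one half of \<open>\<epsilon>\<close> absorbs the
  factor y and the other half goes to the polynomial of lower degree.\<close>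

lemma poly_exp_bound:
  fixes q :: "real poly"
  shows "\<epsilon> > 0 \<Longrightarrow> \<exists>C\<ge>0. \<forall>y. \<bar>poly q y\<bar> \<le> C * exp (\<epsilon> * \<bar>y\<bar>)"
proof (induction q arbitrary: \<epsilon>)
  case 0
  then show ?case by auto
next
  case (pCons a q)
  obtain C where C: "C \<ge> 0" "\<And>y. \<bar>poly q y\<bar> \<le> C * exp (\<epsilon> / 2 * \<bar>y\<bar>)"
    using pCons.IH[of "\<epsilon> / 2"] pCons.prems by auto
  have "\<bar>poly (pCons a q) y\<bar> \<le> (\<bar>a\<bar> + 2 / \<epsilon> * C) * exp (\<epsilon> * \<bar>y\<bar>)" for y
  proof -
    have "\<epsilon> / 2 * \<bar>y\<bar> \<le> exp (\<epsilon> / 2 * \<bar>y\<bar>)" using exp_ge_add_one_self[of "\<epsilon> / 2 * \<bar>y\<bar>"] by linarith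
    then have "\<bar>y\<bar> \<le> 2 / \<epsilon> * exp (\<epsilon> / 2 * \<bar>y\<bar>)" using pCons.prems by (simp add: field_simps)
    then have "\<bar>y\<bar> * \<bar>poly q y\<bar> \<le> (2 / \<epsilon> * exp (\<epsilon> / 2 * \<bar>y\<bar>)) * (C * exp (\<epsilon> / 2 * \<bar>y\<bar>))"
      using C pCons.prems by (intro mult_mono) auto
    also have "\<dots> = 2 / \<epsilon> * C * (exp (\<epsilon> / 2 * \<bar>y\<bar>) * exp (\<epsilon> / 2 * \<bar>y\<bar>))" by simp
    also have "exp (\<epsilon> / 2 * \<bar>y\<bar>) * exp (\<epsilon> / 2 * \<bar>y\<bar>) = exp (\<epsilon> * \<bar>y\<bar>)"
      unfolding exp_add[symmetric] by simp
    finally have "\<bar>y * poly q y\<bar> \<le> 2 / \<epsilon> * C * exp (\<epsilon> * \<bar>y\<bar>)" by (simp add: abs_mult)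
    moreover have "\<bar>a\<bar> * 1 \<le> \<bar>a\<bar> * exp (\<epsilon> * \<bar>y\<bar>)" using pCons.prems by (intro mult_left_mono) auto
    ultimately show ?thesis unfolding poly_pCons distrib_right by linarith
  qed
  moreover have "\<bar>a\<bar> + 2 / \<epsilon> * C \<ge> 0" using C pCons.prems by simp
  ultimately show ?case by blast
qed

lemma finite_uniform_bound:
  assumes "\<And>k::nat. k \<le> K \<Longrightarrow> \<exists>C::real. C \<ge> 0 \<and> (\<forall>x. P k x \<longrightarrow> f k x \<le> C * g k x)"
    and "\<And>k x. P k x \<Longrightarrow> g k x \<ge> 0"
  shows "\<exists>C\<ge>0. \<forall>k\<le>K. \<forall>x. P k x \<longrightarrow> f k x \<le> C * g k x"
proof -
  obtain C where C: "\<And>k. k \<le> K \<Longrightarrow> C k \<ge> 0 \<and> (\<forall>x. P k x \<longrightarrow> f k x \<le> C k * g k x)"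
    using assms(1) by metis
  have "f k x \<le> (\<Sum>k\<le>K. C k) * g k x" if "k \<le> K" "P k x" for k x
  proof -
    have "C k \<le> (\<Sum>k\<le>K. C k)" using C that by (intro member_le_sum) auto
    then have "C k * g k x \<le> (\<Sum>k\<le>K. C k) * g k x" using assms(2) that by (intro mult_right_mono) auto
    with C that show ?thesis by (meson order_trans)
  qed
  moreover have "(\<Sum>k\<le>K. C k) \<ge> 0" using C by (intro sum_nonneg) auto
  ultimately show ?thesis by blast
qed

text \<open>For positive \<open>r\<close> this is the larger of r / h and h / r, raised to the power
  \<open>\<epsilon>\<close>: the scale-invariant price for a polynomial in the logarithm.\<close>

definition log_factor :: "real \<Rightarrow> real \<Rightarrow> real \<Rightarrow> real" where
  "log_factor \<epsilon> h r = exp (\<epsilon> * \<bar>ln (r / h)\<bar>)"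

text \<open>The pair \<open>hx\<close> holds the scale and the point, so that a single constant
  serves all of them at once.\<close>

lemma sing_bound:
  assumes "\<epsilon> > 0"
  shows "\<exists>C\<ge>0. \<forall>k\<le>K. \<forall>hx. fst hx > 0 \<longrightarrow> \<bar>sing z \<gamma> (fst hx) p k (snd hx)\<bar>
    \<le> C * (log_factor \<epsilon> (fst hx) \<bar>snd hx - z\<bar> * \<bar>snd hx - z\<bar> powr (\<gamma> - real k))"
proof (rule finite_uniform_bound)
  fix k :: nat
  obtain C where C: "C \<ge> 0" "\<And>y. \<bar>poly (sing_poly \<gamma> k p) y\<bar> \<le> C * exp (\<epsilon> * \<bar>y\<bar>)"
    using poly_exp_bound[OF assms] by blast
  have "\<bar>sing z \<gamma> h p k x\<bar> \<le> C * (log_factor \<epsilon> h \<bar>x - z\<bar> * \<bar>x - z\<bar> powr (\<gamma> - real k))" for h x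
  proof -
    have "\<bar>sgn (x - z)\<bar> \<le> 1" by (simp add: sgn_real_def)
    then have "\<bar>sgn (x - z)\<bar> ^ k \<le> 1" by (intro power_le_one) auto
    then have "\<bar>sing z \<gamma> h p k x\<bar> \<le> 1 * \<bar>x - z\<bar> powr (\<gamma> - real k) * (C * log_factor \<epsilon> h \<bar>x - z\<bar>)"
      unfolding sing_def log_factor_def abs_mult power_abs
      using C by (intro mult_mono) auto
    then show ?thesis by (simp add: mult_ac)
  qed
  then show "\<exists>C\<ge>0. \<forall>hx. fst hx > 0 \<longrightarrow> \<bar>sing z \<gamma> (fst hx) p k (snd hx)\<bar>
    \<le> C * (log_factor \<epsilon> (fst hx) \<bar>snd hx - z\<bar> * \<bar>snd hx - z\<bar> powr (\<gamma> - real k))"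
    using C by blast
qed (simp add: log_factor_def)

section \<open>The cutoff function\<close>

lemma power_dvd_pderiv:
  fixes s p :: "real poly"
  assumes "s ^ Suc n dvd p"
  shows "s ^ n dvd pderiv p"
proof -
  obtain r where p: "p = s ^ Suc n * r" using assms by (elim dvdE)
  have "pderiv p = s ^ n * (s * pderiv r + smult (of_nat (Suc n)) (pderiv s) * r)"
    unfolding p pderiv_mult pderiv_power_Suc by (simp add: algebra_simps)
  then show ?thesis by simp
qed

lemma power_dvd_pderiv_funpow:
  fixes s p :: "real poly"
  shows "s ^ (n + k) dvd p \<Longrightarrow> s ^ n dvd (pderiv ^^ k) p"
proof (induction k arbitrary: n)
  case (Suc k)
  then have "s ^ Suc n dvd (pderiv ^^ k) p" by (intro Suc.IH) simp
  then show ?case by (simp add: power_dvd_pderiv)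
qed simp

lemma poly_pderiv_funpow_eq_0:
  fixes s p :: "real poly"
  assumes "s ^ Suc K dvd p" "k \<le> K" "poly s t = 0"
  shows "poly ((pderiv ^^ k) p) t = 0"
proof -
  have "s ^ (Suc (K - k) + k) dvd p" using assms by (simp add: Suc_diff_le)
  then have "s ^ Suc (K - k) dvd (pderiv ^^ k) p" by (rule power_dvd_pderiv_funpow)
  then obtain r where "(pderiv ^^ k) p = s ^ Suc (K - k) * r" by (elim dvdE)
  then show ?thesis using assms by simp
qed

text \<open>With \<open>q(t) = (1 - (1 - t)\<^sup>K\<^sup>+\<^sup>1)\<^sup>K\<^sup>+\<^sup>1\<close>, \<open>q\<close> vanishes to order \<open>K + 1\<close> at \<open>0\<close> and \<open>1 - q\<close>
  vanishes to order \<open>K + 1\<close> at \<open>1\<close>.\<close>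

definition step_poly :: "nat \<Rightarrow> real poly" where
  "step_poly K = (1 - [:1, -1:] ^ Suc K) ^ Suc K"

text \<open>Used with v = 1 - t for the zero of \<open>step_poly\<close> at 0, and with v = 1 - (1 -
  t)^(K+1) for the zero of its complement at 1.\<close>

lemma one_minus_dvd_one_minus_power: "1 - v dvd 1 - (v :: real poly) ^ n"
proof -
  have "v - 1 dvd v ^ n - 1" using power_diff_sumr2[of v n 1] by simp
  then show ?thesis by (metis dvd_minus_iff minus_diff_eq minus_dvd_iff)
qed

lemma step_poly_0:
  assumes "k \<le> K" shows "poly ((pderiv ^^ k) (step_poly K)) 0 = 0"
proof (rule poly_pderiv_funpow_eq_0[OF _ assms, of "[:0, 1:]"])
  have "[:0, 1:] = 1 - [:1, -1::real:]" by (simp add: one_pCons)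
  then show "[:0, 1:] ^ Suc K dvd step_poly K"
    unfolding step_poly_def by (metis dvd_power_same one_minus_dvd_one_minus_power)
qed simp

lemma step_poly_1:
  assumes "k \<le> K" shows "poly ((pderiv ^^ k) (step_poly K)) 1 = (if k = 0 then 1 else 0)"
proof -
  have "[:1, -1:] ^ Suc K dvd 1 - step_poly K"
    using one_minus_dvd_one_minus_power[of "1 - [:1, -1::real:] ^ Suc K" "Suc K"]
    by (simp add: step_poly_def)
  then have 0: "poly ((pderiv ^^ k) (1 - step_poly K)) 1 = 0"
    using assms by (rule poly_pderiv_funpow_eq_0) simp
  have "(pderiv ^^ k) (1 - step_poly K) = (if k = 0 then 1 else 0) - (pderiv ^^ k) (step_poly K)"
    by (induction k) (auto simp: pderiv_diff)
  with 0 show ?thesis by (auto split: if_splits)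
qed

text \<open>Finite smoothness K is enough, because each estimate takes only finitely many
  derivatives; a piecewise polynomial then serves in place of an exponential bump function.\<close>

definition step :: "nat \<Rightarrow> nat \<Rightarrow> real \<Rightarrow> real" where
  "step K k t = (if t \<le> 0 then 0 else if t \<le> 1 then poly ((pderiv ^^ k) (step_poly K)) t
     else if k = 0 then 1 else 0)"

lemma DERIV_If_le:
  fixes f g :: "real \<Rightarrow> real"
  assumes f: "t \<le> c \<Longrightarrow> (f has_real_derivative D) (at t)"
    and g: "t \<ge> c \<Longrightarrow> (g has_real_derivative D) (at t)" and fg: "f c = g c"
  shows "((\<lambda>t. if t \<le> c then f t else g t) has_real_derivative D) (at t)"
proof (cases t c rule: linorder_cases)
  case less
  show ?thesis
    by (rule has_field_derivative_transform_within_open[OF f, of "{..<c}"]) (use less in auto)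
next
  case greater
  show ?thesis
    by (rule has_field_derivative_transform_within_open[OF g, of "{c<..}"]) (use greater in auto)
next
  case equal
  let ?h = "\<lambda>t. if t \<le> c then f t else g t"
  have "((\<lambda>y. (f y - f t) / (y - t)) \<longlongrightarrow> D) (at_left t)"
    using f equal by (auto simp: has_field_derivative_iff filterlim_at_split)
  then have "((\<lambda>y. (?h y - ?h t) / (y - t)) \<longlongrightarrow> D) (at_left t)"
    by (rule Lim_transform_eventually)
      (auto simp: eventually_at_left_field equal intro!: exI[of _ "c - 1"])
  moreover have "((\<lambda>y. (g y - g t) / (y - t)) \<longlongrightarrow> D) (at_right t)"
    using g equal by (auto simp: has_field_derivative_iff filterlim_at_split)
  then have "((\<lambda>y. (?h y - ?h t) / (y - t)) \<longlongrightarrow> D) (at_right t)"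
    by (rule Lim_transform_eventually)
      (auto simp: eventually_at_right_field equal fg intro!: exI[of _ "c + 1"])
  ultimately show ?thesis by (simp add: has_field_derivative_iff filterlim_at_split)
qed

lemma step_deriv:
  assumes "k < K"
  shows "(step K k has_real_derivative step K (Suc k) t) (at t within S)"
proof -
  note c = step_poly_0[of k K] step_poly_0[of "Suc k" K] step_poly_1[of k K] step_poly_1[of "Suc k" K]
  have e: "step K k = (\<lambda>t. if t \<le> 0 then 0 else if t \<le> 1
      then poly ((pderiv ^^ k) (step_poly K)) t else if k = 0 then 1 else 0)"
    by (rule ext) (simp add: step_def)
  have "(step K k has_real_derivative step K (Suc k) t) (at t)"
    unfolding e
    using assms c
    by (intro DERIV_If_le) (auto simp: step_def intro!: derivative_eq_intros)
  then show ?thesis by (rule has_field_derivative_at_within)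
qed

lemma step_measurable [measurable]: "step K k \<in> borel_measurable borel"
proof -
  have [measurable]: "poly q \<in> borel_measurable borel" for q :: "real poly"
    by (intro borel_measurable_continuous_onI) (auto intro: continuous_intros)
  show ?thesis unfolding step_def[abs_def] by measurable
qed

lemma step_bounded: "\<exists>C\<ge>1. \<forall>k\<le>K. \<forall>t. \<bar>step K k t\<bar> \<le> C"
proof -
  have "\<exists>C\<ge>0. \<forall>t. True \<longrightarrow> \<bar>step K k t\<bar> \<le> C * 1" for k
  proof -
    have "bounded (poly ((pderiv ^^ k) (step_poly K)) ` {0..1})"
      by (intro compact_imp_bounded compact_continuous_image) (auto intro: continuous_intros)
    then obtain B where B: "\<forall>t\<in>{0..1}. \<bar>poly ((pderiv ^^ k) (step_poly K)) t\<bar> \<le> B"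
      unfolding bounded_iff by auto
    have "\<bar>step K k t\<bar> \<le> max 1 B" for t
      using B[rule_format, of t] by (auto simp: step_def max_def)
    then show ?thesis by (intro exI[of _ "max 1 B"]) auto
  qed
  then obtain C where "C \<ge> 0" "\<forall>k\<le>K. \<forall>t. \<bar>step K k t\<bar> \<le> C"
    using finite_uniform_bound[of K "\<lambda>_ _. True" "\<lambda>k t. \<bar>step K k t\<bar>" "\<lambda>_ _. 1"] by auto
  then show ?thesis by (intro exI[of _ "max 1 C"]) (auto simp: le_max_iff_disj)
qed

text \<open>The derivatives of a cutoff which is \<open>0\<close> for \<open>\<bar>x - z\<bar> \<le> h / 2\<close> and \<open>1\<close> for \<open>\<bar>x - z\<bar> \<ge> h\<close>.\<close>

definition cutoff :: "nat \<Rightarrow> real \<Rightarrow> real \<Rightarrow> nat \<Rightarrow> real \<Rightarrow> real" where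
  "cutoff K z h k x = (sgn (x - z) * (2 / h)) ^ k * step K k (2 * \<bar>x - z\<bar> / h - 1)"

lemma cutoff_measurable [measurable]: "cutoff K z h k \<in> borel_measurable borel"
proof -
  have [measurable]: "(sgn :: real \<Rightarrow> real) \<in> borel_measurable borel"
    unfolding sgn_real_def[abs_def] by measurable
  show ?thesis unfolding cutoff_def[abs_def] by measurable
qed

lemma cutoff_eq_0: "h > 0 \<Longrightarrow> \<bar>x - z\<bar> \<le> h / 2 \<Longrightarrow> cutoff K z h k x = 0"
  by (simp add: cutoff_def step_def field_simps)

lemma cutoff_far:
  assumes "h > 0" "\<bar>x - z\<bar> \<ge> h" "k \<le> K"
  shows "cutoff K z h k x = (if k = 0 then 1 else 0)"
proof -
  have "2 * \<bar>x - z\<bar> / h - 1 \<ge> 1" using assms by (simp add: field_simps)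
  then show ?thesis using step_poly_1[OF assms(3)]
    by (cases "2 * \<bar>x - z\<bar> / h - 1 = 1") (auto simp: cutoff_def step_def)
qed

lemma cutoff_deriv:
  assumes k: "k < K" and x: "x \<noteq> z" and h: "h > 0"
  shows "(cutoff K z h k has_real_derivative cutoff K z h (Suc k) x) (at x within S)"
proof -
  define s where "s = sgn (x - z)"
  have s: "s * (x - z) > 0" using x by (auto simp: s_def sgn_real_def)
  have ax: "\<bar>y - z\<bar> = s * (y - z)" "sgn (y - z) = s" if "s * (y - z) > 0" for y
    using that x by (auto simp: s_def sgn_real_def split: if_splits)
  have "((\<lambda>y. 2 * (s * (y - z)) / h - 1) has_real_derivative s * (2 / h)) (at x)"
    using h by (auto intro!: derivative_eq_intros)
  from DERIV_chain2[where f = "step K k", OF step_deriv[OF k] this]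
  have "((\<lambda>y. (s * (2 / h)) ^ k * step K k (2 * (s * (y - z)) / h - 1)) has_real_derivative
      (s * (2 / h)) ^ k * (step K (Suc k) (2 * (s * (x - z)) / h - 1) * (s * (2 / h)))) (at x)"
    by (rule DERIV_cmult)
  also have "(s * (2 / h)) ^ k * (step K (Suc k) (2 * (s * (x - z)) / h - 1) * (s * (2 / h)))
     = cutoff K z h (Suc k) x"
    unfolding cutoff_def ax[OF s] by simp
  finally have "(cutoff K z h k has_real_derivative cutoff K z h (Suc k) x) (at x)"
  proof (rule has_field_derivative_transform_within_open)
    show "open {y. s * (y - z) > 0}" by (intro open_Collect_less continuous_intros)
    show "x \<in> {y. s * (y - z) > 0}" using s by simp
    show "(s * (2 / h)) ^ k * step K k (2 * (s * (y - z)) / h - 1) = cutoff K z h k y"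
      if "y \<in> {y. s * (y - z) > 0}" for y
      using ax[of y] that by (simp add: cutoff_def)
  qed
  then show ?thesis by (rule has_field_derivative_at_within)
qed

text \<open>Where a derivative of positive order is nonzero, the distance to \<open>z\<close> is at
  most h, so every factor 1 / h is bounded by the inverse distance. The cutoff thus behaves like a
  function of homogeneity 0, uniformly in h.\<close>

lemma cutoff_bound:
  "\<exists>C\<ge>0. \<forall>k\<le>K. \<forall>h>0. \<forall>x. x \<noteq> z \<longrightarrow> \<bar>cutoff K z h k x\<bar> \<le> C * \<bar>x - z\<bar> powr (0 - real k)"
proof -
  obtain C where C: "C \<ge> 1" "\<And>k t. k \<le> K \<Longrightarrow> \<bar>step K k t\<bar> \<le> C" using step_bounded by blast
  have "\<bar>cutoff K z h k x\<bar> \<le> (2 ^ K * C) * \<bar>x - z\<bar> powr (0 - real k)"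
    if k: "k \<le> K" and h: "h > 0" and x: "x \<noteq> z" for k h x
  proof -
    define r where "r = \<bar>x - z\<bar>"
    have r: "r > 0" using x by (simp add: r_def)
    have p: "r powr (0 - real k) = (1 / r) ^ k"
      using r by (simp add: powr_minus powr_realpow power_one_over inverse_eq_divide)
    have 2: "(2::real) ^ k \<le> 2 ^ K" using k by (intro power_increasing) auto
    show ?thesis
    proof (cases "r \<le> h")
      case True
      have "\<bar>cutoff K z h k x\<bar> = (2 / h) ^ k * \<bar>step K k (2 * r / h - 1)\<bar>"
        using h x by (simp add: cutoff_def abs_mult power_abs power_mult_distrib r_def abs_sgn_eq)
      also have "\<dots> \<le> (2 / r) ^ k * C"
        using True h r C k by (intro mult_mono power_mono divide_left_mono) auto
      also have "\<dots> = 2 ^ k * (1 / r) ^ k * C" by (simp add: power_divide)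
      also have "\<dots> \<le> 2 ^ K * (1 / r) ^ k * C"
        using 2 r C by (intro mult_right_mono) auto
      finally show ?thesis by (simp only: p r_def[symmetric] mult_ac)
    next
      case False
      have "\<bar>cutoff K z h k x\<bar> \<le> 1 * 1 * (1 / r) ^ k"
        using False h k r cutoff_far[of h x z k K] by (auto simp: r_def)
      also have "\<dots> \<le> 2 ^ K * C * (1 / r) ^ k"
        using C r by (intro mult_right_mono mult_mono) auto
      finally show ?thesis by (simp only: p r_def[symmetric] mult_ac)
    qed
  qed
  moreover have "2 ^ K * C \<ge> 0" using C by simp
  ultimately show ?thesis by blast
qed

section \<open>Weighted norms near the singularity and away from it\<close>

lemma jacobi_L2_nn_bound:
  assumes [measurable]: "u \<in> borel_measurable borel" and B: "B \<ge> 0"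
    and le: "(\<integral>\<^sup>+x. ennreal (indicator {-1<..<1} x * (jacobi_weight a b x * (u x)\<^sup>2)) \<partial>lborel) \<le> ennreal B"
  shows "jacobi_L2 a b u \<and> jint a b (\<lambda>x. (u x)\<^sup>2) \<le> B"
proof -
  have eq: "(\<integral>\<^sup>+x. ennreal ((u x)\<^sup>2) \<partial>jacobi_measure a b)
      = (\<integral>\<^sup>+x. ennreal (indicator {-1<..<1} x * (jacobi_weight a b x * (u x)\<^sup>2)) \<partial>lborel)"
    unfolding jacobi_measure_def
    by (subst nn_integral_density) (auto intro!: nn_integral_cong simp: ennreal_mult'[symmetric] mult.assoc)
  have "integrable (jacobi_measure a b) (\<lambda>x. (u x)\<^sup>2)"
    using le by (intro integrableI_nonneg) (auto simp: eq less_top[symmetric] top_unique)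
  moreover from this have "ennreal (jint a b (\<lambda>x. (u x)\<^sup>2)) \<le> ennreal B"
    using le eq by (subst nn_integral_eq_integral[symmetric]) auto
  ultimately show ?thesis using B by (simp add: jacobi_L2_def ennreal_le_iff)
qed

lemma log_factor_near:
  assumes "0 < r" "r \<le> h" "\<epsilon> > 0"
  shows "(log_factor \<epsilon> h r)\<^sup>2 = h powr (2 * \<epsilon>) * r powr (- 2 * \<epsilon>)"
proof -
  have "\<bar>ln (r / h)\<bar> = ln h - ln r" using assms by (simp add: ln_div)
  then have "(log_factor \<epsilon> h r)\<^sup>2 = exp (2 * (\<epsilon> * (ln h - ln r)))"
    by (simp add: log_factor_def power2_eq_square flip: exp_add)
  also have "\<dots> = h powr (2 * \<epsilon>) * r powr (- 2 * \<epsilon>)"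
    using assms by (simp add: powr_def algebra_simps flip: exp_add)
  finally show ?thesis .
qed

text \<open>Between h / 2 and h the logarithm of r / h is negative. The added 2 ln 2 covers this
  range, and squaring turns it into the constant \<open>16 powr \<epsilon>\<close>.\<close>

lemma log_factor_far:
  assumes "0 < h" "h / 2 \<le> r" "\<epsilon> > 0"
  shows "(log_factor \<epsilon> h r)\<^sup>2 \<le> 16 powr \<epsilon> * h powr (- 2 * \<epsilon>) * r powr (2 * \<epsilon>)"
proof -
  have r: "r > 0" using assms by linarith
  have "ln (h / 2) \<le> ln r" using assms r by (subst ln_le_cancel_iff) auto
  then have "\<bar>ln (r / h)\<bar> \<le> ln r - ln h + 2 * ln 2" using assms r ln_gt_zero[of "2::real"] by (auto simp: ln_div abs_if)
  then have "\<epsilon> * \<bar>ln (r / h)\<bar> \<le> \<epsilon> * (ln r - ln h + 2 * ln 2)" using assms by simp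
  then have "2 * (\<epsilon> * \<bar>ln (r / h)\<bar>) \<le> 2 * (\<epsilon> * (ln r - ln h + 2 * ln 2))" by simp
  moreover have "(log_factor \<epsilon> h r)\<^sup>2 = exp (2 * (\<epsilon> * \<bar>ln (r / h)\<bar>))"
    by (simp add: log_factor_def power2_eq_square flip: exp_add)
  ultimately have "(log_factor \<epsilon> h r)\<^sup>2 \<le> exp (2 * (\<epsilon> * (ln r - ln h + 2 * ln 2)))" by simp
  also have "ln 16 = 4 * ln (2::real)" using ln_realpow[of 2 4] by simp
  then have "exp (2 * (\<epsilon> * (ln r - ln h + 2 * ln 2)))
      = 16 powr \<epsilon> * h powr (- 2 * \<epsilon>) * r powr (2 * \<epsilon>)"
    using assms r by (simp add: powr_def algebra_simps flip: exp_add)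
  finally show ?thesis .
qed

text \<open>\<open>S\<close> is a set of distances to \<open>z\<close>. Bounding weight and function
  by powers of the distance leaves a single power integral; the null set {z}, where the values are a
  convention, is discarded.\<close>

lemma singular_estimate:
  assumes pos: "c \<ge> 0" "A \<ge> 0" "I \<ge> 0"
    and [measurable]: "u \<in> borel_measurable borel" "S \<in> sets borel"
    and w: "\<And>x. x \<in> {-1<..<1} \<Longrightarrow> x \<noteq> z \<Longrightarrow> \<bar>x - z\<bar> \<in> S \<Longrightarrow> jacobi_weight a b x \<le> c * \<bar>x - z\<bar> powr e"
    and u: "\<And>x. x \<in> {-1<..<1} \<Longrightarrow> x \<noteq> z \<Longrightarrow> (u x)\<^sup>2 \<le> A * (indicator S \<bar>x - z\<bar> * \<bar>x - z\<bar> powr q)"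
    and I: "(\<integral>\<^sup>+x. ennreal (indicator S \<bar>x - z\<bar> * \<bar>x - z\<bar> powr (e + q)) \<partial>lborel) \<le> ennreal I"
  shows "jacobi_L2 a b u \<and> jint a b (\<lambda>x. (u x)\<^sup>2) \<le> c * A * I"
proof (rule jacobi_L2_nn_bound)
  have "(\<integral>\<^sup>+x. ennreal (indicator {-1<..<1} x * (jacobi_weight a b x * (u x)\<^sup>2)) \<partial>lborel)
    \<le> (\<integral>\<^sup>+x. ennreal (c * A) * ennreal (indicator S \<bar>x - z\<bar> * \<bar>x - z\<bar> powr (e + q)) \<partial>lborel)"
  proof (rule nn_integral_mono_AE)
    show "AE x in lborel. ennreal (indicator {-1<..<1} x * (jacobi_weight a b x * (u x)\<^sup>2))
      \<le> ennreal (c * A) * ennreal (indicator S \<bar>x - z\<bar> * \<bar>x - z\<bar> powr (e + q))"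
      using AE_lborel_singleton[of z]
    proof eventually_elim
      case (elim x)
      have "indicator {-1<..<1} x * (jacobi_weight a b x * (u x)\<^sup>2)
        \<le> c * A * (indicator S \<bar>x - z\<bar> * \<bar>x - z\<bar> powr (e + q))"
      proof (cases "x \<in> {-1<..<1} \<and> \<bar>x - z\<bar> \<in> S")
        case True
        have "jacobi_weight a b x * (u x)\<^sup>2 \<le> (c * \<bar>x - z\<bar> powr e) * (A * \<bar>x - z\<bar> powr q)"
          using w[of x] u[of x] elim True pos by (intro mult_mono) auto
        then show ?thesis using True by (simp add: powr_add mult_ac)
      next
        case False
        then have "x \<notin> {-1<..<1} \<or> u x = 0" using u[of x] elim by auto
        then show ?thesis using pos by auto
      qed
      then show ?case using pos by (simp add: ennreal_mult'[symmetric] ennreal_leI)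
    qed
  qed
  also have "\<dots> = ennreal (c * A) *
      (\<integral>\<^sup>+x. ennreal (indicator S \<bar>x - z\<bar> * \<bar>x - z\<bar> powr (e + q)) \<partial>lborel)"
    by (rule nn_integral_cmult) simp
  also have "\<dots> \<le> ennreal (c * A) * ennreal I" using I by (rule mult_left_mono) simp
  also have "\<dots> = ennreal (c * A * I)" using pos by (intro ennreal_mult'[symmetric]) auto
  finally show "(\<integral>\<^sup>+x. ennreal (indicator {-1<..<1} x * (jacobi_weight a b x * (u x)\<^sup>2)) \<partial>lborel)
    \<le> ennreal (c * A * I)" .
qed (use pos in auto)

text \<open>\<open>\<epsilon>\<close> lowers the exponent under the integral, which costs a factor
  h^(-2 \<epsilon>), and the square of \<open>log_factor\<close> supplies the inverse factor. So
  \<open>\<epsilon>\<close> leaves no trace in the power of h. \<open>G\<close> is chosen before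
  \<open>h\<close> and \<open>u\<close>.\<close>

lemma near_estimate:
  assumes c: "c \<ge> 0" and C: "C \<ge> 0" and \<epsilon>: "\<epsilon> > 0" and p: "e + 2 * q - 2 * \<epsilon> > -1"
    and w: "\<And>x. x \<in> {-1<..<1} \<Longrightarrow> x \<noteq> z \<Longrightarrow> \<bar>x - z\<bar> \<le> h0 \<Longrightarrow> jacobi_weight a b x \<le> c * \<bar>x - z\<bar> powr e"
  shows "\<exists>G\<ge>0. \<forall>h u. 0 < h \<longrightarrow> h \<le> h0 \<longrightarrow> u \<in> borel_measurable borel \<longrightarrow>
     (\<forall>x\<in>{-1<..<1}. x \<noteq> z \<longrightarrow> \<bar>x - z\<bar> > h \<longrightarrow> u x = 0) \<longrightarrow>
     (\<forall>x\<in>{-1<..<1}. x \<noteq> z \<longrightarrow> \<bar>u x\<bar> \<le> C * (log_factor \<epsilon> h \<bar>x - z\<bar> * \<bar>x - z\<bar> powr q)) \<longrightarrow>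
     jacobi_L2 a b u \<and> jint a b (\<lambda>x. (u x)\<^sup>2) \<le> G * h powr (e + 2 * q + 1)"
proof (rule exI, intro conjI[rotated] allI impI)
  define P where "P = e + (2 * q - 2 * \<epsilon>)"
  have P: "P > -1" using p by (simp add: P_def)
  define G where "G = c * C\<^sup>2 * (2 / (P + 1))"
  show "G \<ge> 0" using c P by (simp add: G_def)
  fix h and u :: "real \<Rightarrow> real"
  assume h: "0 < h" "h \<le> h0" and m: "u \<in> borel_measurable borel"
    and u0: "\<forall>x\<in>{-1<..<1}. x \<noteq> z \<longrightarrow> \<bar>x - z\<bar> > h \<longrightarrow> u x = 0"
    and u: "\<forall>x\<in>{-1<..<1}. x \<noteq> z \<longrightarrow> \<bar>u x\<bar> \<le> C * (log_factor \<epsilon> h \<bar>x - z\<bar> * \<bar>x - z\<bar> powr q)"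
  have "jacobi_L2 a b u \<and> jint a b (\<lambda>x. (u x)\<^sup>2)
      \<le> c * (C\<^sup>2 * h powr (2 * \<epsilon>)) * (2 * (h powr (P + 1) / (P + 1)))"
  proof (rule singular_estimate[where S = "{..h}" and z = z and e = e and q = "2 * q - 2 * \<epsilon>"])
    fix x assume x: "x \<in> {-1<..<1}" "x \<noteq> z"
    show "(u x)\<^sup>2 \<le> C\<^sup>2 * h powr (2 * \<epsilon>) * (indicator {..h} \<bar>x - z\<bar> * \<bar>x - z\<bar> powr (2 * q - 2 * \<epsilon>))"
    proof (cases "\<bar>x - z\<bar> \<le> h")
      case True
      have "(u x)\<^sup>2 \<le> (C * (log_factor \<epsilon> h \<bar>x - z\<bar> * \<bar>x - z\<bar> powr q))\<^sup>2"
        using u x C unfolding abs_le_square_iff[symmetric] by (auto simp: log_factor_def)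
      also have "\<dots> = C\<^sup>2 * ((log_factor \<epsilon> h \<bar>x - z\<bar>)\<^sup>2 * (\<bar>x - z\<bar> powr q * \<bar>x - z\<bar> powr q))"
        by (simp add: power_mult_distrib power2_eq_square)
      also have "\<dots> = C\<^sup>2 * h powr (2 * \<epsilon>) * \<bar>x - z\<bar> powr (2 * q - 2 * \<epsilon>)"
      proof -
        have "\<bar>x - z\<bar> powr (- 2 * \<epsilon>) * (\<bar>x - z\<bar> powr q * \<bar>x - z\<bar> powr q) = \<bar>x - z\<bar> powr (2 * q - 2 * \<epsilon>)"
          unfolding powr_add[symmetric] by (simp add: algebra_simps)
        then show ?thesis using x log_factor_near[OF _ True \<epsilon>] by (simp add: mult.assoc)
      qed
      finally show ?thesis using True by simp
    qed (use u0 x in simp)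
    show "jacobi_weight a b x \<le> c * \<bar>x - z\<bar> powr e" if "\<bar>x - z\<bar> \<in> {..h}"
      using w[OF x] that h by simp
  next
    show "(\<integral>\<^sup>+x. ennreal (indicator {..h} \<bar>x - z\<bar> * \<bar>x - z\<bar> powr (e + (2 * q - 2 * \<epsilon>))) \<partial>lborel)
        \<le> ennreal (2 * (h powr (P + 1) / (P + 1)))"
      using P h unfolding P_def[symmetric] by (intro nn_integral_powr_near) auto
  qed (use c P m in auto)
  also have "c * (C\<^sup>2 * h powr (2 * \<epsilon>)) * (2 * (h powr (P + 1) / (P + 1))) = G * (h powr (2 * \<epsilon>) * h powr (P + 1))"
    by (simp add: G_def)
  also have "h powr (2 * \<epsilon>) * h powr (P + 1) = h powr (e + 2 * q + 1)"
    unfolding powr_add[symmetric] P_def by (simp add: algebra_simps)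
  finally show "jacobi_L2 a b u" "jint a b (\<lambda>x. (u x)\<^sup>2) \<le> G * h powr (e + 2 * q + 1)" by blast+
qed

text \<open>When the total exponent is below -1, the integral over distances from h / 2 on is
  governed by its lower end, so the bound has the same form as near \<open>z\<close>.\<close>

lemma far_estimate:
  assumes c: "c \<ge> 0" and C: "C \<ge> 0" and \<epsilon>: "\<epsilon> > 0" and p: "e + 2 * q + 2 * \<epsilon> < -1"
    and w: "\<And>x. x \<in> {-1<..<1} \<Longrightarrow> x \<noteq> z \<Longrightarrow> jacobi_weight a b x \<le> c * \<bar>x - z\<bar> powr e"
  shows "\<exists>G\<ge>0. \<forall>h u. 0 < h \<longrightarrow> u \<in> borel_measurable borel \<longrightarrow>
     (\<forall>x\<in>{-1<..<1}. x \<noteq> z \<longrightarrow> \<bar>x - z\<bar> < h / 2 \<longrightarrow> u x = 0) \<longrightarrow>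
     (\<forall>x\<in>{-1<..<1}. x \<noteq> z \<longrightarrow> \<bar>u x\<bar> \<le> C * (log_factor \<epsilon> h \<bar>x - z\<bar> * \<bar>x - z\<bar> powr q)) \<longrightarrow>
     jint a b (\<lambda>x. (u x)\<^sup>2) \<le> G * h powr (e + 2 * q + 1)"
proof (rule exI, intro conjI[rotated] allI impI)
  define P where "P = e + (2 * q + 2 * \<epsilon>)"
  have P: "P < -1" using p by (simp add: P_def)
  define G where "G = c * C\<^sup>2 * 16 powr \<epsilon> * (2 * (1 / 2) powr (P + 1) / - (P + 1))"
  show "G \<ge> 0" using c P unfolding G_def by (intro mult_nonneg_nonneg divide_nonneg_nonneg) auto
  fix h and u :: "real \<Rightarrow> real"
  assume h: "0 < h" and m: "u \<in> borel_measurable borel"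
    and u0: "\<forall>x\<in>{-1<..<1}. x \<noteq> z \<longrightarrow> \<bar>x - z\<bar> < h / 2 \<longrightarrow> u x = 0"
    and u: "\<forall>x\<in>{-1<..<1}. x \<noteq> z \<longrightarrow> \<bar>u x\<bar> \<le> C * (log_factor \<epsilon> h \<bar>x - z\<bar> * \<bar>x - z\<bar> powr q)"
  have "jacobi_L2 a b u \<and> jint a b (\<lambda>x. (u x)\<^sup>2)
      \<le> c * (C\<^sup>2 * (16 powr \<epsilon> * h powr (- 2 * \<epsilon>))) * (2 * ((h / 2) powr (P + 1) / - (P + 1)))"
  proof (rule singular_estimate[where S = "{h / 2..}" and z = z and e = e and q = "2 * q + 2 * \<epsilon>"])
    fix x assume x: "x \<in> {-1<..<1}" "x \<noteq> z"
    show "(u x)\<^sup>2 \<le> C\<^sup>2 * (16 powr \<epsilon> * h powr (- 2 * \<epsilon>))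
        * (indicator {h / 2..} \<bar>x - z\<bar> * \<bar>x - z\<bar> powr (2 * q + 2 * \<epsilon>))"
    proof (cases "h / 2 \<le> \<bar>x - z\<bar>")
      case True
      have "(u x)\<^sup>2 \<le> (C * (log_factor \<epsilon> h \<bar>x - z\<bar> * \<bar>x - z\<bar> powr q))\<^sup>2"
        using u x C unfolding abs_le_square_iff[symmetric] by (auto simp: log_factor_def)
      also have "\<dots> = C\<^sup>2 * ((log_factor \<epsilon> h \<bar>x - z\<bar>)\<^sup>2 * (\<bar>x - z\<bar> powr q * \<bar>x - z\<bar> powr q))"
        by (simp add: power_mult_distrib power2_eq_square)
      also have "\<dots> \<le> C\<^sup>2 * ((16 powr \<epsilon> * h powr (- 2 * \<epsilon>) * \<bar>x - z\<bar> powr (2 * \<epsilon>))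
          * (\<bar>x - z\<bar> powr q * \<bar>x - z\<bar> powr q))"
        by (intro mult_left_mono mult_right_mono log_factor_far h True \<epsilon>) auto
      also have "\<dots> = C\<^sup>2 * (16 powr \<epsilon> * h powr (- 2 * \<epsilon>)) * \<bar>x - z\<bar> powr (2 * q + 2 * \<epsilon>)"
      proof -
        have "\<bar>x - z\<bar> powr (2 * \<epsilon>) * (\<bar>x - z\<bar> powr q * \<bar>x - z\<bar> powr q) = \<bar>x - z\<bar> powr (2 * q + 2 * \<epsilon>)"
          unfolding powr_add[symmetric] by (simp add: algebra_simps)
        then show ?thesis by (simp add: mult.assoc)
      qed
      finally show ?thesis using True by simp
    qed (use u0 x in simp)
    show "jacobi_weight a b x \<le> c * \<bar>x - z\<bar> powr e" by (rule w[OF x])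
  next
    show "0 \<le> 2 * ((h / 2) powr (P + 1) / - (P + 1))"
      using P by (intro mult_nonneg_nonneg divide_nonneg_nonneg) auto
    show "(\<integral>\<^sup>+x. ennreal (indicator {h / 2..} \<bar>x - z\<bar> * \<bar>x - z\<bar> powr (e + (2 * q + 2 * \<epsilon>))) \<partial>lborel)
        \<le> ennreal (2 * ((h / 2) powr (P + 1) / - (P + 1)))"
      using P h unfolding P_def[symmetric] by (intro nn_integral_powr_far) auto
  qed (use c m in auto)
  also have "(h / 2) powr (P + 1) = (1 / 2) powr (P + 1) * h powr (P + 1)"
    using h by (simp add: powr_mult[symmetric])
  also have "c * (C\<^sup>2 * (16 powr \<epsilon> * h powr (- 2 * \<epsilon>))) * (2 * ((1 / 2) powr (P + 1) * h powr (P + 1) / - (P + 1)))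
      = G * (h powr (- 2 * \<epsilon>) * h powr (P + 1))"
    unfolding G_def by (simp only: times_divide_eq_left times_divide_eq_right mult_ac)
  also have "h powr (- 2 * \<epsilon>) * h powr (P + 1) = h powr (e + 2 * q + 1)"
    unfolding powr_add[symmetric] P_def by (simp add: algebra_simps)
  finally show "jint a b (\<lambda>x. (u x)\<^sup>2) \<le> G * h powr (e + 2 * q + 1)" by blast
qed

text \<open>Continuity is demanded on the whole line in order to have Borel functions,
  differentiability only within the closed interval, where it is one-sided at the ends.\<close>

definition smooth_seq :: "(nat \<Rightarrow> real \<Rightarrow> real) \<Rightarrow> bool" where
  "smooth_seq gs \<longleftrightarrow> (\<forall>k. continuous_on UNIV (gs k)) \<and>
     (\<forall>k. \<forall>x\<in>{-1..1}. (gs k has_real_derivative gs (Suc k) x) (at x within {-1..1}))"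

lemma smooth_seq_continuous: "smooth_seq gs \<Longrightarrow> continuous_on S (gs k)"
  unfolding smooth_seq_def using continuous_on_subset by blast

lemma smooth_seq_measurable: "smooth_seq gs \<Longrightarrow> gs k \<in> borel_measurable borel"
  by (intro borel_measurable_continuous_onI smooth_seq_continuous)

lemma smooth_seq_deriv:
  "smooth_seq gs \<Longrightarrow> x \<in> {-1..1} \<Longrightarrow> (gs k has_real_derivative gs (Suc k) x) (at x within {-1..1})"
  by (simp add: smooth_seq_def)

lemma smooth_seq_bounded:
  assumes "smooth_seq gs"
  shows "\<exists>M\<ge>0. \<forall>k\<le>K. \<forall>x\<in>{-1..1}. \<bar>gs k x\<bar> \<le> M"
proof -
  have "\<exists>C\<ge>0. \<forall>x. x \<in> {-1..1} \<longrightarrow> \<bar>gs k x\<bar> \<le> C * 1" for k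
  proof -
    have "bounded (gs k ` {-1..1})"
      by (intro compact_imp_bounded compact_continuous_image smooth_seq_continuous assms) auto
    then obtain B where B: "\<forall>x\<in>{-1..1}. \<bar>gs k x\<bar> \<le> B" unfolding bounded_iff by auto
    then show ?thesis by (intro exI[of _ "max 0 B"]) (auto simp: le_max_iff_disj)
  qed
  then show ?thesis
    using finite_uniform_bound[of K "\<lambda>_ x. x \<in> {-1..1}" "\<lambda>k x. \<bar>gs k x\<bar>" "\<lambda>_ _. 1"] by auto
qed

text \<open>For \<open>p = monom 1 i\<close> these are the derivatives of the function F_i of the
  overview, with \<open>gs\<close> the derivatives of g; \<open>faway\<close> below holds those of
  its far part.\<close>

definition fsing :: "(nat \<Rightarrow> real \<Rightarrow> real) \<Rightarrow> real \<Rightarrow> real \<Rightarrow> real poly \<Rightarrow> real \<Rightarrow> nat \<Rightarrow> real \<Rightarrow> real" where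
  "fsing gs z \<gamma> p h k = leib k (sing z \<gamma> h p) gs"

definition faway :: "(nat \<Rightarrow> real \<Rightarrow> real) \<Rightarrow> real \<Rightarrow> real \<Rightarrow> real poly \<Rightarrow> nat \<Rightarrow> real \<Rightarrow> nat \<Rightarrow> real \<Rightarrow> real" where
  "faway gs z \<gamma> p K h k = leib k (fsing gs z \<gamma> p h) (cutoff K z h)"

context
  fixes gs :: "nat \<Rightarrow> real \<Rightarrow> real" and z \<gamma> :: real and p :: "real poly"
  assumes gs: "smooth_seq gs" and z: "z \<in> {-1..1}"
begin

lemma fsing_measurable: "fsing gs z \<gamma> p h k \<in> borel_measurable borel"
  unfolding fsing_def by (rule leib_measurable[OF sing_measurable smooth_seq_measurable[OF gs]])

lemma faway_measurable: "faway gs z \<gamma> p K h k \<in> borel_measurable borel"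
  unfolding faway_def by (rule leib_measurable[OF fsing_measurable cutoff_measurable])

lemma fsing_at: "fsing gs z \<gamma> p h k z = 0"
  unfolding fsing_def by (intro leib_zero_left) simp

lemma fsing_deriv:
  assumes "h > 0" "x \<in> {-1..1}" "x \<noteq> z"
  shows "(fsing gs z \<gamma> p h k has_real_derivative fsing gs z \<gamma> p h (Suc k) x) (at x within {-1..1})"
  unfolding fsing_def using assms by (intro leib_deriv sing_deriv smooth_seq_deriv gs) auto

lemma faway_eq_0: "h > 0 \<Longrightarrow> \<bar>x - z\<bar> \<le> h / 2 \<Longrightarrow> faway gs z \<gamma> p K h k x = 0"
  unfolding faway_def by (intro leib_zero_right cutoff_eq_0)

lemma faway_eq: "h > 0 \<Longrightarrow> \<bar>x - z\<bar> \<ge> h \<Longrightarrow> k \<le> K \<Longrightarrow> faway gs z \<gamma> p K h k x = fsing gs z \<gamma> p h k x"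
  unfolding faway_def by (intro leib_one_right) (simp_all add: cutoff_far)

lemma faway_deriv:
  assumes "h > 0" "x \<in> {-1..1}" "k < K"
  shows "(faway gs z \<gamma> p K h k has_real_derivative faway gs z \<gamma> p K h (Suc k) x) (at x within {-1..1})"
proof (cases "x = z")
  case True
  \<comment> \<open>The far part vanishes identically near \<open>z\<close>, so it is differentiable
    there although its singular factor need not be.\<close>
  have "((\<lambda>_. 0) has_real_derivative 0) (at x)" by simp
  then have "(faway gs z \<gamma> p K h k has_real_derivative 0) (at x)"
    by (rule has_field_derivative_transform_within_open[of _ _ _ "ball z (h / 2)"])
       (use assms True in \<open>auto simp: faway_eq_0 dist_real_def abs_minus_commute\<close>)
  then show ?thesis using faway_eq_0[of h x K "Suc k"] assms True
    by (auto intro: has_field_derivative_at_within)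
next
  case False
  then show ?thesis
    unfolding faway_def using assms by (intro leib_deriv fsing_deriv cutoff_deriv) auto
qed

lemma fsing_bound:
  assumes \<epsilon>: "\<epsilon> > 0"
  shows "\<exists>C\<ge>0. \<forall>k\<le>K. \<forall>h>0. \<forall>x\<in>{-1..1}. x \<noteq> z \<longrightarrow>
    \<bar>fsing gs z \<gamma> p h k x\<bar> \<le> C * (log_factor \<epsilon> h \<bar>x - z\<bar> * \<bar>x - z\<bar> powr (\<gamma> - real k))"
proof -
  obtain M where M: "M \<ge> 0" "\<forall>k\<le>K. \<forall>x\<in>{-1..1}. \<bar>gs k x\<bar> \<le> M" using smooth_seq_bounded[OF gs] by blast
  obtain C where C: "C \<ge> 0" "\<forall>k\<le>K. \<forall>hx. fst hx > 0 \<longrightarrow> \<bar>sing z \<gamma> (fst hx) p k (snd hx)\<bar>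
    \<le> C * (log_factor \<epsilon> (fst hx) \<bar>snd hx - z\<bar> * \<bar>snd hx - z\<bar> powr (\<gamma> - real k))"
    using sing_bound[OF \<epsilon>] by blast
  have "\<bar>fsing gs z \<gamma> p h k x\<bar> \<le> (2 ^ K * C * (M * 2 ^ K)) * (log_factor \<epsilon> h \<bar>x - z\<bar> * \<bar>x - z\<bar> powr (\<gamma> - real k))"
    if "k \<le> K" "h > 0" "x \<in> {-1..1}" "x \<noteq> z" for k h x
  proof -
    define r where "r = \<bar>x - z\<bar>"
    have r: "r > 0" "r \<le> 2" using that z by (auto simp: r_def)
    have L: "log_factor \<epsilon> h r \<ge> 0" by (simp add: log_factor_def)
    have "\<bar>fsing gs z \<gamma> p h k x\<bar> \<le> 2 ^ k * (C * log_factor \<epsilon> h r) * (M * 2 ^ K) * r powr (\<gamma> + 0 - real k)"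
      unfolding fsing_def
    proof (rule leib_bound)
      show "\<bar>sing z \<gamma> h p i x\<bar> \<le> C * log_factor \<epsilon> h r * r powr (\<gamma> - real i)" if "i \<le> k" for i
        using C(2)[rule_format, of i "(h, x)"] that \<open>k \<le> K\<close> \<open>h > 0\<close> by (simp add: r_def mult_ac)
      \<comment> \<open>The bounded factor is put into homogeneous form: the distance r is at most
        2, so 1 is at most 2^K times (1 / r)^i.\<close>
      show "\<bar>gs i x\<bar> \<le> M * 2 ^ K * r powr (0 - real i)" if "i \<le> k" for i
      proof -
        have p: "r powr (0 - real i) = (1 / r) ^ i"
          using r by (simp add: powr_minus powr_realpow power_one_over inverse_eq_divide)
        have "1 = 2 ^ i * (1 / 2 :: real) ^ i" by (simp add: power_one_over)
        also have "\<dots> \<le> 2 ^ K * (1 / r) ^ i"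
          using that \<open>k \<le> K\<close> r by (intro mult_mono power_increasing power_mono divide_left_mono) auto
        finally have "M * 1 \<le> M * (2 ^ K * (1 / r) ^ i)" using M by (intro mult_left_mono)
        moreover have "\<bar>gs i x\<bar> \<le> M" using M that \<open>k \<le> K\<close> \<open>x \<in> {-1..1}\<close> by auto
        ultimately show ?thesis unfolding p by (simp add: mult_ac)
      qed
    qed (use r C M L in auto)
    also have "\<dots> = 2 ^ k * (C * (M * 2 ^ K) * (log_factor \<epsilon> h r * r powr (\<gamma> - real k)))"
      by (simp add: mult_ac)
    also have "\<dots> \<le> 2 ^ K * (C * (M * 2 ^ K) * (log_factor \<epsilon> h r * r powr (\<gamma> - real k)))"
      using that C M L by (intro mult_right_mono power_increasing mult_nonneg_nonneg) auto
    finally show ?thesis by (simp add: r_def mult_ac)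
  qed
  moreover have "2 ^ K * C * (M * 2 ^ K) \<ge> 0" using C M by simp
  ultimately show ?thesis by blast
qed

lemma faway_bound:
  assumes \<epsilon>: "\<epsilon> > 0"
  shows "\<exists>C\<ge>0. \<forall>k\<le>K. \<forall>h>0. \<forall>x\<in>{-1..1}. x \<noteq> z \<longrightarrow>
    \<bar>faway gs z \<gamma> p K h k x\<bar> \<le> C * (log_factor \<epsilon> h \<bar>x - z\<bar> * \<bar>x - z\<bar> powr (\<gamma> - real k))"
proof -
  obtain M where M: "M \<ge> 0" "\<forall>k\<le>K. \<forall>h>0. \<forall>x. x \<noteq> z \<longrightarrow> \<bar>cutoff K z h k x\<bar> \<le> M * \<bar>x - z\<bar> powr (0 - real k)"
    using cutoff_bound[of K z] by blast
  obtain C where C: "C \<ge> 0" "\<forall>k\<le>K. \<forall>h>0. \<forall>x\<in>{-1..1}. x \<noteq> z \<longrightarrow>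
    \<bar>fsing gs z \<gamma> p h k x\<bar> \<le> C * (log_factor \<epsilon> h \<bar>x - z\<bar> * \<bar>x - z\<bar> powr (\<gamma> - real k))"
    using fsing_bound[OF \<epsilon>] by blast
  have "\<bar>faway gs z \<gamma> p K h k x\<bar> \<le> (2 ^ K * C * M) * (log_factor \<epsilon> h \<bar>x - z\<bar> * \<bar>x - z\<bar> powr (\<gamma> - real k))"
    if "k \<le> K" "h > 0" "x \<in> {-1..1}" "x \<noteq> z" for k h x
  proof -
    define r where "r = \<bar>x - z\<bar>"
    have r: "r > 0" using that by (auto simp: r_def)
    have L: "log_factor \<epsilon> h r \<ge> 0" by (simp add: log_factor_def)
    have "\<bar>faway gs z \<gamma> p K h k x\<bar> \<le> 2 ^ k * (C * log_factor \<epsilon> h r) * M * r powr (\<gamma> + 0 - real k)"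
      unfolding faway_def using that r C M L
      by (intro leib_bound) (auto simp: r_def mult.assoc)
    also have "\<dots> = 2 ^ k * (C * M * (log_factor \<epsilon> h r * r powr (\<gamma> - real k)))"
      by (simp add: mult_ac)
    also have "\<dots> \<le> 2 ^ K * (C * M * (log_factor \<epsilon> h r * r powr (\<gamma> - real k)))"
      using that C M L by (intro mult_right_mono power_increasing mult_nonneg_nonneg) auto
    finally show ?thesis by (simp add: r_def mult_ac)
  qed
  moreover have "2 ^ K * C * M \<ge> 0" using C M by simp
  ultimately show ?thesis by blast
qed

end

lemma jint_square_add3_le:
  assumes "jacobi_L2 a b u" "jacobi_L2 a b v" "jacobi_L2 a b w"
  shows "jint a b (\<lambda>x. (u x + v x + w x)\<^sup>2)
    \<le> 3 * (jint a b (\<lambda>x. (u x)\<^sup>2) + jint a b (\<lambda>x. (v x)\<^sup>2) + jint a b (\<lambda>x. (w x)\<^sup>2))"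
proof -
  have "jint a b (\<lambda>x. (u x + v x + w x)\<^sup>2) \<le> jint a b (\<lambda>x. 3 * ((u x)\<^sup>2 + (v x)\<^sup>2 + (w x)\<^sup>2))"
  proof (rule integral_mono)
    show "integrable (jacobi_measure a b) (\<lambda>x. (u x + v x + w x)\<^sup>2)"
      by (intro jacobi_L2_square jacobi_L2_add assms)
    show "integrable (jacobi_measure a b) (\<lambda>x. 3 * ((u x)\<^sup>2 + (v x)\<^sup>2 + (w x)\<^sup>2))"
      by (intro integrable_mult_right Bochner_Integration.integrable_add jacobi_L2_square assms)
    have "(s + t + r)\<^sup>2 \<le> 3 * (s\<^sup>2 + t\<^sup>2 + r\<^sup>2)" for s t r :: real
    proof -
      have "0 \<le> (s - t)\<^sup>2 + (t - r)\<^sup>2 + (s - r)\<^sup>2" by simp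
      then show ?thesis by (simp add: power2_eq_square algebra_simps)
    qed
    then show "(u x + v x + w x)\<^sup>2 \<le> 3 * ((u x)\<^sup>2 + (v x)\<^sup>2 + (w x)\<^sup>2)" for x .
  qed
  also have "\<dots> = 3 * (jint a b (\<lambda>x. (u x)\<^sup>2) + jint a b (\<lambda>x. (v x)\<^sup>2) + jint a b (\<lambda>x. (w x)\<^sup>2))"
    using assms by (simp add: jacobi_L2_square)
  finally show ?thesis .
qed

subsection \<open>Approximation of singular functions\<close>

text \<open>The squared error of the \<open>j\<close>-th derivative, for a function \<open>U 0\<close> with derivatives \<open>U j\<close>.\<close>

abbreviation proj_err :: "nat \<Rightarrow> real \<Rightarrow> real \<Rightarrow> nat \<Rightarrow> (nat \<Rightarrow> real \<Rightarrow> real) \<Rightarrow> real" where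
  "proj_err j a b N U \<equiv> jint (a + real j) (b + real j)
     (\<lambda>x. (U j x - jacobi_trunc j a b (Suc N) (U 0) x)\<^sup>2)"

lemma powr_even_power: "n > 0 \<Longrightarrow> (real n)\<^sup>2 ^ k = real n powr (2 * real k)"
  using powr_realpow[of "real n" "2 * k"] by (simp add: power_mult)

lemma smooth_block:
  assumes ab: "a > -1" "b > -1" and gs: "smooth_seq gs"
  shows "\<exists>C\<ge>0. \<forall>\<^sub>F N in sequentially. proj_err j a b N gs \<le> C * real N powr s"
proof -
  \<comment> \<open>Any rate \<open>s\<close> is reached by taking enough derivatives beyond the
    j-th.\<close>
  obtain n :: nat where n: "real n > \<bar>s\<bar>" using reals_Archimedean2 by blast
  define K where "K = n + j"
  define J where "J = jint (a + real K) (b + real K) (\<lambda>x. (gs K x)\<^sup>2)"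
  have J: "J \<ge> 0" by (simp add: J_def)
  have "proj_err j a b N gs
     \<le> 4 ^ n * J * real N powr s" if N: "2 * K < N" for N
  proof -
    have N0: "N > 0" using N by simp
    have "proj_err j a b N gs
      \<le> (4 / (real N)\<^sup>2) ^ (K - j) * J"
      unfolding J_def using N
      by (intro jacobi_spectral_rate ab smooth_seq_measurable smooth_seq_deriv smooth_seq_continuous gs)
         (auto simp: K_def)
    also have "\<dots> = 4 ^ n * J * real N powr (- 2 * real n)"
      unfolding K_def add_diff_cancel_right' power_divide powr_even_power[OF N0]
      by (simp add: powr_minus divide_inverse)
    also have "\<dots> \<le> 4 ^ n * J * real N powr s"
      using N0 n J by (intro mult_left_mono powr_mono) auto
    finally show ?thesis .
  qed
  then have "\<forall>\<^sub>F N in sequentially. proj_err j a b N gs \<le> 4 ^ n * J * real N powr s"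
    by (rule eventually_mono[OF eventually_gt_at_top])
  moreover have "4 ^ n * J \<ge> 0" using J by simp
  ultimately show ?thesis by blast
qed

text \<open>Near the singularity \<open>z\<close> the weight with parameters \<open>(a + j, b + j)\<close> behaves like
  \<open>\<bar>x - z\<bar>\<close> to the power \<open>a' + \<kappa> j\<close>; the natural length scale at degree \<open>N\<close> is \<open>N\<close> to the power
  \<open>- \<rho>\<close>. One has \<open>\<kappa> = 1\<close>, \<open>\<rho> = 2\<close> at an end point and \<open>\<kappa> = 0\<close>, \<open>\<rho> = 1\<close> at an interior point.\<close>

locale jacobi_singular =
  fixes a b z \<gamma> a' \<kappa> \<rho> :: real and m :: nat
  assumes ab: "a > -1" "b > -1" and z: "z \<in> {-1..1}"
    and \<rho>: "\<rho> > 0" "\<rho> * (2 - \<kappa>) = 2"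
    and weight_near: "\<exists>h0>0. \<exists>c\<ge>0. \<forall>j\<le>m. \<forall>x\<in>{-1<..<1}. x \<noteq> z \<longrightarrow> \<bar>x - z\<bar> \<le> h0 \<longrightarrow>
      jacobi_weight (a + real j) (b + real j) x \<le> c * \<bar>x - z\<bar> powr (a' + \<kappa> * real j)"
    and weight_far: "\<And>K. K > 0 \<Longrightarrow> \<exists>c\<ge>0. \<forall>x\<in>{-1<..<1}. x \<noteq> z \<longrightarrow>
      jacobi_weight (a + real K) (b + real K) x \<le> c * \<bar>x - z\<bar> powr (a' + \<kappa> * real K)"
    and exponent: "a' + 2 * \<gamma> - (2 - \<kappa>) * real m > -1"
begin

text \<open>The squared norm of the near part is of order h^\<theta>, that is N^(-\<rho> \<theta>);
  half of this exponent is the rate for m = 0.\<close>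

definition \<theta> :: real where "\<theta> = a' + 2 * \<gamma> + 1"

definition scale :: "nat \<Rightarrow> real" where "scale N = real N powr (- \<rho>)"

lemma \<kappa>: "2 - \<kappa> > 0"
  using \<rho> by (metis zero_less_mult_pos zero_less_numeral)

text \<open>At this scale each of the \<open>i\<close> derivatives costs exactly N^2, the same
  factor as in the inverse and Poincare inequalities. The relation between \<open>\<rho>\<close> and
  \<open>\<kappa>\<close> expresses just this.\<close>

lemma scale_powr: "scale N powr (a' + \<kappa> * real i + 2 * (\<gamma> - real i) + 1) = real N powr (2 * real i - \<rho> * \<theta>)"
proof -
  have "- \<rho> * (a' + \<kappa> * real i + 2 * (\<gamma> - real i) + 1) = (\<rho> * (2 - \<kappa>)) * real i - \<rho> * \<theta>"
    by (simp add: \<theta>_def algebra_simps)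
  then show ?thesis unfolding scale_def powr_powr \<rho> by simp
qed

lemma scale_pos: "N > 0 \<Longrightarrow> scale N > 0"
  by (simp add: scale_def)

lemma scale_tendsto: "scale \<longlonglongrightarrow> 0"
  unfolding scale_def[abs_def] using \<rho>
  by (intro tendsto_neg_powr filterlim_real_sequentially) auto

text \<open>The logarithm is taken relative to the moving scale, so \<open>p\<close> influences the
  constant but not the rate. Square integrability comes from the same splitting, the near part being
  square integrable and the far part continuous.\<close>

lemma singular_block:
  assumes gs: "smooth_seq gs" and j: "j \<le> m"
  shows "\<exists>C\<ge>0. \<forall>\<^sub>F N in sequentially.
    jacobi_L2 (a + real j) (b + real j) (fsing gs z \<gamma> p (scale N) j) \<and>
    proj_err j a b N (fsing gs z \<gamma> p (scale N))
      \<le> C * real N powr (2 * real j - \<rho> * \<theta>)"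
proof -
  \<comment> \<open>A quarter of the room left by the locale assumption on the exponents: after
    subtracting 2 \<epsilon> the near integrals still converge.\<close>
  define \<epsilon> where "\<epsilon> = (a' + 2 * \<gamma> - (2 - \<kappa>) * real m + 1) / 4"
  have \<epsilon>: "\<epsilon> > 0" "a' + 2 * \<gamma> - (2 - \<kappa>) * real m - 2 * \<epsilon> > -1"
    using exponent unfolding \<epsilon>_def by (simp_all add: field_simps)
  obtain n :: nat where n: "real n > (a' + 2 * \<gamma> + 2 * \<epsilon> + 1) / (2 - \<kappa>)"
    using reals_Archimedean2 by blast
  \<comment> \<open>So many derivatives that the power of the distance is integrable at infinity,
    \<open>\<epsilon>\<close> included.\<close>
  define K where "K = Suc (n + m)"
  have K: "K > 0" "j \<le> K" using j by (auto simp: K_def)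
  have KE: "a' + \<kappa> * real K + 2 * (\<gamma> - real K) + 2 * \<epsilon> < -1"
  proof -
    have "a' + 2 * \<gamma> + 2 * \<epsilon> + 1 < (2 - \<kappa>) * real n" using n \<kappa> by (simp add: field_simps)
    also have "\<dots> \<le> (2 - \<kappa>) * real K" using \<kappa> by (intro mult_left_mono) (auto simp: K_def)
    finally show ?thesis by (simp add: algebra_simps)
  qed
  obtain h0 c where h0: "h0 > 0" "c \<ge> 0" and c: "\<forall>j\<le>m. \<forall>x\<in>{-1<..<1}. x \<noteq> z \<longrightarrow>
      \<bar>x - z\<bar> \<le> h0 \<longrightarrow> jacobi_weight (a + real j) (b + real j) x \<le> c * \<bar>x - z\<bar> powr (a' + \<kappa> * real j)"
    using weight_near by blast
  obtain c' where c': "c' \<ge> 0" "\<forall>x\<in>{-1<..<1}. x \<noteq> z \<longrightarrow>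
      jacobi_weight (a + real K) (b + real K) x \<le> c' * \<bar>x - z\<bar> powr (a' + \<kappa> * real K)"
    using weight_far[OF K(1)] by blast
  obtain C1 where C1: "C1 \<ge> 0" "\<forall>k\<le>Suc K. \<forall>h>0. \<forall>x\<in>{-1..1}. x \<noteq> z \<longrightarrow>
    \<bar>fsing gs z \<gamma> p h k x\<bar> \<le> C1 * (log_factor \<epsilon> h \<bar>x - z\<bar> * \<bar>x - z\<bar> powr (\<gamma> - real k))"
    using fsing_bound[OF gs z \<epsilon>(1), of "Suc K" \<gamma> p] by blast
  \<comment> \<open>With a cutoff of order \<open>Suc K\<close> even the K-th derivative of the far
    part is differentiable, hence continuous.\<close>
  obtain C2 where C2: "C2 \<ge> 0" "\<forall>k\<le>Suc K. \<forall>h>0. \<forall>x\<in>{-1..1}. x \<noteq> z \<longrightarrow>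
    \<bar>faway gs z \<gamma> p (Suc K) h k x\<bar> \<le> C2 * (log_factor \<epsilon> h \<bar>x - z\<bar> * \<bar>x - z\<bar> powr (\<gamma> - real k))"
    using faway_bound[OF gs z \<epsilon>(1), of "Suc K" \<gamma> p] by blast
  \<comment> \<open>The near part is the difference of the two derivative sequences. No
    complementary cutoff is introduced, and the two bounds simply add.\<close>
  define near where "near = (\<lambda>h k x. fsing gs z \<gamma> p h k x - faway gs z \<gamma> p (Suc K) h k x)"
  have near_meas: "near h k \<in> borel_measurable borel" for h k
    unfolding near_def using fsing_measurable[OF gs z] faway_measurable[OF gs z] by measurable
  have "\<exists>G\<ge>0. \<forall>h. 0 < h \<longrightarrow> h \<le> h0 \<longrightarrow> jacobi_L2 (a + real i) (b + real i) (near h i) \<and>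
     jint (a + real i) (b + real i) (\<lambda>x. (near h i x)\<^sup>2) \<le> G * h powr (a' + \<kappa> * real i + 2 * (\<gamma> - real i) + 1)"
    if i: "i \<le> m" for i
  proof -
    have "(2 - \<kappa>) * real i \<le> (2 - \<kappa>) * real m" using i \<kappa> by (intro mult_left_mono) auto
    then have "a' + \<kappa> * real i + 2 * (\<gamma> - real i) - 2 * \<epsilon> > -1" using \<epsilon>(2) by (simp add: algebra_simps)
    from near_estimate[OF h0(2) add_nonneg_nonneg[OF C1(1) C2(1)] \<epsilon>(1) this c[rule_format, OF i]]
    obtain G where G: "G \<ge> 0" and *: "\<forall>h u. 0 < h \<longrightarrow> h \<le> h0 \<longrightarrow> u \<in> borel_measurable borel \<longrightarrow>
     (\<forall>x\<in>{-1<..<1}. x \<noteq> z \<longrightarrow> \<bar>x - z\<bar> > h \<longrightarrow> u x = 0) \<longrightarrow>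
     (\<forall>x\<in>{-1<..<1}. x \<noteq> z \<longrightarrow> \<bar>u x\<bar> \<le> (C1 + C2) * (log_factor \<epsilon> h \<bar>x - z\<bar> * \<bar>x - z\<bar> powr (\<gamma> - real i))) \<longrightarrow>
     jacobi_L2 (a + real i) (b + real i) u \<and> jint (a + real i) (b + real i) (\<lambda>x. (u x)\<^sup>2)
        \<le> G * h powr (a' + \<kappa> * real i + 2 * (\<gamma> - real i) + 1)" by blast
    have "jacobi_L2 (a + real i) (b + real i) (near h i) \<and>
      jint (a + real i) (b + real i) (\<lambda>x. (near h i x)\<^sup>2) \<le> G * h powr (a' + \<kappa> * real i + 2 * (\<gamma> - real i) + 1)"
      if h: "0 < h" "h \<le> h0" for h
    proof (rule *[rule_format, OF h near_meas])
      fix x :: real assume x: "x \<in> {-1<..<1}" "x \<noteq> z"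
      have iK: "i \<le> Suc K" using i by (simp add: K_def)
      show "near h i x = 0" if "h < \<bar>x - z\<bar>"
        unfolding near_def using faway_eq[OF gs z h(1) _ iK, of x \<gamma> p] that by simp
      show "\<bar>near h i x\<bar> \<le> (C1 + C2) * (log_factor \<epsilon> h \<bar>x - z\<bar> * \<bar>x - z\<bar> powr (\<gamma> - real i))"
      proof -
        have "x \<in> {-1..1}" using x by simp
        from C1(2)[rule_format, OF iK h(1) this x(2)] C2(2)[rule_format, OF iK h(1) this x(2)]
        show ?thesis unfolding near_def distrib_right by linarith
      qed
    qed
    then show ?thesis by (intro exI[of _ G] conjI[OF G] allI impI)
  qed
  note near = this
  obtain G0 where G0: "G0 \<ge> 0" "\<forall>h. 0 < h \<longrightarrow> h \<le> h0 \<longrightarrow> jacobi_L2 a b (near h 0) \<and>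
     jint a b (\<lambda>x. (near h 0 x)\<^sup>2) \<le> G0 * h powr (a' + \<kappa> * 0 + 2 * (\<gamma> - 0) + 1)"
    using near[of 0] unfolding of_nat_0 add_0_right by blast
  obtain G1 where G1: "G1 \<ge> 0" "\<forall>h. 0 < h \<longrightarrow> h \<le> h0 \<longrightarrow> jacobi_L2 (a + real j) (b + real j) (near h j) \<and>
     jint (a + real j) (b + real j) (\<lambda>x. (near h j x)\<^sup>2) \<le> G1 * h powr (a' + \<kappa> * real j + 2 * (\<gamma> - real j) + 1)"
    using near[OF j] by blast
  obtain G2 where G2: "G2 \<ge> 0" and *: "\<forall>h u. 0 < h \<longrightarrow> u \<in> borel_measurable borel \<longrightarrow>
     (\<forall>x\<in>{-1<..<1}. x \<noteq> z \<longrightarrow> \<bar>x - z\<bar> < h / 2 \<longrightarrow> u x = 0) \<longrightarrow>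
     (\<forall>x\<in>{-1<..<1}. x \<noteq> z \<longrightarrow> \<bar>u x\<bar> \<le> C2 * (log_factor \<epsilon> h \<bar>x - z\<bar> * \<bar>x - z\<bar> powr (\<gamma> - real K))) \<longrightarrow>
     jint (a + real K) (b + real K) (\<lambda>x. (u x)\<^sup>2) \<le> G2 * h powr (a' + \<kappa> * real K + 2 * (\<gamma> - real K) + 1)"
    using far_estimate[OF c'(1) C2(1) \<epsilon>(1) KE c'(2)[rule_format]] by blast
  have far: "jint (a + real K) (b + real K) (\<lambda>x. (faway gs z \<gamma> p (Suc K) h K x)\<^sup>2)
      \<le> G2 * h powr (a' + \<kappa> * real K + 2 * (\<gamma> - real K) + 1)" if h: "h > 0" for h
  proof (rule *[rule_format, OF h faway_measurable[OF gs z]])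
    fix x :: real assume x: "x \<in> {-1<..<1}" "x \<noteq> z"
    show "faway gs z \<gamma> p (Suc K) h K x = 0" if "\<bar>x - z\<bar> < h / 2"
      using that by (intro faway_eq_0 gs z h) simp
    show "\<bar>faway gs z \<gamma> p (Suc K) h K x\<bar> \<le> C2 * (log_factor \<epsilon> h \<bar>x - z\<bar> * \<bar>x - z\<bar> powr (\<gamma> - real K))"
      using x h by (intro C2(2)[rule_format]) auto
  qed
  \<comment> \<open>\<open>X\<close> comes from the stability bound, and the 3 in \<open>C\<close>
    from squaring a sum of three terms.\<close>
  define X where "X = 2 * (\<bar>a + b\<bar> + 2 * real j + 3)"
  define C where "C = 3 * (G1 + X ^ j * G0 + 4 ^ (K - j) * G2)"
  have C: "C \<ge> 0" using G0(1) G1(1) G2 by (simp add: C_def X_def)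
  have "\<forall>\<^sub>F N in sequentially. scale N < h0"
    using scale_tendsto h0 by (simp add: order_tendsto_iff)
  with eventually_gt_at_top[of "2 * K"] have "\<forall>\<^sub>F N in sequentially.
    jacobi_L2 (a + real j) (b + real j) (fsing gs z \<gamma> p (scale N) j) \<and>
    jint (a + real j) (b + real j)
      (\<lambda>x. (fsing gs z \<gamma> p (scale N) j x - jacobi_trunc j a b (Suc N) (fsing gs z \<gamma> p (scale N) 0) x)\<^sup>2)
      \<le> C * real N powr (2 * real j - \<rho> * \<theta>)"
  proof eventually_elim
    case (elim N)
    then have N: "N > 0" by simp
    define h where "h = scale N"
    have h: "h > 0" "h \<le> h0" using elim scale_pos[OF N] by (auto simp: h_def)
    define F where "F = fsing gs z \<gamma> p h"
    define A where "A = faway gs z \<gamma> p (Suc K) h"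
    let ?a = "a + real j" and ?b = "b + real j"
    let ?R = "real N powr (2 * real j - \<rho> * \<theta>)"
    have ab': "?a > -1" "?b > -1" using ab by auto
    have nF: "near h k = (\<lambda>x. F k x - A k x)" for k by (simp add: near_def F_def A_def)
    have dA: "(A k has_real_derivative A (Suc k) x) (at x within {-1..1})" if "k \<le> K" "x \<in> {-1..1}" for k x
      unfolding A_def using that h by (intro faway_deriv gs z) auto
    have mA: "A k \<in> borel_measurable borel" for k unfolding A_def by (intro faway_measurable gs z)
    have cA: "continuous_on {-1..1} (A k)" if "k \<le> K" for k
      using dA[OF that] by (rule DERIV_continuous_on)
    have L0: "jacobi_L2 a b (A 0)" by (intro jacobi_L2_continuous ab mA cA) simp
    have Lj: "jacobi_L2 ?a ?b (A j)" by (intro jacobi_L2_continuous ab' mA cA K)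
    have n0: "jacobi_L2 a b (near h 0)" "jacobi_L2 ?a ?b (near h j)" using G0(2)[rule_format, OF h] G1(2)[rule_format, OF h] by auto
    have LF0: "jacobi_L2 a b (F 0)" using jacobi_L2_add[OF n0(1) L0] by (simp add: nF)
    have LFj: "jacobi_L2 ?a ?b (F j)" using jacobi_L2_add[OF n0(2) Lj] by (simp add: nF)
    have T: "jacobi_trunc j a b (Suc N) (near h 0) x
        = jacobi_trunc j a b (Suc N) (F 0) x - jacobi_trunc j a b (Suc N) (A 0) x" for x
      unfolding nF by (rule jacobi_trunc_diff[OF ab LF0 L0])
    let ?TN = "jacobi_trunc j a b (Suc N) (near h 0)" and ?TA = "jacobi_trunc j a b (Suc N) (A 0)"
    note LT = jacobi_L2_jacobi_sum[OF ab', of j a b "Suc N"]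
    \<comment> \<open>The near part is singular, so it and its truncation are bounded one by one;
      only for the far part is the difference estimated as a whole.\<close>
    have dec: "F j x - jacobi_trunc j a b (Suc N) (F 0) x = near h j x + (-1) * ?TN x + (A j x - ?TA x)" for x
      using T[of x] fun_cong[OF nF[of j], of x] by linarith
    have "jint ?a ?b (\<lambda>x. (F j x - jacobi_trunc j a b (Suc N) (F 0) x)\<^sup>2)
      = jint ?a ?b (\<lambda>x. (near h j x + (-1) * ?TN x + (A j x - ?TA x))\<^sup>2)"
      by (simp only: dec)
    also have "\<dots> \<le> 3 * (jint ?a ?b (\<lambda>x. (near h j x)\<^sup>2) + jint ?a ?b (\<lambda>x. ((-1) * ?TN x)\<^sup>2)
        + jint ?a ?b (\<lambda>x. (A j x - ?TA x)\<^sup>2))"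
      by (intro jint_square_add3_le n0 jacobi_L2_cmult jacobi_L2_diff Lj LT)
    also have "\<dots> \<le> 3 * (G1 * ?R + X ^ j * G0 * ?R + 4 ^ (K - j) * G2 * ?R)"
    proof (intro mult_left_mono add_mono)
      show "jint ?a ?b (\<lambda>x. (near h j x)\<^sup>2) \<le> G1 * ?R"
        using G1(2)[rule_format, OF h] unfolding h_def scale_powr by simp
      have "jint ?a ?b (\<lambda>x. (?TN x)\<^sup>2) \<le> (X * (real N)\<^sup>2) ^ j * jint a b (\<lambda>x. (near h 0 x)\<^sup>2)"
        unfolding X_def by (rule jacobi_trunc_stable[OF ab n0(1) N])
      also have "\<dots> \<le> (X * (real N)\<^sup>2) ^ j * (G0 * real N powr (- (\<rho> * \<theta>)))"
        using G0(2)[rule_format, OF h] scale_powr[of N 0] unfolding h_def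
        by (intro mult_left_mono) (auto simp: X_def)
      also have "\<dots> = X ^ j * G0 * (real N powr (2 * real j) * real N powr (- (\<rho> * \<theta>)))"
        unfolding power_mult_distrib powr_even_power[OF N] by simp
      also have "real N powr (2 * real j) * real N powr (- (\<rho> * \<theta>)) = ?R"
        unfolding powr_add[symmetric] by simp
      finally show "jint ?a ?b (\<lambda>x. ((-1) * ?TN x)\<^sup>2) \<le> X ^ j * G0 * ?R"
        by (simp only: mult_minus1 power2_minus)
      have "jint ?a ?b (\<lambda>x. (A j x - ?TA x)\<^sup>2)
          \<le> (4 / (real N)\<^sup>2) ^ (K - j) * jint (a + real K) (b + real K) (\<lambda>x. (A K x)\<^sup>2)"
        using elim K by (intro jacobi_spectral_rate ab mA dA cA) auto
      also have "\<dots> \<le> (4 / (real N)\<^sup>2) ^ (K - j) * (G2 * real N powr (2 * real K - \<rho> * \<theta>))"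
        using far[OF h(1)] unfolding h_def scale_powr A_def by (intro mult_left_mono) auto
      also have "\<dots> = 4 ^ (K - j) * G2 * (real N powr (- (2 * real (K - j))) * real N powr (2 * real K - \<rho> * \<theta>))"
        unfolding power_divide powr_even_power[OF N] by (simp add: powr_minus divide_inverse)
      also have "real N powr (- (2 * real (K - j))) * real N powr (2 * real K - \<rho> * \<theta>) = ?R"
        unfolding powr_add[symmetric] using K by (simp add: of_nat_diff algebra_simps)
      finally show "jint ?a ?b (\<lambda>x. (A j x - ?TA x)\<^sup>2) \<le> 4 ^ (K - j) * G2 * ?R" .
    qed simp
    also have "\<dots> = C * ?R" by (simp add: C_def algebra_simps)
    finally show ?case using LFj unfolding F_def h_def by (intro conjI)
  qed
  with C show ?thesis by blast
qed

end

subsection \<open>The Sobolev space\<close>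

text \<open>On an open set, equality of functions passes to their derivatives. This ties the
  iterated \<open>deriv\<close> in the definition of the norm to an explicit sequence.\<close>

lemma funpow_deriv_eq:
  fixes u :: "real \<Rightarrow> real"
  assumes V: "open V" and 0: "\<And>x. x \<in> V \<Longrightarrow> u x = E 0 x"
    and d: "\<And>k x. k < K \<Longrightarrow> x \<in> V \<Longrightarrow> (E k has_real_derivative E (Suc k) x) (at x)"
  shows "k \<le> K \<Longrightarrow> x \<in> V \<Longrightarrow> (deriv ^^ k) u x = E k x"
proof (induction k arbitrary: x)
  case 0
  then show ?case by (simp add: assms)
next
  case (Suc k)
  have "(E k has_real_derivative E (Suc k) x) (at x)" using Suc.prems by (intro d) auto
  then have "((deriv ^^ k) u has_real_derivative E (Suc k) x) (at x)"
    by (rule has_field_derivative_transform_within_open[OF _ V Suc.prems(2)])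
       (use Suc in auto)
  then show ?case by (simp add: DERIV_imp_deriv)
qed

text \<open>The iterated \<open>deriv\<close> may be arbitrary at \<open>z\<close>; a change at a
  single point does not affect the integral.\<close>

lemma jint_eq_LINT_off_point:
  assumes [measurable]: "v \<in> borel_measurable borel"
    and eq: "\<And>x. x \<in> {-1<..<1} \<Longrightarrow> x \<noteq> z \<Longrightarrow> w x = v x"
  shows "(LINT x:{-1<..<1}|lborel. jacobi_weight a b x * (w x)\<^sup>2) = jint a b (\<lambda>x. (v x)\<^sup>2)"
proof -
  have "(LINT x:{-1<..<1}|lborel. jacobi_weight a b x * (w x)\<^sup>2)
      = (LINT x:{-1<..<1}|lborel. jacobi_weight a b x * (v x)\<^sup>2)"
    unfolding set_lebesgue_integral_def
    by (rule integral_discrete_difference[of "{z}"]) (auto simp: indicator_def eq)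
  then show ?thesis by (simp add: integral_jacobi_measure)
qed

lemma set_integrable_off_point:
  assumes v: "jacobi_L2 a b v"
    and eq: "\<And>x. x \<in> {-1<..<1} \<Longrightarrow> x \<noteq> z \<Longrightarrow> w x = v x"
  shows "set_integrable lborel {-1<..<1} (\<lambda>x. jacobi_weight a b x * (w x)\<^sup>2)"
proof -
  have "set_integrable lborel {-1<..<1} (\<lambda>x. jacobi_weight a b x * (v x)\<^sup>2)"
    using v by (subst integrable_jacobi_measure[symmetric]) (auto simp: jacobi_L2_def)
  then show ?thesis unfolding set_integrable_def
    by (subst integrable_discrete_difference[of "{z}" _ _ "\<lambda>x. indicator {-1<..<1} x *\<^sub>R (jacobi_weight a b x * (v x)\<^sup>2)"])
       (auto simp: indicator_def eq)
qed

lemma set_borel_measurable_off_point: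
  fixes v w :: "real \<Rightarrow> real"
  assumes [measurable]: "v \<in> borel_measurable borel"
    and eq: "\<And>x. x \<in> {-1<..<1} \<Longrightarrow> x \<noteq> z \<Longrightarrow> w x = v x"
  shows "set_borel_measurable lborel {-1<..<1} w"
  unfolding set_borel_measurable_def
proof (rule measurable_discrete_difference[of "\<lambda>x. indicator {-1<..<1} x *\<^sub>R v x" _ _ "{z}"])
  show "(\<lambda>x. indicator {-1<..<1} x *\<^sub>R v x) \<in> borel_measurable lborel" by measurable
qed (auto simp: indicator_def eq)

lemma sobolev_norm_eq:
  assumes m: "\<And>j. j \<le> m \<Longrightarrow> E j \<in> borel_measurable borel"
    and 0: "\<And>x. x \<in> {-1<..<1} - {z} \<Longrightarrow> u x = E 0 x"
    and d: "\<And>k x. k < m \<Longrightarrow> x \<in> {-1<..<1} - {z} \<Longrightarrow> (E k has_real_derivative E (Suc k) x) (at x)"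
  shows "jacobi_sobolev_norm m a b u
    = sqrt (\<Sum>j\<le>m. jint (a + real j) (b + real j) (\<lambda>x. (E j x)\<^sup>2))"
proof -
  have "open ({-1<..<1} - {z})" by (intro open_Diff) auto
  from funpow_deriv_eq[OF this 0 d] have "(deriv ^^ j) u x = E j x"
    if "j \<le> m" "x \<in> {-1<..<1} - {z}" for j x
    using that by blast
  then have "(LINT x:{-1<..<1}|lborel. jacobi_weight (a + real j) (b + real j) x * ((deriv ^^ j) u x)\<^sup>2)
      = jint (a + real j) (b + real j) (\<lambda>x. (E j x)\<^sup>2)" if "j \<le> m" for j
    using that m by (intro jint_eq_LINT_off_point[of _ z]) auto
  then show ?thesis unfolding jacobi_sobolev_norm_def by simp
qed

text \<open>For interior \<open>z\<close> this admits a kink: derivatives of order below m - 1 are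
  differentiable at \<open>z\<close>, the one of order m - 1 is merely continuous there, and the one
  of order m is identified only off \<open>z\<close>. For an end point the conditions at
  \<open>z\<close> are vacuous.\<close>

lemma sobolev_memI:
  assumes L2: "\<And>j. j \<le> m \<Longrightarrow> jacobi_L2 (a + real j) (b + real j) (E j)"
    and 0: "\<And>x. x \<in> {-1<..<1} \<Longrightarrow> u x = E 0 x"
    and d: "\<And>k x. k < m \<Longrightarrow> x \<in> {-1<..<1} - {z} \<Longrightarrow> (E k has_real_derivative E (Suc k) x) (at x)"
    and dz: "\<And>k. Suc k < m \<Longrightarrow> z \<in> {-1<..<1} \<Longrightarrow> (E k has_real_derivative E (Suc k) z) (at z)"
    and cz: "\<And>k. k < m \<Longrightarrow> z \<in> {-1<..<1} \<Longrightarrow> isCont (E k) z"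
  shows "u \<in> jacobi_sobolev m a b"
proof -
  have "open ({-1<..<1} - {z})" by (intro open_Diff) auto
  from funpow_deriv_eq[OF this 0 d] have D: "(deriv ^^ j) u x = E j x"
    if "j \<le> m" "x \<in> {-1<..<1}" "x \<noteq> z" for j x
    using that by blast
  have D': "(deriv ^^ j) u x = E j x" if "j < m" "x \<in> {-1<..<1}" for j x
  proof (rule funpow_deriv_eq[of "{-1<..<1}" u E "m - 1"])
    show "(E k has_real_derivative E (Suc k) x) (at x)" if "k < m - 1" "x \<in> {-1<..<1}" for k x
      using d[of k x] dz[of k] that by (cases "x = z") auto
  qed (use that 0 in auto)
  have meas: "E j \<in> borel_measurable borel" if "j \<le> m" for j
    using L2[OF that] by (rule jacobi_L2_measurable)
  have ftc: "set_integrable lborel {s..t} ((deriv ^^ Suc j) u) \<and>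
        (LINT x:{s..t}|lborel. (deriv ^^ Suc j) u x) = (deriv ^^ j) u t - (deriv ^^ j) u s"
    if j: "j < m" and st: "-1 < s" "s \<le> t" "t < 1" for j s t
  proof -
    let ?w = "jacobi_weight (a + real (Suc j)) (b + real (Suc j))"
    have [measurable]: "E (Suc j) \<in> borel_measurable borel" using j by (intro meas) auto
    \<comment> \<open>On a compact subinterval the weight is bounded below by a positive
      \<open>\<delta>\<close>, so weighted square integrability yields local integrability, by |t|
      \<le> 1 + t^2.\<close>
    have "continuous_on {s..t} ?w"
      unfolding jacobi_weight_def[abs_def] using st by (intro continuous_intros) auto
    from continuous_attains_inf[OF compact_Icc _ this]
    obtain y where y: "y \<in> {s..t}" "\<And>x. x \<in> {s..t} \<Longrightarrow> ?w y \<le> ?w x"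
      using st by auto
    define \<delta> where "\<delta> = ?w y"
    have \<delta>: "\<delta> > 0" using y(1) st unfolding \<delta>_def by (intro jacobi_weight_pos) auto
    have "set_integrable lborel {-1<..<1} (\<lambda>x. ?w x * (E (Suc j) x)\<^sup>2)"
      using L2[of "Suc j"] j by (subst integrable_jacobi_measure[symmetric]) (auto simp: jacobi_L2_def)
    then have "set_integrable lborel {s..t} (\<lambda>x. ?w x * (E (Suc j) x)\<^sup>2)"
      by (rule set_integrable_subset) (use st in auto)
    then have "set_integrable lborel {s..t} (\<lambda>x. 1 / \<delta> * (?w x * (E (Suc j) x)\<^sup>2))"
      by (rule set_integrable_mult_right)
    moreover have "set_integrable lborel {s..t} (\<lambda>x. 1 :: real)"
      unfolding set_integrable_def using st by (simp add: integrable_indicator_iff)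
    ultimately have dom: "set_integrable lborel {s..t} (\<lambda>x. 1 + 1 / \<delta> * (?w x * (E (Suc j) x)\<^sup>2))"
      by (intro set_integral_add)
    have I: "set_integrable lborel {s..t} (E (Suc j))"
    proof (rule set_integrable_bound[OF dom])
      show "set_borel_measurable lborel {s..t} (E (Suc j))"
        unfolding set_borel_measurable_def by measurable
      show "AE x in lborel. x \<in> {s..t} \<longrightarrow>
          norm (E (Suc j) x) \<le> norm (1 + 1 / \<delta> * (?w x * (E (Suc j) x)\<^sup>2))"
      proof (intro AE_I2 impI)
        fix x assume "x \<in> {s..t}"
        then have "\<delta> \<le> ?w x" using y(2) by (simp add: \<delta>_def)
        then have "1 * (E (Suc j) x)\<^sup>2 \<le> (1 / \<delta> * ?w x) * (E (Suc j) x)\<^sup>2"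
          using \<delta> by (intro mult_right_mono) auto
        moreover have "\<bar>E (Suc j) x\<bar> \<le> 1 + (E (Suc j) x)\<^sup>2"
          using sum_squares_bound[of 1 "\<bar>E (Suc j) x\<bar>"] by (simp add: power2_eq_square)
        ultimately show "norm (E (Suc j) x) \<le> norm (1 + 1 / \<delta> * (?w x * (E (Suc j) x)\<^sup>2))"
          by (simp add: mult.assoc)
      qed
    qed
    \<comment> \<open>The fundamental theorem admits \<open>z\<close> as an exceptional point, where
      continuity of \<open>E j\<close> suffices.\<close>
    have "(E (Suc j) has_integral (E j t - E j s)) {s..t}"
    proof (rule fundamental_theorem_of_calculus_interior_strong[of "{z}"])
      show "(E j has_vector_derivative E (Suc j) x) (at x)" if "x \<in> {s<..<t} - {z}" for x
        using d[OF j, of x] that st unfolding has_real_derivative_iff_has_vector_derivative by auto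
      have "isCont (E j) x" if "x \<in> {s..t}" for x
        using d[OF j, of x] cz[OF j] that st by (cases "x = z") (auto intro: DERIV_isCont)
      then show "continuous_on {s..t} (E j)" by (intro continuous_at_imp_continuous_on) auto
    qed (use st in auto)
    then have "(LINT x:{s..t}|lborel. E (Suc j) x) = E j t - E j s"
      using set_borel_integral_eq_integral(2)[OF I] by (simp add: integral_unique)
    moreover have "(LINT x:{s..t}|lborel. (deriv ^^ Suc j) u x) = (LINT x:{s..t}|lborel. E (Suc j) x)"
      unfolding set_lebesgue_integral_def using D[of "Suc j"] j st
      by (intro integral_discrete_difference[of "{z}"]) (auto simp: indicator_def simp del: funpow.simps)
    moreover have "set_integrable lborel {s..t} ((deriv ^^ Suc j) u)"
      using I unfolding set_integrable_def
      by (subst integrable_discrete_difference[of "{z}" _ _ "\<lambda>x. indicator {s..t} x *\<^sub>R E (Suc j) x"])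
         (use D[of "Suc j"] j st in \<open>auto simp: indicator_def simp del: funpow.simps\<close>)
    moreover have "(deriv ^^ j) u t = E j t" "(deriv ^^ j) u s = E j s"
      using st by (intro D' j; simp)+
    ultimately show ?thesis by (simp del: funpow.simps)
  qed
  show ?thesis
    unfolding jacobi_sobolev_def
  proof (intro CollectI conjI allI impI)
    fix j assume j: "j \<le> m"
    show "set_borel_measurable lborel {-1<..<1} ((deriv ^^ j) u)"
      using D j by (intro set_borel_measurable_off_point[OF meas[OF j], of z]) auto
    show "set_integrable lborel {-1<..<1}
          (\<lambda>x. jacobi_weight (a + real j) (b + real j) x * ((deriv ^^ j) u x)\<^sup>2)"
      using D j by (intro set_integrable_off_point[OF L2[OF j], of z]) auto
  qed (use ftc in blast)+
qed

lemma jacobi_L2_off_point: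
  assumes v: "jacobi_L2 a b v" and w: "w \<in> borel_measurable borel"
    and eq: "\<And>x. x \<in> {-1<..<1} \<Longrightarrow> x \<noteq> z \<Longrightarrow> w x = v x"
  shows "jacobi_L2 a b w"
  using set_integrable_off_point[OF v eq] w
  by (simp add: jacobi_L2_def integrable_jacobi_measure)

lemma power_bound_isCont:
  fixes F :: "real \<Rightarrow> real"
  assumes "\<delta> > 0" "p > 0" "F z = 0"
    and le: "\<And>x. x \<noteq> z \<Longrightarrow> \<bar>x - z\<bar> < \<delta> \<Longrightarrow> \<bar>F x\<bar> \<le> C * \<bar>x - z\<bar> powr p"
  shows "isCont F z"
proof -
  have "((\<lambda>x. C * \<bar>x - z\<bar> powr p) \<longlongrightarrow> C * 0) (at z)"
    using assms(2) by (intro tendsto_mult tendsto_const tendsto_zero_powrI[where b = p])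
      (auto intro!: tendsto_eq_intros)
  moreover have "\<forall>\<^sub>F x in at z. norm (F x) \<le> C * \<bar>x - z\<bar> powr p"
    unfolding eventually_at using assms(1) le by (auto simp: dist_real_def intro!: exI[of _ \<delta>])
  ultimately have "(F \<longlongrightarrow> 0) (at z)" by (intro Lim_null_comparison[of F]) auto
  then show ?thesis by (simp add: isCont_def assms(3))
qed

text \<open>The difference quotient at \<open>z\<close> obeys the same kind of bound with exponent p
  - 1, so the continuity criterion applies to it.\<close>

lemma power_bound_DERIV:
  fixes F :: "real \<Rightarrow> real"
  assumes "\<delta> > 0" "p > 1" "F z = 0"
    and le: "\<And>x. x \<noteq> z \<Longrightarrow> \<bar>x - z\<bar> < \<delta> \<Longrightarrow> \<bar>F x\<bar> \<le> C * \<bar>x - z\<bar> powr p"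
  shows "(F has_real_derivative 0) (at z)"
proof -
  have "isCont (\<lambda>x. if x = z then 0 else F x / (x - z)) z"
  proof (rule power_bound_isCont[of \<delta> "p - 1" _ _ C])
    fix x assume x: "x \<noteq> z" "\<bar>x - z\<bar> < \<delta>"
    have "\<bar>F x\<bar> / \<bar>x - z\<bar> \<le> C * \<bar>x - z\<bar> powr p / \<bar>x - z\<bar>"
      using le[OF x] x by (intro divide_right_mono) auto
    also have "\<dots> = C * \<bar>x - z\<bar> powr (p - 1)" using x by (simp add: powr_diff)
    finally show "\<bar>if x = z then 0 else F x / (x - z)\<bar> \<le> C * \<bar>x - z\<bar> powr (p - 1)" using x by simp
  qed (use assms in auto)
  then have "((\<lambda>x. if x = z then 0 else F x / (x - z)) \<longlongrightarrow> 0) (at z)" by (simp add: isCont_def)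
  then have "((\<lambda>x. F x / (x - z)) \<longlongrightarrow> 0) (at z)"
    by (rule Lim_transform_eventually) (auto simp: eventually_at intro!: exI[of _ 1])
  then show ?thesis by (simp add: has_field_derivative_iff assms(3))
qed

text \<open>Binomial expansion of ln r = ln (r / h) + ln h. It persists at r = 0, as
  \<open>0 powr \<gamma>\<close> is 0 by convention.\<close>

lemma power_log_split:
  fixes r h \<gamma> G :: real
  assumes "h > 0" "r \<ge> 0"
  shows "r powr \<gamma> * ln r ^ \<mu> * G
    = (\<Sum>i\<le>\<mu>. (real (\<mu> choose i) * ln h ^ (\<mu> - i)) * (r powr \<gamma> * ln (r / h) ^ i * G))"
proof (cases "r = 0")
  case False
  then have "ln r = ln (r / h) + ln h" using assms by (simp add: ln_div)
  then have "ln r ^ \<mu> = (\<Sum>i\<le>\<mu>. real (\<mu> choose i) * ln (r / h) ^ i * ln h ^ (\<mu> - i))"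
    by (simp only: binomial_ring)
  then show ?thesis by (simp add: sum_distrib_left sum_distrib_right mult_ac)
qed simp

lemma fsing_monom_0:
  "fsing gs z \<gamma> (monom 1 i) h 0 x = \<bar>x - z\<bar> powr \<gamma> * ln (\<bar>x - z\<bar> / h) ^ i * gs 0 x"
  by (simp add: fsing_def sing_def poly_monom)

lemma jacobi_coeff_cong:
  assumes "\<And>x. x \<in> {-1<..<1} \<Longrightarrow> x \<noteq> z \<Longrightarrow> f x = g x"
  shows "jacobi_coeff a b f n = jacobi_coeff a b g n"
proof -
  have "(LINT x:{-1<..<1}|lborel. jacobi_weight a b x * f x * jacobi_P a b n x)
      = (LINT x:{-1<..<1}|lborel. jacobi_weight a b x * g x * jacobi_P a b n x)"
    unfolding set_lebesgue_integral_def
    by (rule integral_discrete_difference[of "{z}"]) (auto simp: indicator_def assms)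
  then show ?thesis by (simp add: jacobi_coeff_def)
qed

lemma jacobi_proj_eq: "jacobi_proj a b f N = jacobi_trunc 0 a b (Suc N) f"
  by (rule ext) (simp only: jacobi_proj_def jacobi_sum.simps lessThan_Suc_atMost)

context jacobi_singular
begin

lemma fsing_deriv_at:
  assumes "smooth_seq gs" "h > 0" "x \<in> {-1<..<1} - {z}"
  shows "(fsing gs z \<gamma> p h k has_real_derivative fsing gs z \<gamma> p h (Suc k) x) (at x)"
  using fsing_deriv[OF assms(1) z assms(2), of x \<gamma> p k] assms(3) at_within_Icc_at[of "-1" x 1] by auto

text \<open>At scale 1 and distance at most 1 the logarithmic factor is itself the power -\<epsilon>
  of the distance, so the bound becomes a pure power.\<close>

lemma fsing_small:
  assumes "smooth_seq gs" "\<epsilon> > 0"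
  shows "\<exists>C\<ge>0. \<forall>k\<le>K. \<forall>x\<in>{-1..1}. x \<noteq> z \<longrightarrow> \<bar>x - z\<bar> \<le> 1 \<longrightarrow>
    \<bar>fsing gs z \<gamma> p 1 k x\<bar> \<le> C * \<bar>x - z\<bar> powr (\<gamma> - real k - \<epsilon>)"
proof -
  obtain C where C: "C \<ge> 0" "\<forall>k\<le>K. \<forall>h>0. \<forall>x\<in>{-1..1}. x \<noteq> z \<longrightarrow>
    \<bar>fsing gs z \<gamma> p h k x\<bar> \<le> C * (log_factor \<epsilon> h \<bar>x - z\<bar> * \<bar>x - z\<bar> powr (\<gamma> - real k))"
    using fsing_bound[OF assms(1) z assms(2)] by blast
  have "\<bar>fsing gs z \<gamma> p 1 k x\<bar> \<le> C * \<bar>x - z\<bar> powr (\<gamma> - real k - \<epsilon>)"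
    if "k \<le> K" "x \<in> {-1..1}" "x \<noteq> z" "\<bar>x - z\<bar> \<le> 1" for k x
  proof -
    have "ln \<bar>x - z\<bar> \<le> 0" using that by simp
    then have "log_factor \<epsilon> 1 \<bar>x - z\<bar> * \<bar>x - z\<bar> powr (\<gamma> - real k) = \<bar>x - z\<bar> powr (\<gamma> - real k - \<epsilon>)"
      using that by (simp add: log_factor_def powr_def algebra_simps flip: exp_add)
    then show ?thesis using C(2)[rule_format, of k 1 x] that by simp
  qed
  then show ?thesis by (intro exI[of _ C] conjI[OF C(1)] allI ballI impI)
qed

text \<open>\<open>singular_block\<close> gives square integrability only at the scales of large N,
  so the function is expanded at one such scale. Both derivative sequences consist of iterated
  derivatives of the same function, hence they agree off \<open>z\<close>.\<close>

lemma fsing_L2: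
  assumes gs: "smooth_seq gs" and j: "j \<le> m"
  shows "jacobi_L2 (a + real j) (b + real j) (fsing gs z \<gamma> (monom 1 \<mu>) 1 j)"
proof -
  have "\<forall>\<^sub>F N in sequentially. \<forall>i\<in>{..\<mu>}.
      jacobi_L2 (a + real j) (b + real j) (fsing gs z \<gamma> (monom 1 i) (scale N) j)"
  proof (rule eventually_ball_finite)
    show "\<forall>i\<in>{..\<mu>}. \<forall>\<^sub>F N in sequentially.
      jacobi_L2 (a + real j) (b + real j) (fsing gs z \<gamma> (monom 1 i) (scale N) j)"
    proof
      fix i
      from singular_block[OF gs j, of "monom 1 i"] show "\<forall>\<^sub>F N in sequentially.
        jacobi_L2 (a + real j) (b + real j) (fsing gs z \<gamma> (monom 1 i) (scale N) j)"
        by (elim exE conjE, elim eventually_mono conjunct1)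
    qed
  qed simp
  from eventually_happens'[OF sequentially_bot eventually_conj[OF this eventually_gt_at_top[of 0]]]
  obtain N where N: "N > 0" and L: "\<forall>i\<in>{..\<mu>}.
      jacobi_L2 (a + real j) (b + real j) (fsing gs z \<gamma> (monom 1 i) (scale N) j)"
    by blast
  define h where "h = scale N"
  have h: "h > 0" using scale_pos[OF N] by (simp add: h_def)
  define c where "c = (\<lambda>i. real (\<mu> choose i) * ln h ^ (\<mu> - i))"
  define E where "E = (\<lambda>k x. \<Sum>i\<le>\<mu>. c i * fsing gs z \<gamma> (monom 1 i) h k x)"
  have V: "open ({-1<..<1} - {z})" by (intro open_Diff) auto
  have e0: "fsing gs z \<gamma> (monom 1 \<mu>) 1 0 x = E 0 x" for x
    unfolding E_def c_def fsing_monom_0 using power_log_split[OF h, of "\<bar>x - z\<bar>" \<gamma> \<mu> "gs 0 x"] by simp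
  have dE: "(E k has_real_derivative E (Suc k) x) (at x)" if "x \<in> {-1<..<1} - {z}" for k x
    unfolding E_def by (intro DERIV_sum DERIV_cmult fsing_deriv_at gs h that)
  have d1: "(fsing gs z \<gamma> (monom 1 \<mu>) 1 k has_real_derivative fsing gs z \<gamma> (monom 1 \<mu>) 1 (Suc k) x) (at x)"
    if "x \<in> {-1<..<1} - {z}" for k x
    by (intro fsing_deriv_at gs that) simp
  have eq: "fsing gs z \<gamma> (monom 1 \<mu>) 1 j x = E j x" if "x \<in> {-1<..<1}" "x \<noteq> z" for x
    using funpow_deriv_eq[where u = "fsing gs z \<gamma> (monom 1 \<mu>) 1 0" and E = E, OF V e0 dE, of j j x]
      funpow_deriv_eq[where u = "fsing gs z \<gamma> (monom 1 \<mu>) 1 0" and E = "fsing gs z \<gamma> (monom 1 \<mu>) 1",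
        OF V refl d1, of j j x] that by simp
  have "jacobi_L2 (a + real j) (b + real j) (E j)"
    unfolding E_def using L by (intro jacobi_L2_sum jacobi_L2_cmult) (auto simp: h_def)
  then show ?thesis
    by (rule jacobi_L2_off_point[OF _ fsing_measurable[OF gs z] eq])
qed

lemma singular_sobolev_mem:
  assumes gs: "smooth_seq gs" and int: "z \<in> {-1<..<1} \<Longrightarrow> \<gamma> > real m - 1 / 2"
    and f: "\<And>x. x \<in> {-1<..<1} \<Longrightarrow> f x = \<bar>x - z\<bar> powr \<gamma> * ln \<bar>x - z\<bar> ^ \<mu> * gs 0 x"
  shows "(\<lambda>x. f x - jacobi_proj a b f N x) \<in> jacobi_sobolev m a b"
proof -
  define F where "F = fsing gs z \<gamma> (monom 1 \<mu>) 1"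
  define T where "T = (\<lambda>j. jacobi_trunc j a b (Suc N) f)"
  have dT: "(T k has_real_derivative T (Suc k) x) (at x)" for k x
    unfolding T_def by (rule jacobi_sum_deriv)
  \<comment> \<open>For interior \<open>z\<close>, \<gamma> - k exceeds 1/2 if k < m, and 3/2 if k +
    1 < m. A loss of 1/4 keeps these exponents above 0 and 1, as continuity and differentiability
    require.\<close>
  have "(1 / 4 :: real) > 0" by simp
  from fsing_small[OF gs this, of m "monom 1 \<mu>"]
  obtain C where C: "C \<ge> 0" "\<forall>k\<le>m. \<forall>x\<in>{-1..1}. x \<noteq> z \<longrightarrow> \<bar>x - z\<bar> \<le> 1 \<longrightarrow>
    \<bar>F k x\<bar> \<le> C * \<bar>x - z\<bar> powr (\<gamma> - real k - 1 / 4)"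
    unfolding F_def by blast
  have F0: "F k z = 0" for k unfolding F_def by (rule fsing_at[OF gs z])
  have Cz: "\<exists>\<delta>>0. \<forall>x. x \<noteq> z \<longrightarrow> \<bar>x - z\<bar> < \<delta> \<longrightarrow> \<bar>F k x\<bar> \<le> C * \<bar>x - z\<bar> powr (\<gamma> - real k - 1 / 4)"
    if "k \<le> m" "z \<in> {-1<..<1}" for k
  proof (intro exI[of _ "min 1 (min (1 - z) (1 + z))"] conjI allI impI)
    fix x assume x: "x \<noteq> z" "\<bar>x - z\<bar> < min 1 (min (1 - z) (1 + z))"
    then have "x \<in> {-1..1}" "\<bar>x - z\<bar> \<le> 1" by (simp_all, linarith)
    then show "\<bar>F k x\<bar> \<le> C * \<bar>x - z\<bar> powr (\<gamma> - real k - 1 / 4)"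
      using C(2)[rule_format, OF that(1)] x(1) by blast
  qed (use that in auto)
  show ?thesis
  proof (rule sobolev_memI[of m a b "\<lambda>j x. F j x - T j x" _ z])
    show "jacobi_L2 (a + real j) (b + real j) (\<lambda>x. F j x - T j x)" if "j \<le> m" for j
      unfolding F_def T_def using ab that
      by (intro jacobi_L2_diff fsing_L2 jacobi_L2_jacobi_sum gs) auto
    show "f x - jacobi_proj a b f N x = F 0 x - T 0 x" if "x \<in> {-1<..<1}" for x
      unfolding jacobi_proj_eq F_def T_def fsing_monom_0 using f[OF that] by simp
    show "((\<lambda>x. F k x - T k x) has_real_derivative F (Suc k) x - T (Suc k) x) (at x)"
      if "x \<in> {-1<..<1} - {z}" for k x
      unfolding F_def by (intro DERIV_diff dT fsing_deriv_at gs that) simp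
    show "((\<lambda>x. F k x - T k x) has_real_derivative F (Suc k) z - T (Suc k) z) (at z)"
      if k: "Suc k < m" and z': "z \<in> {-1<..<1}" for k
    proof -
      have km: "k \<le> m" using k by simp
      obtain \<delta> where \<delta>: "\<delta> > 0" "\<And>x. x \<noteq> z \<Longrightarrow> \<bar>x - z\<bar> < \<delta> \<Longrightarrow> \<bar>F k x\<bar> \<le> C * \<bar>x - z\<bar> powr (\<gamma> - real k - 1 / 4)"
        using Cz[OF km z'] by blast
      have "\<gamma> - real k - 1 / 4 > 1" using int[OF z'] k by linarith
      then have "(F k has_real_derivative 0) (at z)" using \<delta> F0 by (intro power_bound_DERIV)
      then show ?thesis unfolding F0 by (intro DERIV_diff dT)
    qed
    show "isCont (\<lambda>x. F k x - T k x) z" if k: "k < m" and z': "z \<in> {-1<..<1}" for k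
    proof -
      have km: "k \<le> m" using k by simp
      obtain \<delta> where \<delta>: "\<delta> > 0" "\<And>x. x \<noteq> z \<Longrightarrow> \<bar>x - z\<bar> < \<delta> \<Longrightarrow> \<bar>F k x\<bar> \<le> C * \<bar>x - z\<bar> powr (\<gamma> - real k - 1 / 4)"
        using Cz[OF km z'] by blast
      have "\<gamma> - real k - 1 / 4 > 0" using int[OF z'] k by linarith
      then have "isCont (F k) z" using \<delta> F0 by (intro power_bound_isCont)
      then show ?thesis using DERIV_isCont[OF dT] by (intro isCont_diff)
    qed
  qed
qed

end

subsection \<open>Convergence rates\<close>

lemma jint_square_sum_le:
  assumes "finite I" and L: "\<And>i. i \<in> I \<Longrightarrow> jacobi_L2 a b (u i)"
  shows "jint a b (\<lambda>x. (\<Sum>i\<in>I. u i x)\<^sup>2) \<le> real (card I) * (\<Sum>i\<in>I. jint a b (\<lambda>x. (u i x)\<^sup>2))"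
proof -
  have "jint a b (\<lambda>x. (\<Sum>i\<in>I. u i x)\<^sup>2) \<le> jint a b (\<lambda>x. (\<Sum>i\<in>I. (u i x)\<^sup>2) * real (card I))"
    by (intro integral_mono sum_squared_le_sum_of_squares jacobi_L2_square jacobi_L2_sum L
        integrable_mult_left Bochner_Integration.integrable_sum)
  also have "\<dots> = real (card I) * (\<Sum>i\<in>I. jint a b (\<lambda>x. (u i x)\<^sup>2))"
    using jacobi_L2_square[OF L] by (simp add: Bochner_Integration.integral_sum mult.commute)
  finally show ?thesis .
qed

context jacobi_singular
begin

text \<open>Norms are squared here, hence the doubled exponents; \<open>k\<close> is meant for the
  coefficient of a block, with its power of ln h.\<close>

abbreviation rate_bound :: "nat \<Rightarrow> nat \<Rightarrow> real \<Rightarrow> (nat \<Rightarrow> real \<Rightarrow> real) \<Rightarrow> real \<Rightarrow> nat \<Rightarrow> bool" where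
  "rate_bound \<nu> j k U C N \<equiv> jacobi_L2 (a + real j) (b + real j) (U j) \<and>
     k\<^sup>2 * proj_err j a b N U \<le> C * (real N powr (2 * real j - \<rho> * \<theta>) * ln (real N) ^ (2 * \<nu>))"

text \<open>The decomposition depends on N through the scale, so coefficients and blocks are indexed
  by N. The projection is linear, hence the errors of the blocks add up, and among the orders j up
  to m the highest one dominates.\<close>

lemma sobolev_norm_bigo:
  fixes k :: "nat \<Rightarrow> nat \<Rightarrow> real" and B :: "nat \<Rightarrow> nat \<Rightarrow> nat \<Rightarrow> real \<Rightarrow> real"
  assumes f: "\<And>N x. N > 0 \<Longrightarrow> x \<in> {-1<..<1} - {z} \<Longrightarrow> f x = (\<Sum>i\<le>\<mu>. k i N * B i N 0 x)"
    and dB: "\<And>N i l x. N > 0 \<Longrightarrow> x \<in> {-1<..<1} - {z} \<Longrightarrow>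
      (B i N l has_real_derivative B i N (Suc l) x) (at x)"
    and bound: "\<And>i j. i \<le> \<mu> \<Longrightarrow> j \<le> m \<Longrightarrow> \<exists>C\<ge>0. \<forall>\<^sub>F N in sequentially. rate_bound \<nu> j (k i N) (B i N) C N"
  shows "(\<lambda>N. jacobi_sobolev_norm m a b (\<lambda>x. f x - jacobi_proj a b f N x))
    \<in> O(\<lambda>N. real N powr (real m - \<rho> * \<theta> / 2) * ln (real N) ^ \<nu>)"
proof -
  \<comment> \<open>One constant per pair (i, j) is fixed first; then the finitely many eventual
    bounds hold simultaneously for all large N.\<close>
  define Q where "Q i j c \<longleftrightarrow> c \<ge> 0 \<and> (\<forall>\<^sub>F N in sequentially. rate_bound \<nu> j (k i N) (B i N) c N)" for i j c
  define C where "C i j = (SOME c. Q i j c)" for i j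
  have C: "Q i j (C i j)" if "i \<le> \<mu>" "j \<le> m" for i j
    unfolding C_def by (rule someI_ex) (use bound[OF that] in \<open>unfold Q_def\<close>)
  have C0: "C i j \<ge> 0" if "i \<le> \<mu>" "j \<le> m" for i j
    using C[OF that] unfolding Q_def by (rule conjunct1)
  define M where "M = (\<Sum>j\<le>m. real (Suc \<mu>) * (\<Sum>i\<le>\<mu>. C i j))"
  have M: "M \<ge> 0" unfolding M_def by (intro sum_nonneg mult_nonneg_nonneg C0) auto
  have "\<forall>\<^sub>F N in sequentially. \<forall>ij\<in>{..\<mu>} \<times> {..m}.
      rate_bound \<nu> (snd ij) (k (fst ij) N) (B (fst ij) N) (C (fst ij) (snd ij)) N"
  proof (rule eventually_ball_finite)
    show "\<forall>ij\<in>{..\<mu>} \<times> {..m}. \<forall>\<^sub>F N in sequentially.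
      rate_bound \<nu> (snd ij) (k (fst ij) N) (B (fst ij) N) (C (fst ij) (snd ij)) N"
    proof
      fix ij assume "ij \<in> {..\<mu>} \<times> {..m}"
      then have "fst ij \<le> \<mu>" "snd ij \<le> m" by auto
      from conjunct2[OF C[OF this, unfolded Q_def]] show "\<forall>\<^sub>F N in sequentially.
      rate_bound \<nu> (snd ij) (k (fst ij) N) (B (fst ij) N) (C (fst ij) (snd ij)) N" .
    qed
  qed simp
  with eventually_ge_at_top[of 1]
  have "\<forall>\<^sub>F N in sequentially. norm (jacobi_sobolev_norm m a b (\<lambda>x. f x - jacobi_proj a b f N x))
    \<le> sqrt M * norm (real N powr (real m - \<rho> * \<theta> / 2) * ln (real N) ^ \<nu>)"
  proof eventually_elim
    case (elim N)
    then have N: "N > 0" by simp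
    define R where "R = real N powr (real m - \<rho> * \<theta> / 2) * ln (real N) ^ \<nu>"
    have L: "jacobi_L2 (a + real j) (b + real j) (B i N j)"
      and J: "(k i N)\<^sup>2 * proj_err j a b N (B i N)
        \<le> C i j * (real N powr (2 * real j - \<rho> * \<theta>) * ln (real N) ^ (2 * \<nu>))"
      if "i \<le> \<mu>" "j \<le> m" for i j
      using elim(2)[rule_format, of "(i, j)"] that by auto
    define D where "D = (\<lambda>i j x. B i N j x - jacobi_trunc j a b (Suc N) (B i N 0) x)"
    define E where "E = (\<lambda>j x. \<Sum>i\<le>\<mu>. k i N * D i j x)"
    have LD: "jacobi_L2 (a + real j) (b + real j) (\<lambda>x. k i N * D i j x)" if "i \<le> \<mu>" "j \<le> m" for i j
      unfolding D_def using L[OF that] ab by (intro jacobi_L2_cmult jacobi_L2_diff jacobi_L2_jacobi_sum) auto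
    have LE: "jacobi_L2 (a + real j) (b + real j) (E j)" if "j \<le> m" for j
      unfolding E_def using that by (intro jacobi_L2_sum LD) auto
    have L0: "jacobi_L2 a b (B i N 0)" if "i \<le> \<mu>" for i using L[of i 0] that by simp
    have "jacobi_coeff a b f n = jacobi_coeff a b (\<lambda>x. \<Sum>i\<le>\<mu>. k i N * B i N 0 x) n" for n
      by (rule jacobi_coeff_cong[of z]) (use f[OF N] in auto)
    then have cf: "jacobi_coeff a b f n = (\<Sum>i\<le>\<mu>. k i N * jacobi_coeff a b (B i N 0) n)" for n
      using jacobi_coeff_linear[OF ab, of "{..\<mu>}" "\<lambda>i. B i N 0"] L0 by simp
    have proj: "jacobi_proj a b f N x = (\<Sum>i\<le>\<mu>. k i N * jacobi_trunc 0 a b (Suc N) (B i N 0) x)" for x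
      unfolding jacobi_proj_eq cf[abs_def] by (rule jacobi_sum_linear)
    have "jacobi_sobolev_norm m a b (\<lambda>x. f x - jacobi_proj a b f N x)
      = sqrt (\<Sum>j\<le>m. jint (a + real j) (b + real j) (\<lambda>x. (E j x)\<^sup>2))"
    proof (rule sobolev_norm_eq[of _ _ z])
      show "E j \<in> borel_measurable borel" if "j \<le> m" for j using LE[OF that] by (rule jacobi_L2_measurable)
      show "f x - jacobi_proj a b f N x = E 0 x" if "x \<in> {-1<..<1} - {z}" for x
        unfolding proj f[OF N that] E_def D_def right_diff_distrib sum_subtractf ..
      show "(E l has_real_derivative E (Suc l) x) (at x)" if "x \<in> {-1<..<1} - {z}" for l x
        unfolding E_def D_def
        by (intro DERIV_sum DERIV_cmult DERIV_diff jacobi_sum_deriv dB N that)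
    qed
    also have "\<dots> \<le> sqrt (M * R\<^sup>2)"
    proof (rule real_sqrt_le_mono)
      have "(\<Sum>j\<le>m. jint (a + real j) (b + real j) (\<lambda>x. (E j x)\<^sup>2))
        \<le> (\<Sum>j\<le>m. real (Suc \<mu>) * (\<Sum>i\<le>\<mu>. C i j) * R\<^sup>2)"
      proof (rule sum_mono)
        fix j assume "j \<in> {..m}"
        then have j: "j \<le> m" by simp
        have "jint (a + real j) (b + real j) (\<lambda>x. (E j x)\<^sup>2)
          \<le> real (card {..\<mu>}) * (\<Sum>i\<le>\<mu>. jint (a + real j) (b + real j) (\<lambda>x. (k i N * D i j x)\<^sup>2))"
          unfolding E_def using LD j by (intro jint_square_sum_le) auto
        also have "\<dots> \<le> real (card {..\<mu>}) * (\<Sum>i\<le>\<mu>. C i j * R\<^sup>2)"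
        proof (intro mult_left_mono sum_mono)
          fix i assume "i \<in> {..\<mu>}"
          then have i: "i \<le> \<mu>" by simp
          have "jint (a + real j) (b + real j) (\<lambda>x. (k i N * D i j x)\<^sup>2)
            = (k i N)\<^sup>2 * jint (a + real j) (b + real j) (\<lambda>x. (D i j x)\<^sup>2)"
            by (simp add: power_mult_distrib)
          also have "\<dots> \<le> C i j * (real N powr (2 * real j - \<rho> * \<theta>) * ln (real N) ^ (2 * \<nu>))"
            using J[OF i j] unfolding D_def .
          also have "\<dots> \<le> C i j * (real N powr (2 * real m - \<rho> * \<theta>) * ln (real N) ^ (2 * \<nu>))"
            using C0[OF i j] j N by (intro mult_left_mono mult_right_mono powr_mono) auto
          also have "real N powr (2 * real m - \<rho> * \<theta>) * ln (real N) ^ (2 * \<nu>) = R\<^sup>2"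
          proof -
            have "real N powr (2 * real m - \<rho> * \<theta>)
                = real N powr (real m - \<rho> * \<theta> / 2) * real N powr (real m - \<rho> * \<theta> / 2)"
              unfolding powr_add[symmetric] by simp
            moreover have "ln (real N) ^ (2 * \<nu>) = ln (real N) ^ \<nu> * ln (real N) ^ \<nu>"
              by (simp add: mult_2 power_add)
            ultimately show ?thesis by (simp add: R_def power2_eq_square)
          qed
          finally show "jint (a + real j) (b + real j) (\<lambda>x. (k i N * D i j x)\<^sup>2) \<le> C i j * R\<^sup>2" .
        qed simp
        finally show "jint (a + real j) (b + real j) (\<lambda>x. (E j x)\<^sup>2)
            \<le> real (Suc \<mu>) * (\<Sum>i\<le>\<mu>. C i j) * R\<^sup>2"
          by (simp only: card_atMost sum_distrib_right[symmetric] mult.assoc)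
      qed
      then show "(\<Sum>j\<le>m. jint (a + real j) (b + real j) (\<lambda>x. (E j x)\<^sup>2)) \<le> M * R\<^sup>2"
        by (simp only: M_def sum_distrib_right)
    qed
    also have "\<dots> = sqrt M * \<bar>R\<bar>" by (simp add: real_sqrt_mult)
    finally have "jacobi_sobolev_norm m a b (\<lambda>x. f x - jacobi_proj a b f N x) \<le> sqrt M * \<bar>R\<bar>" .
    moreover have "jacobi_sobolev_norm m a b (\<lambda>x. f x - jacobi_proj a b f N x) \<ge> 0"
    proof -
      have "(LINT x:{-1<..<1}|lborel. jacobi_weight a b x * (v x)\<^sup>2) \<ge> 0" for a b v
        unfolding set_lebesgue_integral_def by (intro integral_nonneg_AE AE_I2) simp
      then show ?thesis unfolding jacobi_sobolev_norm_def by (intro real_sqrt_ge_zero sum_nonneg)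
    qed
    ultimately show ?case by (simp add: R_def)
  qed
  then show ?thesis by (rule bigoI)
qed

lemma ln_scale: "N > 0 \<Longrightarrow> ln (scale N) = - \<rho> * ln (real N)"
  by (simp add: scale_def ln_powr)

lemma ln_scale_power_le:
  assumes "N \<ge> 3" "l \<le> \<nu>"
  shows "(c * ln (scale N) ^ l)\<^sup>2 \<le> (c * \<rho> ^ l)\<^sup>2 * ln (real N) ^ (2 * \<nu>)"
proof -
  \<comment> \<open>From N = 3 on, ln N is at least 1, so its powers increase with the
    exponent.\<close>
  have "ln (real N) \<ge> ln 3" using assms by (subst ln_le_cancel_iff) auto
  then have ln: "ln (real N) \<ge> 1" using ln3_gt_1 by linarith
  have "(c * ln (scale N) ^ l)\<^sup>2 = (c * \<rho> ^ l)\<^sup>2 * ln (real N) ^ (2 * l)"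
  proof -
    have "(ln (scale N) ^ l)\<^sup>2 = (ln (scale N))\<^sup>2 ^ l" by (simp add: power_mult[symmetric] mult.commute)
    also have "\<dots> = (\<rho> ^ l)\<^sup>2 * ln (real N) ^ (2 * l)"
      using assms by (simp add: ln_scale power_mult_distrib power_mult[symmetric] mult.commute)
    finally show ?thesis by (simp add: power_mult_distrib)
  qed
  also have "\<dots> \<le> (c * \<rho> ^ l)\<^sup>2 * ln (real N) ^ (2 * \<nu>)"
    using ln assms by (intro mult_left_mono power_increasing) auto
  finally show ?thesis .
qed

lemma singular_log_block:
  assumes gs: "smooth_seq gs" and j: "j \<le> m" and l: "l \<le> \<nu>"
  shows "\<exists>C\<ge>0. \<forall>\<^sub>F N in sequentially.
      rate_bound \<nu> j (c * ln (scale N) ^ l) (fsing gs z \<gamma> p (scale N)) C N"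
proof -
  obtain C where C: "C \<ge> 0" and ev: "\<forall>\<^sub>F N in sequentially.
    jacobi_L2 (a + real j) (b + real j) (fsing gs z \<gamma> p (scale N) j) \<and>
    proj_err j a b N (fsing gs z \<gamma> p (scale N))
      \<le> C * real N powr (2 * real j - \<rho> * \<theta>)"
    using singular_block[OF gs j] by blast
  have "\<forall>\<^sub>F N in sequentially.
      rate_bound \<nu> j (c * ln (scale N) ^ l) (fsing gs z \<gamma> p (scale N)) ((c * \<rho> ^ l)\<^sup>2 * C) N"
    using ev eventually_ge_at_top[of 3]
  proof eventually_elim
    case (elim N)
    let ?J = "proj_err j a b N (fsing gs z \<gamma> p (scale N))"
    have "ln (real N) ^ (2 * \<nu>) \<ge> 0" by (simp add: power_mult)
    then have "(c * ln (scale N) ^ l)\<^sup>2 * ?J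
      \<le> ((c * \<rho> ^ l)\<^sup>2 * ln (real N) ^ (2 * \<nu>)) * (C * real N powr (2 * real j - \<rho> * \<theta>))"
      using elim by (intro mult_mono ln_scale_power_le l) auto
    also have "\<dots> = ((c * \<rho> ^ l)\<^sup>2 * C) * (real N powr (2 * real j - \<rho> * \<theta>) * ln (real N) ^ (2 * \<nu>))"
      by (simp only: mult_ac)
    finally show ?case using elim(1) by (intro conjI) auto
  qed
  moreover have "(c * \<rho> ^ l)\<^sup>2 * C \<ge> 0" using C by simp
  ultimately show ?thesis by (intro exI conjI)
qed

lemma singular_bigo:
  assumes gs: "smooth_seq gs"
    and f: "\<And>x. x \<in> {-1<..<1} \<Longrightarrow> f x = \<bar>x - z\<bar> powr \<gamma> * ln \<bar>x - z\<bar> ^ \<mu> * gs 0 x"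
  shows "(\<lambda>N. jacobi_sobolev_norm m a b (\<lambda>x. f x - jacobi_proj a b f N x))
    \<in> O(\<lambda>N. real N powr (real m - \<rho> * \<theta> / 2) * ln (real N) ^ \<mu>)"
proof (rule sobolev_norm_bigo[where k = "\<lambda>i N. real (\<mu> choose i) * ln (scale N) ^ (\<mu> - i)"
      and B = "\<lambda>i N. fsing gs z \<gamma> (monom 1 i) (scale N)" and \<mu> = \<mu>])
  fix N :: nat and x :: real assume N: "N > 0" and x: "x \<in> {-1<..<1} - {z}"
  show "f x = (\<Sum>i\<le>\<mu>. real (\<mu> choose i) * ln (scale N) ^ (\<mu> - i) * fsing gs z \<gamma> (monom 1 i) (scale N) 0 x)"
    unfolding fsing_monom_0 using f[of x] x power_log_split[OF scale_pos[OF N], of "\<bar>x - z\<bar>" \<gamma> \<mu> "gs 0 x"]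
    by simp
  show "(fsing gs z \<gamma> (monom 1 i) (scale N) l has_real_derivative fsing gs z \<gamma> (monom 1 i) (scale N) (Suc l) x) (at x)"
    for i l by (intro fsing_deriv_at gs scale_pos N x)
qed (intro singular_log_block gs; simp)

text \<open>For the term \<open>i = 0\<close> the log power is largest, but when \<open>\<bar>x - z\<bar>\<^sup>\<gamma>\<close> is smooth this term
  is approximated to any order, which removes one logarithm.\<close>

lemma singular_bigo_smooth:
  assumes gs: "smooth_seq gs" and hs: "smooth_seq hs" and \<mu>: "\<mu> > 0"
    and f: "\<And>x. x \<in> {-1<..<1} \<Longrightarrow> f x = \<bar>x - z\<bar> powr \<gamma> * ln \<bar>x - z\<bar> ^ \<mu> * gs 0 x"
    and h: "\<And>x. x \<in> {-1<..<1} - {z} \<Longrightarrow> hs 0 x = \<bar>x - z\<bar> powr \<gamma> * gs 0 x"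
  shows "(\<lambda>N. jacobi_sobolev_norm m a b (\<lambda>x. f x - jacobi_proj a b f N x))
    \<in> O(\<lambda>N. real N powr (real m - \<rho> * \<theta> / 2) * ln (real N) ^ (\<mu> - 1))"
proof -
  define B where "B i N = (if i = 0 then hs else fsing gs z \<gamma> (monom 1 i) (scale N))" for i N
  show ?thesis
  proof (rule sobolev_norm_bigo[where k = "\<lambda>i N. real (\<mu> choose i) * ln (scale N) ^ (\<mu> - i)"
        and B = B and \<mu> = \<mu>])
    fix N :: nat and x :: real assume N: "N > 0" and x: "x \<in> {-1<..<1} - {z}"
    show "f x = (\<Sum>i\<le>\<mu>. real (\<mu> choose i) * ln (scale N) ^ (\<mu> - i) * B i N 0 x)"
      using f[of x] x power_log_split[OF scale_pos[OF N], of "\<bar>x - z\<bar>" \<gamma> \<mu> "gs 0 x"] h[OF x]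
      by (auto simp: fsing_monom_0 B_def intro!: sum.cong)
    have "(hs l has_real_derivative hs (Suc l) x) (at x)" for l
      using smooth_seq_deriv[OF hs, of x l] x at_within_Icc_at[of "-1" x 1] by auto
    then show "(B i N l has_real_derivative B i N (Suc l) x) (at x)" for i l
      using fsing_deriv_at[OF gs scale_pos[OF N] x] by (simp add: B_def)
  next
    fix i j assume i: "i \<le> \<mu>" and j: "j \<le> m"
    show "\<exists>C\<ge>0. \<forall>\<^sub>F N in sequentially.
        rate_bound (\<mu> - 1) j (real (\<mu> choose i) * ln (scale N) ^ (\<mu> - i)) (B i N) C N"
    proof (cases "i = 0")
      case False
      then show ?thesis using singular_log_block[OF gs j, of "\<mu> - i" "\<mu> - 1"] by (simp add: B_def)
    next
      case True
      let ?J = "\<lambda>N. proj_err j a b N hs"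
      \<comment> \<open>The rate of the smooth block can be prescribed; the extra \<open>- 2\<close>
        absorbs the two surplus factors ln N, each of which is at most N.\<close>
      obtain C where C: "C \<ge> 0" and ev: "\<forall>\<^sub>F N in sequentially. ?J N \<le> C * real N powr (2 * real j - \<rho> * \<theta> - 2)"
        using smooth_block[OF ab hs] by blast
      from ev eventually_ge_at_top[of 3]
      have "\<forall>\<^sub>F N in sequentially. (ln (scale N) ^ \<mu>)\<^sup>2 * ?J N
          \<le> ((\<rho> ^ \<mu>)\<^sup>2 * C) * (real N powr (2 * real j - \<rho> * \<theta>) * ln (real N) ^ (2 * (\<mu> - 1)))"
      proof eventually_elim
        case (elim N)
        have ln0: "ln (real N) \<ge> 0" "ln (real N) \<le> real N"
          using elim ln_le_minus_one[of "real N"] by auto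
        have "ln (real N) ^ (2 * \<mu>) = ln (real N) ^ (2 * (\<mu> - 1)) * (ln (real N))\<^sup>2"
          using \<mu> by (cases \<mu>) (simp_all add: power2_eq_square)
        then have "ln (real N) ^ (2 * \<mu>) * real N powr (2 * real j - \<rho> * \<theta> - 2)
            = ln (real N) ^ (2 * (\<mu> - 1)) * (ln (real N))\<^sup>2 * real N powr (2 * real j - \<rho> * \<theta> - 2)" by simp
        also have "ln (real N) ^ (2 * (\<mu> - 1)) * (ln (real N))\<^sup>2 * real N powr (2 * real j - \<rho> * \<theta> - 2)
            \<le> ln (real N) ^ (2 * (\<mu> - 1)) * (real N)\<^sup>2 * real N powr (2 * real j - \<rho> * \<theta> - 2)"
          using elim ln0 by (intro mult_right_mono mult_left_mono power_mono) auto
        also have "\<dots> = ln (real N) ^ (2 * (\<mu> - 1)) * ((real N)\<^sup>2 * real N powr (2 * real j - \<rho> * \<theta> - 2))"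
          by (simp only: mult.assoc)
        also have "(real N)\<^sup>2 * real N powr (2 * real j - \<rho> * \<theta> - 2) = real N powr (2 * real j - \<rho> * \<theta>)"
          using elim by (simp add: powr_diff)
        finally have A: "ln (real N) ^ (2 * \<mu>) * real N powr (2 * real j - \<rho> * \<theta> - 2)
            \<le> ln (real N) ^ (2 * (\<mu> - 1)) * real N powr (2 * real j - \<rho> * \<theta>)" .
        have "(1 * ln (scale N) ^ \<mu>)\<^sup>2 * ?J N
          \<le> ((1 * \<rho> ^ \<mu>)\<^sup>2 * ln (real N) ^ (2 * \<mu>)) * (C * real N powr (2 * real j - \<rho> * \<theta> - 2))"
          using elim ln0 by (intro mult_mono ln_scale_power_le order_refl) auto
        also have "\<dots> = ((\<rho> ^ \<mu>)\<^sup>2 * C) * (ln (real N) ^ (2 * \<mu>) * real N powr (2 * real j - \<rho> * \<theta> - 2))"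
          by simp
        also have "\<dots> \<le> ((\<rho> ^ \<mu>)\<^sup>2 * C) * (ln (real N) ^ (2 * (\<mu> - 1)) * real N powr (2 * real j - \<rho> * \<theta>))"
          using C by (intro mult_left_mono A) simp
        finally show ?case by (simp only: mult_1 mult.commute mult.left_commute)
      qed
      moreover have "jacobi_L2 (a + real j) (b + real j) (hs j)"
        using ab by (intro jacobi_L2_continuous smooth_seq_measurable smooth_seq_continuous hs) auto
      moreover have "(\<rho> ^ \<mu>)\<^sup>2 * C \<ge> 0" using C by simp
      ultimately show ?thesis using True by (auto simp: B_def)
    qed
  qed
qed

end

section \<open>Smooth factors and the three positions of the singularity\<close>

lemma leib_continuous:
  "(\<And>i. continuous_on S (A i)) \<Longrightarrow> (\<And>i. continuous_on S (B i)) \<Longrightarrow> continuous_on S (leib k A B)"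
  by (induction k arbitrary: A B) (auto intro!: continuous_intros)

lemma smooth_on_imp_smooth_seq:
  assumes "smooth_on {-1..1} g"
  obtains gs where "smooth_seq gs" "\<And>x. x \<in> {-1..1} \<Longrightarrow> gs 0 x = g x"
proof -
  obtain D where D0: "\<forall>x\<in>{-1..1}. D 0 x = g x"
    and D: "\<forall>k. \<forall>x\<in>{-1..1}. (D k has_real_derivative D (Suc k) x) (at x within {-1..1})"
    using assms unfolding smooth_on_def by blast
  \<comment> \<open>Constant extension beyond the end points makes every term continuous on the line
    and leaves the derivatives within the interval untouched.\<close>
  define gs where "gs = (\<lambda>k x. D k (max (-1) (min 1 x)))"
  have eq: "gs k x = D k x" if "x \<in> {-1..1}" for k x using that by (simp add: gs_def)
  have "continuous_on {-1..1} (D k)" for k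
    using D by (auto intro: DERIV_continuous_on)
  then have "continuous_on UNIV (gs k)" for k
    unfolding gs_def by (rule continuous_on_compose2[of "{-1..1}" "D k"]) (auto intro!: continuous_intros)
  moreover have "(gs k has_real_derivative gs (Suc k) x) (at x within {-1..1})" if "x \<in> {-1..1}" for k x
    unfolding eq[OF that]
    by (rule has_field_derivative_transform_within[of "D k", OF _ zero_less_one that]) (use D that eq in auto)
  ultimately have "smooth_seq gs" by (auto simp: smooth_seq_def)
  then show ?thesis using that eq D0 by simp
qed

lemma smooth_seq_poly_mult:
  assumes gs: "smooth_seq gs"
  shows "smooth_seq (\<lambda>k. leib k (\<lambda>i. poly ((pderiv ^^ i) q)) gs)"
proof -
  have d: "(poly ((pderiv ^^ i) q) has_real_derivative poly ((pderiv ^^ Suc i) q) x) (at x within S)" for i x S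
    by (simp add: DERIV_subset[OF poly_DERIV])
  have c: "continuous_on UNIV (poly ((pderiv ^^ i) q))" for i
    by (auto intro: continuous_intros)
  show ?thesis unfolding smooth_seq_def
  proof (intro conjI allI ballI)
    show "continuous_on UNIV (leib k (\<lambda>i. poly ((pderiv ^^ i) q)) gs)" for k
      by (rule leib_continuous[OF c smooth_seq_continuous[OF gs]])
    show "(leib k (\<lambda>i. poly ((pderiv ^^ i) q)) gs has_real_derivative
        leib (Suc k) (\<lambda>i. poly ((pderiv ^^ i) q)) gs x) (at x within {-1..1})"
      if "x \<in> {-1..1}" for k x
      by (rule leib_deriv) (rule d smooth_seq_deriv[OF gs that])+
  qed
qed

text \<open>\<open>t\<close> is the distance to the singular end and \<open>s\<close> the distance
  to the other end, which lies in [1, 2] here; the exponent \<open>q\<close> may have either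
  sign.\<close>

lemma powr_mult_le_near:
  assumes "0 < s" "0 \<le> t" "t \<le> 1" "s + t = 2" "\<bar>q\<bar> \<le> Q"
  shows "t powr p * s powr q \<le> 2 powr Q * t powr (p :: real)"
proof -
  have "s powr q \<le> 2 powr \<bar>q\<bar>" using assms by (intro powr_le_2_powr_abs) auto
  also have "\<dots> \<le> 2 powr Q" using assms by (intro powr_mono) auto
  finally show ?thesis using mult_left_mono[of "s powr q" "2 powr Q" "t powr p"] by (simp add: mult.commute)
qed

lemma powr_mult_le_far:
  assumes "0 < s" "s \<le> 2" "0 \<le> q"
  shows "t powr p * s powr q \<le> 2 powr q * t powr (p :: real)"
  using powr_mono2[of q s 2] assms mult_left_mono[of "s powr q" "2 powr q" "t powr p"]
  by (simp add: mult.commute)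

text \<open>Each derivative raises the exponent of 1 - x by one, hence \<open>\<kappa> = 1\<close>
  and \<open>\<rho> = 2\<close>. The factor 1 + x is harmless near 1; to bound it on the whole
  interval its exponent must be nonnegative, which holds after at least one derivative since
  \<open>\<beta>\<close> exceeds -1.\<close>

lemma jacobi_singular_right:
  assumes ab: "\<alpha> > -1" "\<beta> > -1" and "\<alpha> + 2 * \<gamma> > real m - 1"
  shows "jacobi_singular \<alpha> \<beta> 1 \<gamma> \<alpha> 1 2 m"
proof
  show "\<exists>h0>0. \<exists>c\<ge>0. \<forall>j\<le>m. \<forall>x\<in>{-1<..<1}. x \<noteq> 1 \<longrightarrow> \<bar>x - 1\<bar> \<le> h0 \<longrightarrow>
      jacobi_weight (\<alpha> + real j) (\<beta> + real j) x \<le> c * \<bar>x - 1\<bar> powr (\<alpha> + 1 * real j)"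
  proof (rule exI[of _ 1], intro exI[of _ "2 powr (\<bar>\<beta>\<bar> + real m)"] conjI allI ballI impI)
    fix j and x :: real assume "j \<le> m" "x \<in> {-1<..<1}" "\<bar>x - 1\<bar> \<le> 1"
    then show "jacobi_weight (\<alpha> + real j) (\<beta> + real j) x
        \<le> 2 powr (\<bar>\<beta>\<bar> + real m) * \<bar>x - 1\<bar> powr (\<alpha> + 1 * real j)"
      using powr_mult_le_near[of "1 + x" "1 - x" "\<beta> + real j" "\<bar>\<beta>\<bar> + real m" "\<alpha> + real j"]
      by (simp add: jacobi_weight_def)
  qed auto
  show "\<exists>c\<ge>0. \<forall>x\<in>{-1<..<1}. x \<noteq> 1 \<longrightarrow>
      jacobi_weight (\<alpha> + real K) (\<beta> + real K) x \<le> c * \<bar>x - 1\<bar> powr (\<alpha> + 1 * real K)" if "K > 0" for K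
    using powr_mult_le_far[of "1 + x" "\<beta> + real K" "1 - x" "\<alpha> + real K" for x] that ab
    by (intro exI[of _ "2 powr (\<beta> + real K)"]) (auto simp: jacobi_weight_def)
qed (use assms in auto)

lemma jacobi_singular_left:
  assumes ab: "\<alpha> > -1" "\<beta> > -1" and "\<beta> + 2 * \<delta> > real m - 1"
  shows "jacobi_singular \<alpha> \<beta> (-1) \<delta> \<beta> 1 2 m"
proof
  show "\<exists>h0>0. \<exists>c\<ge>0. \<forall>j\<le>m. \<forall>x\<in>{-1<..<1}. x \<noteq> -1 \<longrightarrow> \<bar>x - (-1)\<bar> \<le> h0 \<longrightarrow>
      jacobi_weight (\<alpha> + real j) (\<beta> + real j) x \<le> c * \<bar>x - (-1)\<bar> powr (\<beta> + 1 * real j)"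
  proof (rule exI[of _ 1], intro exI[of _ "2 powr (\<bar>\<alpha>\<bar> + real m)"] conjI allI ballI impI)
    fix j and x :: real assume "j \<le> m" "x \<in> {-1<..<1}" "\<bar>x - (-1)\<bar> \<le> 1"
    then show "jacobi_weight (\<alpha> + real j) (\<beta> + real j) x
        \<le> 2 powr (\<bar>\<alpha>\<bar> + real m) * \<bar>x - (-1)\<bar> powr (\<beta> + 1 * real j)"
      using powr_mult_le_near[of "1 - x" "1 + x" "\<alpha> + real j" "\<bar>\<alpha>\<bar> + real m" "\<beta> + real j"]
      by (simp add: jacobi_weight_def mult.commute add.commute)
  qed auto
  show "\<exists>c\<ge>0. \<forall>x\<in>{-1<..<1}. x \<noteq> -1 \<longrightarrow>
      jacobi_weight (\<alpha> + real K) (\<beta> + real K) x \<le> c * \<bar>x - (-1)\<bar> powr (\<beta> + 1 * real K)" if "K > 0" for K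
    using powr_mult_le_far[of "1 - x" "\<alpha> + real K" "1 + x" "\<beta> + real K" for x] that ab
    by (intro exI[of _ "2 powr (\<alpha> + real K)"]) (auto simp: jacobi_weight_def mult.commute add.commute)
qed (use assms in auto)

text \<open>Near \<open>z\<close> the weight is bounded, and raising its parameters does not change
  this: hence \<open>a' = 0\<close>, \<open>\<kappa> = 0\<close> and
  \<open>\<rho> = 1\<close>.\<close>

lemma jacobi_singular_interior:
  assumes ab: "\<alpha> > -1" "\<beta> > -1" and z: "z \<in> {-1<..<1}" and "s > real m - 1 / 2"
  shows "jacobi_singular \<alpha> \<beta> z s 0 0 1 m"
proof
  \<comment> \<open>Half the distance to the nearer end, so that the closed interval around
    \<open>z\<close> stays inside the open one.\<close>
  define h where "h = min (1 - z) (1 + z) / 2"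
  have h: "h > 0" using z by (simp add: h_def)
  have "h < 1 - z" "h < 1 + z" using z by (auto simp: h_def min_def)
  then have sub: "x \<in> {-1<..<1}" if "x \<in> {z - h..z + h}" for x using that by auto
  have "\<exists>c\<ge>0. \<forall>x. x \<in> {z - h..z + h} \<longrightarrow> jacobi_weight (\<alpha> + real j) (\<beta> + real j) x \<le> c * 1" for j
  proof -
    have "continuous_on {z - h..z + h} (jacobi_weight (\<alpha> + real j) (\<beta> + real j))"
      unfolding jacobi_weight_def[abs_def] using sub by (intro continuous_intros) force+
    then have "bounded (jacobi_weight (\<alpha> + real j) (\<beta> + real j) ` {z - h..z + h})"
      by (intro compact_imp_bounded compact_continuous_image) auto
    then obtain B where "\<forall>x\<in>{z - h..z + h}. norm (jacobi_weight (\<alpha> + real j) (\<beta> + real j) x) \<le> B"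
      unfolding bounded_iff by auto
    then show ?thesis by (intro exI[of _ "max 0 B"]) (auto simp: le_max_iff_disj)
  qed
  then obtain c where c: "c \<ge> 0" "\<forall>j\<le>m. \<forall>x. x \<in> {z - h..z + h} \<longrightarrow>
      jacobi_weight (\<alpha> + real j) (\<beta> + real j) x \<le> c * 1"
    using finite_uniform_bound[of m "\<lambda>_ x. x \<in> {z - h..z + h}"
        "\<lambda>j. jacobi_weight (\<alpha> + real j) (\<beta> + real j)" "\<lambda>_ _. 1"] by auto
  show "\<exists>h0>0. \<exists>c\<ge>0. \<forall>j\<le>m. \<forall>x\<in>{-1<..<1}. x \<noteq> z \<longrightarrow> \<bar>x - z\<bar> \<le> h0 \<longrightarrow>
      jacobi_weight (\<alpha> + real j) (\<beta> + real j) x \<le> c * \<bar>x - z\<bar> powr (0 + 0 * real j)"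
  proof (rule exI[of _ h], intro exI[of _ c] conjI allI ballI impI h c(1))
    fix j and x :: real assume j: "j \<le> m" and x: "x \<noteq> z" "\<bar>x - z\<bar> \<le> h"
    then have "x \<in> {z - h..z + h}" by auto
    then show "jacobi_weight (\<alpha> + real j) (\<beta> + real j) x \<le> c * \<bar>x - z\<bar> powr (0 + 0 * real j)"
      using c(2) j x by simp
  qed
  show "\<exists>c\<ge>0. \<forall>x\<in>{-1<..<1}. x \<noteq> z \<longrightarrow>
      jacobi_weight (\<alpha> + real K) (\<beta> + real K) x \<le> c * \<bar>x - z\<bar> powr (0 + 0 * real K)" if K: "K > 0" for K
  proof (intro exI[of _ "2 powr (\<alpha> + real K) * 2 powr (\<beta> + real K)"] conjI ballI impI)
    fix x :: real assume x: "x \<in> {-1<..<1}" "x \<noteq> z"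
    have "(1 - x) powr (\<alpha> + real K) * (1 + x) powr (\<beta> + real K) \<le> 2 powr (\<alpha> + real K) * 2 powr (\<beta> + real K)"
      using x K ab by (intro mult_mono powr_mono2) auto
    then show "jacobi_weight (\<alpha> + real K) (\<beta> + real K) x
        \<le> 2 powr (\<alpha> + real K) * 2 powr (\<beta> + real K) * \<bar>x - z\<bar> powr (0 + 0 * real K)"
      using x by (simp add: jacobi_weight_def)
  qed auto
qed (use assms in auto)

text \<open>On the interval the distance to an end point is the polynomial 1 - z x, so its natural
  powers are smooth. Negative powers, and odd powers of the distance to an interior point, are
  not.\<close>

lemma smooth_seq_endpoint:
  assumes gs: "smooth_seq gs" and z: "z = 1 \<or> z = (-1 :: real)" and \<gamma>: "\<gamma> \<in> \<nat>"
  shows "\<exists>hs. smooth_seq hs \<and> (\<forall>x\<in>{-1<..<1}. hs 0 x = \<bar>x - z\<bar> powr \<gamma> * gs 0 x)"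
proof -
  obtain n where n: "\<gamma> = real n" using \<gamma> by (auto elim: Nats_cases)
  have "(1 - z * x) ^ n = \<bar>x - z\<bar> powr \<gamma>" if "x \<in> {-1<..<1}" for x
  proof -
    have "\<bar>x - z\<bar> = 1 - z * x" "\<bar>x - z\<bar> > 0" using z that by auto
    then show ?thesis by (simp add: n powr_realpow)
  qed
  then have "\<forall>x\<in>{-1<..<1}. leib 0 (\<lambda>i. poly ((pderiv ^^ i) ([:1, - z:] ^ n))) gs x = \<bar>x - z\<bar> powr \<gamma> * gs 0 x"
    by (simp add: mult.commute)
  with smooth_seq_poly_mult[OF gs] show ?thesis by blast
qed

theorem theorem5:
  fixes \<alpha> \<beta> :: real and m \<mu> :: nat and g :: "real \<Rightarrow> real"
  assumes "\<alpha> > -1" and "\<beta> > -1" and "smooth_on {-1..1} g"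
  shows
    "(\<forall>(\<gamma>::real) f.
        min (\<alpha> + \<gamma>) (\<alpha> + 2 * \<gamma>) > real m - 1 \<and>
        (\<forall>x\<in>{-1<..<1}. f x = (1 - x) powr \<gamma> * (ln (1 - x)) ^ \<mu> * g x) \<longrightarrow>
        (\<forall>N. (\<lambda>x. f x - jacobi_proj \<alpha> \<beta> f N x) \<in> jacobi_sobolev m \<alpha> \<beta>) \<and>
        (\<lambda>N. jacobi_sobolev_norm m \<alpha> \<beta> (\<lambda>x. f x - jacobi_proj \<alpha> \<beta> f N x))
          \<in> O(\<lambda>N. real N powr (real m - \<alpha> - 2 * \<gamma> - 1) * (ln (real N)) ^ \<mu>) \<and>
        (\<mu> > 0 \<and> \<gamma> \<in> \<nat> \<longrightarrow>
          (\<lambda>N. jacobi_sobolev_norm m \<alpha> \<beta> (\<lambda>x. f x - jacobi_proj \<alpha> \<beta> f N x))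
            \<in> O(\<lambda>N. real N powr (real m - \<alpha> - 2 * \<gamma> - 1) * (ln (real N)) ^ (\<mu> - 1)))) \<and>
     (\<forall>(z0::real) (s::real) f.
        z0 \<in> {-1<..<1} \<and> s > real m - 1 / 2 \<and> min \<alpha> \<beta> \<ge> -(1 / 2) \<and>
        (\<forall>x\<in>{-1<..<1}. f x = \<bar>x - z0\<bar> powr s * (ln \<bar>x - z0\<bar>) ^ \<mu> * g x) \<longrightarrow>
        (\<forall>N. (\<lambda>x. f x - jacobi_proj \<alpha> \<beta> f N x) \<in> jacobi_sobolev m \<alpha> \<beta>) \<and>
        (\<lambda>N. jacobi_sobolev_norm m \<alpha> \<beta> (\<lambda>x. f x - jacobi_proj \<alpha> \<beta> f N x))
          \<in> O(\<lambda>N. real N powr (real m - s - 1 / 2) * (ln (real N)) ^ \<mu>)) \<and>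
     (\<forall>(\<delta>::real) f.
        min (\<beta> + \<delta>) (\<beta> + 2 * \<delta>) > real m - 1 \<and>
        (\<forall>x\<in>{-1<..<1}. f x = (1 + x) powr \<delta> * (ln (1 + x)) ^ \<mu> * g x) \<longrightarrow>
        (\<forall>N. (\<lambda>x. f x - jacobi_proj \<alpha> \<beta> f N x) \<in> jacobi_sobolev m \<alpha> \<beta>) \<and>
        (\<lambda>N. jacobi_sobolev_norm m \<alpha> \<beta> (\<lambda>x. f x - jacobi_proj \<alpha> \<beta> f N x))
          \<in> O(\<lambda>N. real N powr (real m - \<beta> - 2 * \<delta> - 1) * (ln (real N)) ^ \<mu>) \<and>
        (\<mu> > 0 \<and> \<delta> \<in> \<nat> \<longrightarrow>
          (\<lambda>N. jacobi_sobolev_norm m \<alpha> \<beta> (\<lambda>x. f x - jacobi_proj \<alpha> \<beta> f N x))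
            \<in> O(\<lambda>N. real N powr (real m - \<beta> - 2 * \<delta> - 1) * (ln (real N)) ^ (\<mu> - 1))))"
proof -
  note ab = assms(1,2)
  obtain gs where gs: "smooth_seq gs" and gs0: "\<And>x. x \<in> {-1..1} \<Longrightarrow> gs 0 x = g x"
    using smooth_on_imp_smooth_seq[OF assms(3)] by blast
  show ?thesis
  proof (intro conjI allI impI; elim conjE)
    fix \<gamma> f
    assume "min (\<alpha> + \<gamma>) (\<alpha> + 2 * \<gamma>) > real m - 1"
      and f: "\<forall>x\<in>{-1<..<1}. f x = (1 - x) powr \<gamma> * (ln (1 - x)) ^ \<mu> * g x"
    then interpret jacobi_singular \<alpha> \<beta> 1 \<gamma> \<alpha> 1 2 m by (intro jacobi_singular_right ab) auto
    have f': "f x = \<bar>x - 1\<bar> powr \<gamma> * ln \<bar>x - 1\<bar> ^ \<mu> * gs 0 x" if "x \<in> {-1<..<1}" for x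
      using f that gs0[of x] by simp
    have e: "real m - \<alpha> - 2 * \<gamma> - 1 = real m - 2 * \<theta> / 2" by (simp add: \<theta>_def field_simps)
    \<comment> \<open>The pointwise condition on the exponent concerns interior singularities and is
      vacuous at an end point.\<close>
    show "(\<lambda>x. f x - jacobi_proj \<alpha> \<beta> f N x) \<in> jacobi_sobolev m \<alpha> \<beta>" for N
      by (rule singular_sobolev_mem[OF gs _ f']) auto
    show "(\<lambda>N. jacobi_sobolev_norm m \<alpha> \<beta> (\<lambda>x. f x - jacobi_proj \<alpha> \<beta> f N x))
          \<in> O(\<lambda>N. real N powr (real m - \<alpha> - 2 * \<gamma> - 1) * (ln (real N)) ^ \<mu>)"
      unfolding e by (rule singular_bigo[OF gs f'])
    show "(\<lambda>N. jacobi_sobolev_norm m \<alpha> \<beta> (\<lambda>x. f x - jacobi_proj \<alpha> \<beta> f N x))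
          \<in> O(\<lambda>N. real N powr (real m - \<alpha> - 2 * \<gamma> - 1) * (ln (real N)) ^ (\<mu> - 1))"
      if pos: "\<mu> > 0" and nat: "\<gamma> \<in> \<nat>"
    proof -
      obtain hs where hs: "smooth_seq hs" "\<And>x. x \<in> {-1<..<1} \<Longrightarrow> hs 0 x = \<bar>x - 1\<bar> powr \<gamma> * gs 0 x"
        using smooth_seq_endpoint[OF gs _ nat, of 1] by auto
      show ?thesis unfolding e
        by (rule singular_bigo_smooth[OF gs hs(1) pos f']) (use hs(2) in auto)
    qed
  next
    fix \<delta> f
    assume "min (\<beta> + \<delta>) (\<beta> + 2 * \<delta>) > real m - 1"
      and f: "\<forall>x\<in>{-1<..<1}. f x = (1 + x) powr \<delta> * (ln (1 + x)) ^ \<mu> * g x"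
    then interpret jacobi_singular \<alpha> \<beta> "-1" \<delta> \<beta> 1 2 m by (intro jacobi_singular_left ab) auto
    have f': "f x = \<bar>x - (-1)\<bar> powr \<delta> * ln \<bar>x - (-1)\<bar> ^ \<mu> * gs 0 x" if "x \<in> {-1<..<1}" for x
      using f that gs0[of x] by (simp add: add.commute)
    have e: "real m - \<beta> - 2 * \<delta> - 1 = real m - 2 * \<theta> / 2" by (simp add: \<theta>_def field_simps)
    show "(\<lambda>x. f x - jacobi_proj \<alpha> \<beta> f N x) \<in> jacobi_sobolev m \<alpha> \<beta>" for N
      by (rule singular_sobolev_mem[OF gs _ f']) auto
    show "(\<lambda>N. jacobi_sobolev_norm m \<alpha> \<beta> (\<lambda>x. f x - jacobi_proj \<alpha> \<beta> f N x))
          \<in> O(\<lambda>N. real N powr (real m - \<beta> - 2 * \<delta> - 1) * (ln (real N)) ^ \<mu>)"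
      unfolding e by (rule singular_bigo[OF gs f'])
    show "(\<lambda>N. jacobi_sobolev_norm m \<alpha> \<beta> (\<lambda>x. f x - jacobi_proj \<alpha> \<beta> f N x))
          \<in> O(\<lambda>N. real N powr (real m - \<beta> - 2 * \<delta> - 1) * (ln (real N)) ^ (\<mu> - 1))"
      if pos: "\<mu> > 0" and nat: "\<delta> \<in> \<nat>"
    proof -
      obtain hs where hs: "smooth_seq hs" "\<And>x. x \<in> {-1<..<1} \<Longrightarrow> hs 0 x = \<bar>x - (-1)\<bar> powr \<delta> * gs 0 x"
        using smooth_seq_endpoint[OF gs _ nat, of "-1"] by blast
      show ?thesis unfolding e
        by (rule singular_bigo_smooth[OF gs hs(1) pos f']) (use hs(2) in auto)
    qed
  next
    fix z s f
    assume z: "z \<in> {-1<..<1::real}" and s: "s > real m - 1 / 2"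
      and f: "\<forall>x\<in>{-1<..<1}. f x = \<bar>x - z\<bar> powr s * (ln \<bar>x - z\<bar>) ^ \<mu> * g x"
    interpret jacobi_singular \<alpha> \<beta> z s 0 0 1 m by (intro jacobi_singular_interior ab z s)
    have f': "f x = \<bar>x - z\<bar> powr s * ln \<bar>x - z\<bar> ^ \<mu> * gs 0 x" if "x \<in> {-1<..<1}" for x
      using f that gs0[of x] by simp
    \<comment> \<open>Here \<open>\<rho> = 1\<close> and \<open>\<theta>\<close> is 2 s + 1.\<close>
    have e: "real m - s - 1 / 2 = real m - 1 * \<theta> / 2" by (simp add: \<theta>_def field_simps)
    show "(\<lambda>x. f x - jacobi_proj \<alpha> \<beta> f N x) \<in> jacobi_sobolev m \<alpha> \<beta>" for N
      by (rule singular_sobolev_mem[OF gs s f'])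
    show "(\<lambda>N. jacobi_sobolev_norm m \<alpha> \<beta> (\<lambda>x. f x - jacobi_proj \<alpha> \<beta> f N x))
          \<in> O(\<lambda>N. real N powr (real m - s - 1 / 2) * (ln (real N)) ^ \<mu>)"
      unfolding e by (rule singular_bigo[OF gs f'])
  qed
qed

end
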